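(* Let $m\ge1$ and let $H_1:=h_m^*\in\mathcal{H}_q(\Sigma_{2m})$. Then $H_1=v^{m(2m-1)}\sum_{\epsilon\in\{\pm\}^m}I_\epsilon C_\epsilon$, where $I_\epsilon=I^{\epsilon_1}_{m\to2m-1}I^{\epsilon_2}_{m-1\to 2m-2}\cdots I^{\epsilon_m}_{1\to m}$ (the $k$-th factor being $I^{\epsilon_k}_{m+1-k\to 2m-k}$) and $C_\epsilon=\prod_{i:\ \epsilon_i=-}c_{m,m-i}$.
   Context: $K$ commutative ring, $v\in K^\times$, $q=v^2$. $\mathcal{H}^{\mathrm B}$: $K$-algebra generated by $T_0,\dots,T_{2m-1}$ with type $\mathrm B_{2m}$ braid relations, $T_0^2=1$, $T_i^2=(q-1)T_i+q$ ($i\ge1$); $\mathcal{H}=\mathcal{H}_q(\Sigma_{2m})$ is the subalgebra generated by $T_1,\dots,T_{2m-1}$; $T_w$ via reduced expressions. $T_{a\to b\to a}$ is $T_aT_{a-1}\cdots T_b\cdots T_a$ ($a>b$), $T_a$ ($a=b$), $T_a\cdots T_b\cdots T_a$ ($a<b$); $u_k^\pm=\prod_{i=0}^{k-1}(q^i\pm T_{i\to0\to i})$. $w_{m,m}\in\Sigma_{2m}$ sends $j\mapsto m+j$ and $m+j\mapsto j$ for $1\le j\le m$. $h_m$ is the unique element of $\mathcal{H}$ with $u_m^+T_{w_{m,m}}u_m^-\in u_m^+h_m+\sum_{b>m}\mathcal{H}u_b^+\mathcal{H}$ (existence and uniqueness as in the paper's definition). $*$ is the unique $K$-algebra anti-automorphism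 of $\mathcal{H}$ with $T_i^*=T_i$ for all $i$. $I_w:=v^{-\ell(w)}T_w$, $I_i:=I_{s_i}$; $I_{a\to b}:=I_aI_{a-1}\cdots I_b$ ($a>b$), $I_a$ ($a=b$), $I_aI_{a+1}\cdots I_b$ ($a<b$); $I^+_{a\to b}=I_{a\to b}$, $I^-_{a\to b}=I_{b\to a}^{-1}$. $c_{m,0}=1$, $c_{m,i}=I_{m+i\to m+1}I_{m+1\to m+i}$ ($i\ge1$), pairwise commuting. $\{\pm\}^m$ is the set of $m$-tuples of signs. *)

theory Defs
  imports Main
begin

text \<open>Concrete model of the Hecke algebra of type B_n (n = 2m) with parameters
  T_0^2 = 1 and T_i^2 = (q-1)T_i + q, as the free K-module with basis T_w,
  w in the Weyl group W(B_n), with the standard multiplication rules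
  T_s T_w = T_{sw} if l(sw) > l(w), and (q_s - 1) T_w + q_s T_{sw} otherwise.
  Elements are coefficient functions on signed permutations of {-n..n}.\<close>

definition sgen :: "nat \<Rightarrow> int \<Rightarrow> int" where
  "sgen i = (if i = 0 then (\<lambda>x. if x = 1 then -1 else if x = -1 then 1 else x)
     else (\<lambda>x. if x = int i then int i + 1 else if x = int i + 1 then int i
        else if x = - int i then - int i - 1 else if x = - int i - 1 then - int i else x))"

definition word_prod :: "nat list \<Rightarrow> int \<Rightarrow> int" where
  "word_prod ws = foldr (\<lambda>i f. sgen i \<circ> f) ws id"

definition WB :: "nat \<Rightarrow> (int \<Rightarrow> int) set" where
  "WB n = {word_prod ws | ws. set ws \<subseteq> {..<n}}"

definition WA :: "nat \<Rightarrow> (int \<Rightarrow> int) set" where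
  "WA n = {word_prod ws | ws. set ws \<subseteq> {1..<n}}"

definition blen :: "nat \<Rightarrow> (int \<Rightarrow> int) \<Rightarrow> nat" where
  "blen n w = (LEAST k. \<exists>ws. set ws \<subseteq> {..<n} \<and> length ws = k \<and> word_prod ws = w)"

definition redword :: "nat \<Rightarrow> (int \<Rightarrow> int) \<Rightarrow> nat list" where
  "redword n w = (SOME ws. set ws \<subseteq> {..<n} \<and> length ws = blen n w \<and> word_prod ws = w)"

type_synonym 'k hecke = "(int \<Rightarrow> int) \<Rightarrow> 'k"

definition qpar :: "'k::comm_ring_1 \<Rightarrow> nat \<Rightarrow> 'k" where
  "qpar q i = (if i = 0 then 1 else q)"

definition Lgen :: "nat \<Rightarrow> 'k::comm_ring_1 \<Rightarrow> nat \<Rightarrow> 'k hecke \<Rightarrow> 'k hecke" where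
  "Lgen n q i f = (\<lambda>y. if y \<notin> WB n then 0
     else if blen n (sgen i \<circ> y) < blen n y then f (sgen i \<circ> y) + (qpar q i - 1) * f y
     else qpar q i * f (sgen i \<circ> y))"

definition Lword :: "nat \<Rightarrow> 'k::comm_ring_1 \<Rightarrow> nat list \<Rightarrow> 'k hecke \<Rightarrow> 'k hecke" where
  "Lword n q ws f = foldr (Lgen n q) ws f"

definition hmul :: "nat \<Rightarrow> 'k::comm_ring_1 \<Rightarrow> 'k hecke \<Rightarrow> 'k hecke \<Rightarrow> 'k hecke" where
  "hmul n q a b = (\<lambda>y. \<Sum>w\<in>WB n. a w * Lword n q (redword n w) b y)"

definition HB :: "nat \<Rightarrow> ('k::zero) hecke set" where
  "HB n = {a. \<forall>y. a y \<noteq> 0 \<longrightarrow> y \<in> WB n}"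

definition HA :: "nat \<Rightarrow> ('k::zero) hecke set" where
  "HA n = {a. \<forall>y. a y \<noteq> 0 \<longrightarrow> y \<in> WA n}"

definition Tb :: "(int \<Rightarrow> int) \<Rightarrow> ('k::comm_ring_1) hecke" where
  "Tb w = (\<lambda>y. if y = w then 1 else 0)"

definition hone :: "('k::comm_ring_1) hecke" where
  "hone = Tb id"

definition hadd :: "('k::comm_ring_1) hecke \<Rightarrow> 'k hecke \<Rightarrow> 'k hecke" where
  "hadd a b = (\<lambda>y. a y + b y)"

definition hsmult :: "'k::comm_ring_1 \<Rightarrow> 'k hecke \<Rightarrow> 'k hecke" where
  "hsmult c a = (\<lambda>y. c * a y)"

definition hsum :: "'e set \<Rightarrow> ('e \<Rightarrow> ('k::comm_ring_1) hecke) \<Rightarrow> 'k hecke" where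
  "hsum E f = (\<lambda>y. \<Sum>e\<in>E. f e y)"

definition hprod :: "nat \<Rightarrow> 'k::comm_ring_1 \<Rightarrow> 'k hecke list \<Rightarrow> 'k hecke" where
  "hprod n q xs = foldr (hmul n q) xs hone"

definition hinv :: "nat \<Rightarrow> 'k::comm_ring_1 \<Rightarrow> 'k hecke \<Rightarrow> 'k hecke" where
  "hinv n q a = (THE b. b \<in> HB n \<and> hmul n q a b = hone \<and> hmul n q b a = hone)"

definition uinv :: "'k::comm_ring_1 \<Rightarrow> 'k" where
  "uinv v = (THE u. v * u = 1)"

definition Tarc0 :: "nat \<Rightarrow> 'k::comm_ring_1 \<Rightarrow> nat \<Rightarrow> 'k hecke" where
  "Tarc0 n q i = hprod n q (map (\<lambda>j. Tb (sgen j)) (rev [1..<i+1] @ [0] @ [1..<i+1]))"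

definition uplus :: "nat \<Rightarrow> 'k::comm_ring_1 \<Rightarrow> nat \<Rightarrow> 'k hecke" where
  "uplus n q k = hprod n q (map (\<lambda>i. hadd (hsmult (q ^ i) hone) (Tarc0 n q i)) [0..<k])"

definition uminus :: "nat \<Rightarrow> 'k::comm_ring_1 \<Rightarrow> nat \<Rightarrow> 'k hecke" where
  "uminus n q k = hprod n q (map (\<lambda>i. hadd (hsmult (q ^ i) hone) (hsmult (-1) (Tarc0 n q i))) [0..<k])"

definition wmm :: "nat \<Rightarrow> int \<Rightarrow> int" where
  "wmm m = (\<lambda>x. if 1 \<le> x \<and> x \<le> int m then x + int m
     else if int m + 1 \<le> x \<and> x \<le> 2 * int m then x - int m
     else if - int m \<le> x \<and> x \<le> -1 then x - int m
     else if - 2 * int m \<le> x \<and> x \<le> - int m - 1 then x + int m else x)"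

text \<open>sum_{b>m} H u_b^+ H  (b ranges over m < b <= n, where u_b^+ is defined).\<close>
definition Jset :: "nat \<Rightarrow> 'k::comm_ring_1 \<Rightarrow> nat \<Rightarrow> 'k hecke set" where
  "Jset n q m = {a. \<exists>xs. (\<forall>(x, b, z) \<in> set xs. x \<in> HA n \<and> z \<in> HA n \<and> m < b \<and> b \<le> n)
      \<and> a = (\<lambda>y. \<Sum>(x, b, z) \<leftarrow> xs. hmul n q (hmul n q x (uplus n q b)) z y)}"

definition hm :: "nat \<Rightarrow> 'k::comm_ring_1 \<Rightarrow> 'k hecke" where
  "hm m v = (let n = 2 * m; q = v ^ 2 in
     THE h. h \<in> HA n \<and> (\<exists>j \<in> Jset n q m.
       hmul n q (hmul n q (uplus n q m) (Tb (wmm m))) (uminus n q m) = hadd (hmul n q (uplus n q m) h) j))"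

definition anti_auto :: "nat \<Rightarrow> 'k::comm_ring_1 \<Rightarrow> ('k hecke \<Rightarrow> 'k hecke) \<Rightarrow> bool" where
  "anti_auto n q \<phi> \<longleftrightarrow> bij_betw \<phi> (HA n) (HA n) \<and> \<phi> hone = hone
     \<and> (\<forall>a \<in> HA n. \<forall>b \<in> HA n. \<phi> (hadd a b) = hadd (\<phi> a) (\<phi> b)
                         \<and> \<phi> (hmul n q a b) = hmul n q (\<phi> b) (\<phi> a))
     \<and> (\<forall>c. \<forall>a \<in> HA n. \<phi> (hsmult c a) = hsmult c (\<phi> a))"

definition hstar :: "nat \<Rightarrow> 'k::comm_ring_1 \<Rightarrow> 'k hecke \<Rightarrow> 'k hecke" where
  "hstar n q a = (THE b. \<exists>\<phi>. anti_auto n q \<phi> \<and> (\<forall>i \<in> {1..<n}. \<phi> (Tb (sgen i)) = Tb (sgen i)) \<and> \<phi> a = b)"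

definition Igen :: "nat \<Rightarrow> 'k::comm_ring_1 \<Rightarrow> nat \<Rightarrow> 'k hecke" where
  "Igen n v i = hsmult (uinv v ^ blen n (sgen i)) (Tb (sgen i))"

definition Ichain :: "nat \<Rightarrow> nat \<Rightarrow> nat list" where
  "Ichain a b = (if b \<le> a then rev [b..<a+1] else [a..<b+1])"

definition Iplus :: "nat \<Rightarrow> 'k::comm_ring_1 \<Rightarrow> nat \<Rightarrow> nat \<Rightarrow> 'k hecke" where
  "Iplus n v a b = hprod n (v ^ 2) (map (Igen n v) (Ichain a b))"

definition Iminus :: "nat \<Rightarrow> 'k::comm_ring_1 \<Rightarrow> nat \<Rightarrow> nat \<Rightarrow> 'k hecke" where
  "Iminus n v a b = hinv n (v ^ 2) (Iplus n v b a)"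

definition cm :: "nat \<Rightarrow> 'k::comm_ring_1 \<Rightarrow> nat \<Rightarrow> nat \<Rightarrow> 'k hecke" where
  "cm n v m i = (if i = 0 then hone
     else hmul n (v ^ 2) (Iplus n v (m + i) (m + 1)) (Iplus n v (m + 1) (m + i)))"

text \<open>Sign tuples as bool lists of length m: True = +, False = -; eps!(k-1) = eps_k.\<close>
definition Ieps :: "nat \<Rightarrow> 'k::comm_ring_1 \<Rightarrow> bool list \<Rightarrow> 'k hecke" where
  "Ieps m v eps = hprod (2 * m) (v ^ 2) (map (\<lambda>k. if eps ! (k - 1)
        then Iplus (2 * m) v (m + 1 - k) (2 * m - k)
        else Iminus (2 * m) v (m + 1 - k) (2 * m - k)) [1..<m+1])"

definition Ceps :: "nat \<Rightarrow> 'k::comm_ring_1 \<Rightarrow> bool list \<Rightarrow> 'k hecke" where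
  "Ceps m v eps = hprod (2 * m) (v ^ 2)
     (map (\<lambda>i. cm (2 * m) v m (m - i)) (filter (\<lambda>i. \<not> eps ! (i - 1)) [1..<m+1]))"

end

theory Submission
  imports Defs
begin

text \<open>
  Normalise the generators to \<open>I_i = v\<^sup>-\<^sup>1 T_i\<close> and put \<open>L_1 = T_0\<close>, \<open>L_(i+1) = I_i L_i I_i\<close>, so that up to powers
  of \<open>q\<close> the elements \<open>u_k\<^sup>+\<close> and \<open>u_k\<^sup>-\<close> are the products of the \<open>1 + L_i\<close> and \<open>1 - L_i\<close> for \<open>i \<le> k\<close>.
  The relation \<open>I_(a\<rightarrow>b) L_b = L_(a+1) I\<^sup>-_(a\<rightarrow>b)\<close> pushes every factor \<open>1 - L_i\<close> of \<open>u_m\<^sup>-\<close> to the left through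
  \<open>T_w\<close>, for \<open>w = w_(m,m)\<close>, which yields the sum over sign tuples with coefficients that are products of
  elements \<open>- L_(m+k)\<close>. Since \<open>u_m\<^sup>+ (1 + L_(m+1))\<close> is a multiple of \<open>u_(m+1)\<^sup>+\<close>, one has
  \<open>u_m\<^sup>+ L_(m+k) = - u_m\<^sup>+ c_(m,k-1)\<close> modulo the \<open>H u_b\<^sup>+ H\<close> with \<open>b > m\<close>.

  Uniqueness of \<open>h_m\<close> comes from the filtration by the number of negative entries of a signed permutation.
  The leading term of \<open>u_b\<^sup>+\<close> is \<open>T_d\<close> times a unit of the Hecke algebra of the symmetric group, for a signed
  permutation \<open>d\<close> with \<open>b\<close> negative entries, and the \<open>T_x T_d T_z\<close> with \<open>x\<close> a distinguished left coset
  representative of \<open>\<Sigma>_b \<times> \<Sigma>_(n-b)\<close> and \<open>z\<close> in the symmetric group are pairwise distinct basis elements \<open>T_(xdz)\<close>.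
\<close>

section \<open>Descents and length in the hyperoctahedral group\<close>

text \<open>K is an arbitrary commutative ring, so ranks and semisimplicity are of no help, while
  \<open>hm\<close>, \<open>hstar\<close> and \<open>hinv\<close> are definite descriptions that
  need existence and uniqueness. For h_m, uniqueness comes from a triangular expansion whose leading
  terms have unit coefficients.

  Computations take place in a ring of K-linear operators whose values at the unit are the Hecke
  algebra elements. Associativity of \<open>hmul\<close> and the braid relations rest on one fact:
  left and right multiplications by generators commute.

  The sign expansion yields h_m with its coefficients on the left; the theorem has them on the right
  and so concerns h_m^*. The scalar is a count: u_m^+ and u_m^- each carry q^(m(m-1)/2), T_w carries
  v^(m^2), and one power of q is absorbed in u_m^+, which leaves v^(m^2 + m(m-1)) = v^(m(2m-1)).

  The sums of H u_b^+ H are ideals only for the type A algebra, to which L_j does not belong. Hence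
  the L_(m+k) cannot be replaced one at a time: their products are kept in increasing order and
  treated by induction.\<close>

definition lo :: "nat \<Rightarrow> int" where "lo i = (if i = 0 then -1 else int i)"
definition hi :: "nat \<Rightarrow> int" where "hi i = int i + 1"

text \<open>With \<open>lo 0 = -1\<close> the generator s_0, which exchanges -1 and 1, follows the
  same pattern as the others, so descents and inversions can be treated uniformly in i.\<close>

lemma sgen_lo_hi: "sgen i x = (if x = lo i then hi i else if x = hi i then lo i
   else if x = - lo i then - hi i else if x = - hi i then - lo i else x)"
  by (auto simp: sgen_def lo_def hi_def)

lemma sgen_sgen [simp]: "sgen i (sgen i x) = x"
  by (auto simp: sgen_def)

lemma sgen_comp_sgen [simp]: "sgen i \<circ> sgen i = id"
  by (auto simp: fun_eq_iff)

lemma comp_sgen_sgen [simp]: "w \<circ> sgen i \<circ> sgen i = w" "sgen i \<circ> (sgen i \<circ> w) = w"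
  by (auto simp: fun_eq_iff)

lemma sgen_minus: "sgen i (- x) = - sgen i x"
  by (auto simp: sgen_def)

lemma sgen_eq_0_iff [simp]: "sgen i x = 0 \<longleftrightarrow> x = 0"
  by (auto simp: sgen_def)

lemma abs_sgen_le: "i < n \<Longrightarrow> \<bar>sgen i x\<bar> \<le> int n \<longleftrightarrow> \<bar>x\<bar> \<le> int n"
  by (auto simp: sgen_def)

lemma sgen_fix: "i < n \<Longrightarrow> \<bar>x\<bar> > int n \<Longrightarrow> sgen i x = x"
  by (auto simp: sgen_def)

lemma sgen_pos: "i \<noteq> 0 \<Longrightarrow> sgen i x > 0 \<longleftrightarrow> x > 0"
  by (auto simp: sgen_def)

lemma sgen_lo [simp]: "sgen i (lo i) = hi i" and sgen_hi [simp]: "sgen i (hi i) = lo i"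
  by (auto simp: sgen_def lo_def hi_def)

lemma lo_hi_simps [simp]: "lo i < hi i" "lo i \<noteq> 0" "hi i \<noteq> 0" "lo i \<noteq> hi i" "hi i \<noteq> lo i" "hi i > 0"
  by (auto simp: lo_def hi_def)

lemma abs_lo_hi_le [simp]: "i < n \<Longrightarrow> \<bar>lo i\<bar> \<le> int n" "i < n \<Longrightarrow> \<bar>hi i\<bar> \<le> int n"
  by (auto simp: lo_def hi_def)

text \<open>For i > 0 the map s_i moves every entry by at most one, so only neighbours can change
  their order; s_0 moves only 1 and -1. The entry 0 is excluded because s_0 would also reverse (-1,
  0) and (0, 1).\<close>

lemma sgen_order_reversed:
  assumes "x < y" "x \<noteq> 0" "y \<noteq> 0" "sgen i y < sgen i x"
  shows "x = lo i \<and> y = hi i \<or> x = - hi i \<and> y = - lo i"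
proof (cases "i = 0")
  case True
  have "x = -1 \<or> x = 1 \<or> sgen 0 x = x" "y = -1 \<or> y = 1 \<or> sgen 0 y = y" by (auto simp: sgen_def)
  then show ?thesis using assms unfolding True by (auto simp: sgen_def lo_def hi_def)
next
  case False
  have le: "sgen i z \<le> z + 1" "z - 1 \<le> sgen i z" for z using False by (auto simp: sgen_def)
  have eq: "sgen i z = z + 1 \<Longrightarrow> z = lo i \<or> z = - hi i" for z
  proof (rule ccontr)
    assume "sgen i z = z + 1" "\<not> (z = lo i \<or> z = - hi i)"
    moreover from this(2) have "sgen i z \<le> z" using False unfolding sgen_lo_hi by (auto simp: lo_def hi_def)
    ultimately show False by linarith
  qed
  have "sgen i x = x + 1" "y = x + 1" using le[of x] le[of y] assms(1,4) by linarith+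
  then show ?thesis using eq[of x] False by (auto simp: lo_def hi_def)
qed

lemma sgen_mono:
  assumes "x < y" "x \<noteq> 0" "y \<noteq> 0" "\<not> (x = lo i \<and> y = hi i)" "\<not> (x = - hi i \<and> y = - lo i)"
  shows "sgen i x < sgen i y"
proof -
  have "sgen i x \<noteq> sgen i y" using assms(1) by (metis less_irrefl sgen_sgen)
  then show ?thesis using sgen_order_reversed[OF assms(1-3), of i] assms(4,5) by linarith
qed

section \<open>The groups of types B and A as sets of words\<close>

lemma word_prod_Nil [simp]: "word_prod [] = id"
  by (simp add: word_prod_def)

lemma word_prod_Cons [simp]: "word_prod (i # ws) = sgen i \<circ> word_prod ws"
  by (simp add: word_prod_def)

lemma word_prod_append [simp]: "word_prod (ws @ vs) = word_prod ws \<circ> word_prod vs"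
  by (induction ws) (auto simp: comp_assoc)

lemma word_prod_snoc: "word_prod (ws @ [i]) = word_prod ws \<circ> sgen i"
  by simp

lemma word_prod_rev: "word_prod (rev ws) \<circ> word_prod ws = id"
  by (induction ws) (auto simp: fun_eq_iff)

lemma word_prod_rev': "word_prod ws \<circ> word_prod (rev ws) = id"
  using word_prod_rev[of "rev ws"] by simp

lemma inv_word_prod: "inv (word_prod ws) = word_prod (rev ws)"
  using word_prod_rev word_prod_rev' inv_unique_comp by blast

lemma WB_I: "set ws \<subseteq> {..<n} \<Longrightarrow> word_prod ws \<in> WB n"
  by (auto simp: WB_def)

lemma WB_id [simp]: "id \<in> WB n"
  using WB_I[of "[]" n] by simp

lemma WB_sgen [simp]: "i < n \<Longrightarrow> sgen i \<in> WB n"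
  using WB_I[of "[i]" n] by simp

lemma WB_comp: "u \<in> WB n \<Longrightarrow> w \<in> WB n \<Longrightarrow> u \<circ> w \<in> WB n"
  unfolding WB_def by clarsimp (metis Un_subset_iff set_append word_prod_append)

lemma WB_inv [simp]: "w \<in> WB n \<Longrightarrow> inv w \<in> WB n"
  unfolding WB_def by (force simp: inv_word_prod)

lemma WB_comp_sgen [simp]: "i < n \<Longrightarrow> w \<circ> sgen i \<in> WB n \<longleftrightarrow> w \<in> WB n"
  by (metis WB_comp WB_sgen comp_sgen_sgen(1))

lemma WB_sgen_comp [simp]: "i < n \<Longrightarrow> sgen i \<circ> w \<in> WB n \<longleftrightarrow> w \<in> WB n"
  by (metis WB_comp WB_sgen comp_sgen_sgen(2))

lemma WA_I: "set ws \<subseteq> {1..<n} \<Longrightarrow> word_prod ws \<in> WA n"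
  by (auto simp: WA_def)

lemma WA_subset_WB: "WA n \<subseteq> WB n"
  by (auto simp: WA_def WB_def) (metis atLeastLessThan_iff lessThan_iff subset_iff)

lemma WA_WB: "w \<in> WA n \<Longrightarrow> w \<in> WB n"
  using WA_subset_WB by blast

lemma WA_id [simp]: "id \<in> WA n"
  using WA_I[of "[]" n] by simp

lemma WA_sgen [simp]: "1 \<le> i \<Longrightarrow> i < n \<Longrightarrow> sgen i \<in> WA n"
  using WA_I[of "[i]" n] by simp

lemma WA_comp: "u \<in> WA n \<Longrightarrow> w \<in> WA n \<Longrightarrow> u \<circ> w \<in> WA n"
  unfolding WA_def by clarsimp (metis Un_subset_iff set_append word_prod_append)

lemma WA_inv [simp]: "w \<in> WA n \<Longrightarrow> inv w \<in> WA n"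
  unfolding WA_def by (force simp: inv_word_prod)

lemma WA_comp_sgen [simp]: "1 \<le> i \<Longrightarrow> i < n \<Longrightarrow> w \<circ> sgen i \<in> WA n \<longleftrightarrow> w \<in> WA n"
  by (metis WA_comp WA_sgen comp_sgen_sgen(1))

lemma WA_sgen_comp [simp]: "1 \<le> i \<Longrightarrow> i < n \<Longrightarrow> sgen i \<circ> w \<in> WA n \<longleftrightarrow> w \<in> WA n"
  by (metis WA_comp WA_sgen comp_sgen_sgen(2))

lemma WB_bij: "w \<in> WB n \<Longrightarrow> bij w"
  unfolding WB_def using word_prod_rev word_prod_rev' o_bij by blast

lemma WB_induct [consumes 1, case_names id step]:
  assumes "w \<in> WB n" "P id" "\<And>i w. i < n \<Longrightarrow> w \<in> WB n \<Longrightarrow> P w \<Longrightarrow> P (sgen i \<circ> w)"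
  shows "P w"
proof -
  have "P (word_prod ws)" if "set ws \<subseteq> {..<n}" for ws
    using that by (induction ws) (auto intro!: assms WB_I)
  then show ?thesis using assms(1) by (auto simp: WB_def)
qed

lemma WB_minus: "w \<in> WB n \<Longrightarrow> w (- x) = - w x"
  by (induction rule: WB_induct) (auto simp: sgen_minus)

lemma WB_eq_0_iff: "w \<in> WB n \<Longrightarrow> w x = 0 \<longleftrightarrow> x = 0"
  by (induction rule: WB_induct) auto

lemma WB_abs_le: "w \<in> WB n \<Longrightarrow> \<bar>w x\<bar> \<le> int n \<longleftrightarrow> \<bar>x\<bar> \<le> int n"
  by (induction rule: WB_induct) (auto simp: abs_sgen_le)

lemma WB_fix: "w \<in> WB n \<Longrightarrow> \<bar>x\<bar> > int n \<Longrightarrow> w x = x"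
  by (induction rule: WB_induct) (auto simp: sgen_fix)

lemma WB_eq_iff: "w \<in> WB n \<Longrightarrow> w x = w y \<longleftrightarrow> x = y"
  using WB_bij by (metis bij_pointE)

lemma WB_inv_app [simp]: "w \<in> WB n \<Longrightarrow> inv w (w x) = x" "w \<in> WB n \<Longrightarrow> w (inv w x) = x"
  using WB_bij by (metis bij_inv_eq_iff)+

lemma WB_inv_inv [simp]: "w \<in> WB n \<Longrightarrow> inv (inv w) = w"
  by (simp add: WB_bij inv_inv_eq)

lemma inv_sgen [simp]: "inv (sgen i) = sgen i"
  using inv_word_prod[of "[i]"] by simp

lemma WB_inv_comp: "u \<in> WB n \<Longrightarrow> w \<in> WB n \<Longrightarrow> inv (u \<circ> w) = inv w \<circ> inv u"
  by (simp add: WB_bij o_inv_distrib)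

lemma WB_inv_comp_sgen: "i < n \<Longrightarrow> w \<in> WB n \<Longrightarrow> inv (w \<circ> sgen i) = sgen i \<circ> inv w"
  using WB_inv_comp[of w n "sgen i"] by simp

lemma WB_inv_sgen_comp: "i < n \<Longrightarrow> w \<in> WB n \<Longrightarrow> inv (sgen i \<circ> w) = inv w \<circ> sgen i"
  using WB_inv_comp[of "sgen i" n w] by simp

lemma WB_eqI: "u \<in> WB n \<Longrightarrow> w \<in> WB n \<Longrightarrow> (\<And>x. 1 \<le> x \<Longrightarrow> x \<le> int n \<Longrightarrow> u x = w x) \<Longrightarrow> u = w"
proof
  fix x assume a: "u \<in> WB n" "w \<in> WB n" "\<And>x. 1 \<le> x \<Longrightarrow> x \<le> int n \<Longrightarrow> u x = w x"
  consider "\<bar>x\<bar> > int n" | "x = 0" | "1 \<le> x" "x \<le> int n" | "1 \<le> - x" "- x \<le> int n" by linarith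
  then show "u x = w x"
  proof cases
    case 4 then have "u (- x) = w (- x)" using a(3) by blast
    then show ?thesis using WB_minus[OF a(1), of x] WB_minus[OF a(2), of x] by simp
  next
    case 2 then show ?thesis using WB_eq_0_iff[OF a(1), of 0] WB_eq_0_iff[OF a(2), of 0] by simp
  qed (use a WB_fix[OF a(1)] WB_fix[OF a(2)] in auto)
qed

lemma finite_WB: "finite (WB n)"
proof -
  obtain xs where xs: "set xs = {- int n..int n}" using finite_list[of "{- int n..int n}"] by auto
  have "inj_on (\<lambda>w. map w xs) (WB n)"
    by (rule inj_onI, rule WB_eqI) (use xs in auto)
  moreover have "(\<lambda>w. map w xs) ` WB n \<subseteq> {ys. set ys \<subseteq> {- int n..int n} \<and> length ys = length xs}"
  proof (rule image_subsetI)
    fix w assume w: "w \<in> WB n"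
    have "w x \<in> {- int n..int n}" if "x \<in> set xs" for x
      using that WB_abs_le[OF w, of x] xs by (auto simp: abs_le_iff)
    then show "map w xs \<in> {ys. set ys \<subseteq> {- int n..int n} \<and> length ys = length xs}" by auto
  qed
  moreover have "finite {ys. set ys \<subseteq> {- int n..int n} \<and> length ys = length xs}"
    by (rule finite_lists_length_eq) simp
  ultimately show ?thesis by (meson finite_imageD finite_subset)
qed

lemma finite_WA: "finite (WA n)"
  using finite_WB WA_subset_WB finite_subset by blast

lemma WA_induct [consumes 1, case_names id step]:
  assumes "w \<in> WA n" "P id" "\<And>i w. 1 \<le> i \<Longrightarrow> i < n \<Longrightarrow> w \<in> WA n \<Longrightarrow> P w \<Longrightarrow> P (sgen i \<circ> w)"
  shows "P w"
proof -
  have "P (word_prod ws)" if "set ws \<subseteq> {1..<n}" for ws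
    using that by (induction ws) (auto intro!: assms WA_I)
  then show ?thesis using assms(1) by (auto simp: WA_def)
qed

lemma WA_pos: "w \<in> WA n \<Longrightarrow> w x > 0 \<longleftrightarrow> x > 0"
  by (induction rule: WA_induct) (auto simp: sgen_pos)

text \<open>Descents are defined by comparing values. That they are the generators lowering the
  length is proved in \<open>rdes_iff_blen\<close> and \<open>blen_ldes_iff\<close>.\<close>

definition rdes :: "(int \<Rightarrow> int) \<Rightarrow> nat \<Rightarrow> bool" where "rdes w i \<longleftrightarrow> w (hi i) < w (lo i)"
definition ldes :: "(int \<Rightarrow> int) \<Rightarrow> nat \<Rightarrow> bool" where "ldes w i \<longleftrightarrow> rdes (inv w) i"

lemma rdes_comp_sgen: "i < n \<Longrightarrow> w \<in> WB n \<Longrightarrow> rdes (w \<circ> sgen i) i \<longleftrightarrow> \<not> rdes w i"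
  using WB_eq_iff[of w n "hi i" "lo i"] by (auto simp: rdes_def)

lemma ldes_sgen_comp: "i < n \<Longrightarrow> w \<in> WB n \<Longrightarrow> ldes (sgen i \<circ> w) i \<longleftrightarrow> \<not> ldes w i"
  by (simp add: ldes_def WB_inv_sgen_comp rdes_comp_sgen)

section \<open>Inversions and the Coxeter length\<close>

definition Invs :: "nat \<Rightarrow> (int \<Rightarrow> int) \<Rightarrow> (int \<times> int) set" where
  "Invs n w = {(a, b). \<bar>a\<bar> \<le> int n \<and> \<bar>b\<bar> \<le> int n \<and> a \<noteq> 0 \<and> b \<noteq> 0 \<and> a < b \<and> w b < w a}"

definition negs :: "nat \<Rightarrow> (int \<Rightarrow> int) \<Rightarrow> nat" where
  "negs n w = card {a. 1 \<le> a \<and> a \<le> int n \<and> w a < 0}"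

lemma finite_Invs: "finite (Invs n w)"
  by (rule finite_subset[of _ "{- int n..int n} \<times> {- int n..int n}"]) (auto simp: Invs_def)

lemma finite_negs: "finite {a. 1 \<le> a \<and> a \<le> int n \<and> P a}"
  by (rule finite_subset[of _ "{1..int n}"]) auto

text \<open>By \<open>sgen_mono\<close>, s_i preserves the order of every pair of nonzero entries
  except \<open>(lo i, hi i)\<close> and its mirror image. So the old inversions are carried along
  by s_i, and exactly the exceptional pairs are new.\<close>

lemma Invs_comp_sgen:
  assumes "i < n" "w \<in> WB n" "\<not> rdes w i"
  shows "Invs n (w \<circ> sgen i) = map_prod (sgen i) (sgen i) ` Invs n w \<union> {(lo i, hi i), (- hi i, - lo i)}"
    and "map_prod (sgen i) (sgen i) ` Invs n w \<inter> {(lo i, hi i), (- hi i, - lo i)} = {}"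
proof -
  have lt: "w (lo i) < w (hi i)" using assms(3) WB_eq_iff[OF assms(2), of "hi i" "lo i"] by (auto simp: rdes_def)
  have lt': "w (- hi i) < w (- lo i)" using lt WB_minus[OF assms(2)] by simp
  have inv: "(sgen i a, sgen i b) \<in> Invs n (w \<circ> sgen i)" if "(a, b) \<in> Invs n w" for a b
  proof -
    have "\<not> (a = lo i \<and> b = hi i)" "\<not> (a = - hi i \<and> b = - lo i)" using that lt lt' by (auto simp: Invs_def)
    then show ?thesis using that sgen_mono[of a b i] by (auto simp: Invs_def abs_sgen_le assms(1))
  qed
  have inv': "(sgen i a, sgen i b) \<in> Invs n w" if "(a, b) \<in> Invs n (w \<circ> sgen i)" "(a, b) \<notin> {(lo i, hi i), (- hi i, - lo i)}" for a b
    using that sgen_mono[of a b i] by (auto simp: Invs_def abs_sgen_le assms(1))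
  have sp: "{(lo i, hi i), (- hi i, - lo i)} \<subseteq> Invs n (w \<circ> sgen i)"
    using lt lt' assms(1) by (auto simp: Invs_def sgen_minus)
  show "Invs n (w \<circ> sgen i) = map_prod (sgen i) (sgen i) ` Invs n w \<union> {(lo i, hi i), (- hi i, - lo i)}"
  proof (intro equalityI subsetI)
    fix p assume p: "p \<in> Invs n (w \<circ> sgen i)"
    obtain a b where ab: "p = (a, b)" by force
    show "p \<in> map_prod (sgen i) (sgen i) ` Invs n w \<union> {(lo i, hi i), (- hi i, - lo i)}"
    proof (cases "p \<in> {(lo i, hi i), (- hi i, - lo i)}")
      case False
      then have "(sgen i a, sgen i b) \<in> Invs n w" using inv' p ab by blast
      then have "map_prod (sgen i) (sgen i) (sgen i a, sgen i b) \<in> map_prod (sgen i) (sgen i) ` Invs n w" by (rule imageI)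
      then show ?thesis using ab by simp
    qed auto
  qed (use inv sp in auto)
  show "map_prod (sgen i) (sgen i) ` Invs n w \<inter> {(lo i, hi i), (- hi i, - lo i)} = {}"
  proof -
    have False if "(a, b) \<in> Invs n w" "map_prod (sgen i) (sgen i) (a, b) \<in> {(lo i, hi i), (- hi i, - lo i)}" for a b
    proof -
      have "(a, b) = (hi i, lo i) \<or> (a, b) = (- lo i, - hi i)"
      proof -
        have "sgen i a = lo i \<and> sgen i b = hi i \<or> sgen i a = - hi i \<and> sgen i b = - lo i" using that(2) by simp
        then have "sgen i (sgen i a) = hi i \<and> sgen i (sgen i b) = lo i \<or> sgen i (sgen i a) = - lo i \<and> sgen i (sgen i b) = - hi i"
          by (auto simp: sgen_minus simp del: sgen_sgen)
        then show ?thesis by simp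
      qed
      moreover have "\<not> hi i < lo i" using lo_hi_simps(1)[of i] by linarith
      ultimately show False using that(1) by (auto simp: Invs_def)
    qed
    then have "p \<notin> {(lo i, hi i), (- hi i, - lo i)}" if "p \<in> map_prod (sgen i) (sgen i) ` Invs n w" for p
      using that by (metis (no_types) imageE surj_pair)
    then show ?thesis by blast
  qed
qed

lemma negs_comp_sgen:
  assumes "i < n" "i \<noteq> 0" shows "negs n (w \<circ> sgen i) = negs n w"
proof -
  have "bij_betw (sgen i) {a. 1 \<le> a \<and> a \<le> int n \<and> (w \<circ> sgen i) a < 0} {a. 1 \<le> a \<and> a \<le> int n \<and> w a < 0}"
  proof (rule bij_betw_byWitness[where f' = "sgen i"])
    have k: "1 \<le> sgen i a \<and> sgen i a \<le> int n" if "1 \<le> a" "a \<le> int n" for a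
      using that abs_sgen_le[OF assms(1), of a] sgen_pos[OF assms(2), of a] by linarith
    show "sgen i ` {a. 1 \<le> a \<and> a \<le> int n \<and> (w \<circ> sgen i) a < 0} \<subseteq> {a. 1 \<le> a \<and> a \<le> int n \<and> w a < 0}"
      "sgen i ` {a. 1 \<le> a \<and> a \<le> int n \<and> w a < 0} \<subseteq> {a. 1 \<le> a \<and> a \<le> int n \<and> (w \<circ> sgen i) a < 0}"
      using k by (simp_all add: image_subset_iff)
  qed auto
  then show ?thesis unfolding negs_def by (rule bij_betw_same_card)
qed

lemma negs_sgen_comp:
  assumes "i \<noteq> 0" "i < n" "w \<in> WB n" shows "negs n (sgen i \<circ> w) = negs n w"
proof -
  have "(sgen i \<circ> w) a < 0 \<longleftrightarrow> w a < 0" for a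
    using sgen_pos[OF assms(1), of "w a"] sgen_eq_0_iff[of i "w a"] by (simp only: o_def) linarith
  then show ?thesis by (simp add: negs_def)
qed

lemma negs_comp_sgen_0:
  assumes "0 < n" "w \<in> WB n" "\<not> rdes w 0" shows "negs n (w \<circ> sgen 0) = Suc (negs n w)"
proof -
  have w1: "w 1 > 0" using assms(3) WB_minus[OF assms(2), of 1] WB_eq_0_iff[OF assms(2), of 1]
    by (auto simp: rdes_def lo_def hi_def)
  have "{a. 1 \<le> a \<and> a \<le> int n \<and> (w \<circ> sgen 0) a < 0} = insert 1 {a. 1 \<le> a \<and> a \<le> int n \<and> w a < 0}"
    using w1 WB_minus[OF assms(2), of 1] assms(1) by (auto simp: sgen_def)
  then show ?thesis using w1 finite_negs by (simp add: negs_def)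
qed

text \<open>Inversions other than the pairs \<open>(-a, a)\<close> occur twice, hence this is twice the Coxeter length.\<close>
definition ell :: "nat \<Rightarrow> (int \<Rightarrow> int) \<Rightarrow> nat" where "ell n w = card (Invs n w) + negs n w"

text \<open>For i > 0 two mirror pairs become inversions. For i = 0 they are one and the same pair,
  and the second unit is the new negative entry counted by \<open>negs\<close>.\<close>

lemma ell_comp_sgen:
  assumes "i < n" "w \<in> WB n" "\<not> rdes w i" shows "ell n (w \<circ> sgen i) = ell n w + 2"
proof -
  have inj: "inj_on (map_prod (sgen i) (sgen i)) A" for A
    by (rule inj_on_inverseI[where g = "map_prod (sgen i) (sgen i)"]) auto
  have c: "card (Invs n (w \<circ> sgen i)) = card (Invs n w) + card {(lo i, hi i), (- hi i, - lo i)}"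
    unfolding Invs_comp_sgen(1)[OF assms]
    by (subst card_Un_disjoint) (use finite_Invs Invs_comp_sgen(2)[OF assms] in \<open>auto simp: card_image[OF inj]\<close>)
  show ?thesis
  proof (cases "i = 0")
    case True
    then have "card {(lo i, hi i), (- hi i, - lo i)} = 1" by (simp add: lo_def hi_def)
    then show ?thesis using c negs_comp_sgen_0 assms True by (simp add: ell_def)
  next
    case False
    then have "card {(lo i, hi i), (- hi i, - lo i)} = 2" by (auto simp: lo_def hi_def)
    then show ?thesis using c negs_comp_sgen[OF assms(1) False, of w] by (simp add: ell_def)
  qed
qed

lemma ell_comp_sgen_des:
  assumes "i < n" "w \<in> WB n" "rdes w i" shows "ell n w = ell n (w \<circ> sgen i) + 2"
  using ell_comp_sgen[OF assms(1), of "w \<circ> sgen i"] assms rdes_comp_sgen by auto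

lemma ell_id [simp]: "ell n id = 0"
proof -
  have a: "Invs n id = {}" and b: "{a. 1 \<le> a \<and> a \<le> int n \<and> id a < 0} = {}" by (auto simp: Invs_def)
  show ?thesis unfolding ell_def negs_def a b by simp
qed

text \<open>Having no descent at 0 makes w(1) positive, the other indices make w increasing on 1..n.
  Counting up from 1 gives w(k) >= k, counting down from n gives w(k) <= k.\<close>

lemma no_rdes_imp_id:
  assumes w: "w \<in> WB n" and nd: "\<And>i. i < n \<Longrightarrow> \<not> rdes w i" shows "w = id"
proof (rule WB_eqI[OF w WB_id])
  have inc: "w (int i) < w (int i + 1)" if "1 \<le> i" "i < n" for i
    using nd[OF that(2)] WB_eq_iff[OF w, of "int i" "int i + 1"] that by (auto simp: rdes_def lo_def hi_def)
  have ge: "Suc k \<le> n \<Longrightarrow> w (int (Suc k)) \<ge> int (Suc k)" for k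
  proof (induction k)
    case 0
    then show ?case using nd[of 0] WB_minus[OF w, of 1] WB_eq_0_iff[OF w, of 1] by (auto simp: rdes_def lo_def hi_def)
  next
    case (Suc k) then show ?case using inc[of "Suc k"] by (auto simp: add.commute)
  qed
  have le: "k < n \<Longrightarrow> w (int (n - k)) \<le> int (n - k)" for k
  proof (induction k)
    case 0 then show ?case using WB_abs_le[OF w, of "int n"] by auto
  next
    case (Suc k)
    have "int (n - Suc k) + 1 = int (n - k)" using Suc.prems by auto
    moreover have "w (int (n - k)) \<le> int (n - k)" using Suc by simp
    moreover have "w (int (n - Suc k)) < w (int (n - Suc k) + 1)" using inc[of "n - Suc k"] Suc.prems by simp
    ultimately show ?case by simp
  qed
  fix x :: int assume x: "1 \<le> x" "x \<le> int n"
  have "w x \<ge> x" using ge[of "nat x - 1"] x by auto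
  moreover have "w x \<le> x" using le[of "n - nat x"] x by auto
  ultimately show "w x = id x" by simp
qed

lemma ell_word: "set ws \<subseteq> {..<n} \<Longrightarrow> ell n (word_prod ws) \<le> 2 * length ws"
proof (induction ws rule: rev_induct)
  case (snoc i ws)
  have w: "word_prod ws \<in> WB n" using snoc.prems by (auto intro: WB_I)
  have "ell n (word_prod ws \<circ> sgen i) \<le> ell n (word_prod ws) + 2"
    using ell_comp_sgen[of i n "word_prod ws"] ell_comp_sgen_des[of i n "word_prod ws"] w snoc.prems
    by (cases "rdes (word_prod ws) i") auto
  moreover have "ell n (word_prod ws) \<le> 2 * length ws" using snoc by simp
  ultimately have "ell n (word_prod ws \<circ> sgen i) \<le> 2 * length (ws @ [i])" by simp
  then show ?case by (subst word_prod_snoc)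
qed simp

lemma ell_word_ex: "w \<in> WB n \<Longrightarrow> \<exists>ws. set ws \<subseteq> {..<n} \<and> 2 * length ws = ell n w \<and> word_prod ws = w"
proof (induction "ell n w" arbitrary: w rule: less_induct)
  case less
  show ?case
  proof (cases "\<exists>i<n. rdes w i")
    case True
    then obtain i where i: "i < n" "rdes w i" by blast
    have e: "ell n w = ell n (w \<circ> sgen i) + 2" using ell_comp_sgen_des i less.prems by blast
    then obtain ws where ws: "set ws \<subseteq> {..<n}" "2 * length ws = ell n (w \<circ> sgen i)" "word_prod ws = w \<circ> sgen i"
      using less.hyps[of "w \<circ> sgen i"] less.prems i by auto
    show ?thesis by (rule exI[of _ "ws @ [i]"]) (use ws i e in auto)
  next
    case False
    then have "w = id" using no_rdes_imp_id less.prems by blast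
    then show ?thesis by (intro exI[of _ "[]"]) auto
  qed
qed

text \<open>\<open>ell_word\<close> bounds the length of every word from below, and the word of
  \<open>ell_word_ex\<close>, obtained by removing descents until the identity is reached, attains
  the bound.\<close>

lemma blen_ell: assumes "w \<in> WB n" shows "2 * blen n w = ell n w"
proof -
  obtain ws where ws: "set ws \<subseteq> {..<n}" "2 * length ws = ell n w" "word_prod ws = w"
    using ell_word_ex assms by blast
  have "blen n w = length ws" unfolding blen_def
  proof (rule Least_equality)
    fix k assume "\<exists>vs. set vs \<subseteq> {..<n} \<and> length vs = k \<and> word_prod vs = w"
    then obtain vs where vs: "set vs \<subseteq> {..<n}" "length vs = k" "word_prod vs = w" by blast
    show "length ws \<le> k" using ell_word[OF vs(1)] vs ws by simp
  qed (use ws in auto)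
  then show ?thesis using ws by simp
qed

lemma redword:
  assumes "w \<in> WB n"
  shows "set (redword n w) \<subseteq> {..<n}" "length (redword n w) = blen n w" "word_prod (redword n w) = w"
proof -
  have "\<exists>ws. set ws \<subseteq> {..<n} \<and> length ws = blen n w \<and> word_prod ws = w"
    using ell_word_ex[OF assms] blen_ell[OF assms] by force
  from someI_ex[OF this] show "set (redword n w) \<subseteq> {..<n}" "length (redword n w) = blen n w" "word_prod (redword n w) = w"
    unfolding redword_def by blast+
qed

lemma blen_le: "set ws \<subseteq> {..<n} \<Longrightarrow> blen n (word_prod ws) \<le> length ws"
  using ell_word[of ws n] blen_ell[OF WB_I[of ws n]] by simp

lemma blen_inv: assumes "w \<in> WB n" shows "blen n (inv w) = blen n w"
proof -
  have "blen n (inv w) \<le> blen n w" if "w \<in> WB n" for w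
    using blen_le[of "rev (redword n w)" n] redword[OF that] inv_word_prod[of "redword n w"] by simp
  from this[OF assms] this[of "inv w"] show ?thesis using assms by auto
qed

lemma blen_comp_sgen: "i < n \<Longrightarrow> w \<in> WB n \<Longrightarrow> \<not> rdes w i \<Longrightarrow> blen n (w \<circ> sgen i) = Suc (blen n w)"
  using ell_comp_sgen[of i n w] blen_ell[of w n] blen_ell[of "w \<circ> sgen i" n] by auto

lemma blen_comp_sgen_des: "i < n \<Longrightarrow> w \<in> WB n \<Longrightarrow> rdes w i \<Longrightarrow> blen n w = Suc (blen n (w \<circ> sgen i))"
  using ell_comp_sgen_des[of i n w] blen_ell[of w n] blen_ell[of "w \<circ> sgen i" n] by auto

lemma blen_sgen_comp: "i < n \<Longrightarrow> w \<in> WB n \<Longrightarrow> \<not> ldes w i \<Longrightarrow> blen n (sgen i \<circ> w) = Suc (blen n w)"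
  using blen_comp_sgen[of i n "inv w"] blen_inv[of w n] blen_inv[of "sgen i \<circ> w" n]
  by (simp add: ldes_def WB_inv_sgen_comp)

lemma blen_sgen_comp_des: "i < n \<Longrightarrow> w \<in> WB n \<Longrightarrow> ldes w i \<Longrightarrow> blen n w = Suc (blen n (sgen i \<circ> w))"
  using blen_comp_sgen_des[of i n "inv w"] blen_inv[of w n] blen_inv[of "sgen i \<circ> w" n]
  by (simp add: ldes_def WB_inv_sgen_comp)

lemma blen_ldes_iff: "i < n \<Longrightarrow> w \<in> WB n \<Longrightarrow> blen n (sgen i \<circ> w) < blen n w \<longleftrightarrow> ldes w i"
  using blen_sgen_comp[of i n w] blen_sgen_comp_des[of i n w] by (cases "ldes w i") auto

lemma blen_id [simp]: "blen n id = 0"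
  using blen_le[of "[]" n] by simp

lemma blen_sgen [simp]: "i < n \<Longrightarrow> blen n (sgen i) = 1"
  using blen_comp_sgen[of i n id] by (simp add: rdes_def not_less less_imp_le)

text \<open>The hypothesis lists the ways in which w can carry the pair moved by s_j to the pair
  moved by s_i, up to order and sign. Each of them makes s_i the conjugate of s_j under w.\<close>

lemma sgen_conj:
  assumes w: "w \<in> WB n"
    and c: "w (lo j) = lo i \<and> w (hi j) = hi i \<or> w (hi j) = - lo i \<and> w (lo j) = - hi i \<or>
       w (lo j) = hi i \<and> w (hi j) = lo i \<or> w (hi j) = - hi i \<and> w (lo j) = - lo i"
  shows "sgen i \<circ> w = w \<circ> sgen j"
proof
  fix p
  consider "p = lo j" | "p = hi j" | "p = - lo j" | "p = - hi j" | "p \<notin> {lo j, hi j, - lo j, - hi j}" by blast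
  then show "(sgen i \<circ> w) p = (w \<circ> sgen j) p"
  proof cases
    case 5
    then have "w p \<noteq> w (lo j)" "w p \<noteq> w (hi j)" "w p \<noteq> w (- lo j)" "w p \<noteq> w (- hi j)"
      using WB_eq_iff[OF w] by auto
    then have "w p \<notin> {lo i, hi i, - lo i, - hi i}" using c WB_minus[OF w] by force
    then show ?thesis using 5 by (simp add: sgen_lo_hi)
  qed (use c WB_minus[OF w] in \<open>auto simp: sgen_minus\<close>)
qed

text \<open>A left descent at i compares the positions of \<open>lo i\<close> and
  \<open>hi i\<close> in w. Right multiplication by s_j applies s_j to both positions, which can
  change their order only if they form the pair moved by s_j or its mirror image.\<close>

lemma sgen_cross:
  assumes w: "w \<in> WB n" and j: "j < n" and ne: "ldes (w \<circ> sgen j) i \<noteq> ldes w i"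
  shows "sgen i \<circ> w = w \<circ> sgen j"
proof -
  let ?x = "inv w (lo i)" and ?y = "inv w (hi i)"
  have nz: "?x \<noteq> 0" "?y \<noteq> 0" "?x \<noteq> ?y"
    using WB_eq_0_iff[OF WB_inv[OF w]] WB_eq_iff[OF WB_inv[OF w]] by auto
  have *: "(sgen j ?y < sgen j ?x) \<noteq> (?y < ?x)"
    using ne j w by (simp add: ldes_def rdes_def WB_inv_comp_sgen)
  have "?x = lo j \<and> ?y = hi j \<or> ?x = - hi j \<and> ?y = - lo j \<or> ?y = lo j \<and> ?x = hi j \<or> ?y = - hi j \<and> ?x = - lo j"
  proof (cases "?x < ?y")
    case True
    then show ?thesis using * sgen_order_reversed[OF True nz(1,2), of j] by linarith
  next
    case False
    then have "?y < ?x" using nz(3) by linarith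
    moreover have "sgen j ?x \<noteq> sgen j ?y" using nz(3) by (metis sgen_sgen)
    ultimately have "?y < ?x" "sgen j ?x < sgen j ?y" using * by linarith+
    then show ?thesis using sgen_order_reversed[of ?y ?x j] nz by blast
  qed
  moreover have "w ?x = lo i" "w ?y = hi i" using w by auto
  ultimately have "w (lo j) = lo i \<and> w (hi j) = hi i \<or> w (hi j) = - lo i \<and> w (lo j) = - hi i \<or>
       w (lo j) = hi i \<and> w (hi j) = lo i \<or> w (hi j) = - hi i \<and> w (lo j) = - lo i"
    using WB_minus[OF w, of "lo j"] WB_minus[OF w, of "hi j"] by (elim disjE conjE) simp_all
  then show ?thesis by (rule sgen_conj[OF w])
qed

text \<open>Makes the two quadratic parameters agree when s_i w = w s_j. A conjugate of s_0 sends
  some nonzero entry to its negative, whereas s_i with i > 0 preserves signs.\<close>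

lemma sgen_conj_0_iff:
  assumes w: "w \<in> WB n" and e: "sgen i \<circ> w = w \<circ> sgen j" shows "i = 0 \<longleftrightarrow> j = 0"
proof -
  have e': "sgen i (w x) = w (sgen j x)" for x using e by (metis comp_apply)
  have False if "i = 0" "j \<noteq> 0"
  proof -
    have "sgen 0 (w (int j)) = w (int j) \<or> sgen 0 (w (int j)) = w (- int j)"
      using WB_minus[OF w] by (auto simp: sgen_def)
    then have "w (int j + 1) = w (int j) \<or> w (int j + 1) = w (- int j)" using e'[of "int j"] that by (simp add: sgen_def)
    then show False unfolding WB_eq_iff[OF w] by linarith
  qed
  moreover have False if "i \<noteq> 0" "j = 0"
  proof -
    have "sgen i (w 1) = - w 1" using e'[of 1] that WB_minus[OF w] by (simp add: sgen_def)
    moreover have "sgen i x = - x \<Longrightarrow> x = 0" for x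
      using sgen_pos[OF that(1), of x] sgen_pos[OF that(1), of "- x"] sgen_minus[of i x] by linarith
    ultimately show False using WB_eq_0_iff[OF w, of 1] by auto
  qed
  ultimately show ?thesis by blast
qed

section \<open>Left and right multiplication operators\<close>

definition Rgen :: "nat \<Rightarrow> 'k::comm_ring_1 \<Rightarrow> nat \<Rightarrow> 'k hecke \<Rightarrow> 'k hecke" where
  "Rgen n q j f = (\<lambda>y. if y \<notin> WB n then 0
     else if rdes y j then f (y \<circ> sgen j) + (qpar q j - 1) * f y
     else qpar q j * f (y \<circ> sgen j))"

lemma Lgen_ldes: "i < n \<Longrightarrow> Lgen n q i f y = (if y \<notin> WB n then 0
     else if ldes y i then f (sgen i \<circ> y) + (qpar q i - 1) * f y else qpar q i * f (sgen i \<circ> y))"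
  by (simp add: Lgen_def blen_ldes_iff)

lemma sgen_cross':
  assumes w: "w \<in> WB n" and i: "i < n" and j: "j < n" and ne: "rdes (sgen i \<circ> w) j \<noteq> rdes w j"
  shows "sgen i \<circ> w = w \<circ> sgen j"
proof -
  have "sgen j \<circ> inv w = inv w \<circ> sgen i"
    by (rule sgen_cross[OF WB_inv[OF w] i]) (use ne w i in \<open>simp add: ldes_def WB_inv_comp_sgen\<close>)
  then have "inv (w \<circ> sgen j) = inv (sgen i \<circ> w)"
    using w i j by (simp add: WB_inv_comp_sgen WB_inv_sgen_comp)
  then show ?thesis using w i j by (metis WB_comp_sgen WB_inv_inv WB_sgen_comp)
qed

lemma rdes_iff_blen: "i < n \<Longrightarrow> w \<in> WB n \<Longrightarrow> rdes w i \<longleftrightarrow> blen n (w \<circ> sgen i) < blen n w"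
  using blen_comp_sgen[of i n w] blen_comp_sgen_des[of i n w] by (cases "rdes w i") auto

text \<open>The source of associativity. If s_i y = y s_j, both operators act through the same two
  elements with the same parameter. Otherwise, by \<open>sgen_cross\<close>, neither multiplication
  affects the descent seen by the other, and the two case distinctions are independent.\<close>

lemma Lgen_Rgen_commute:
  assumes i: "i < n" and j: "j < n"
  shows "Lgen n q i (Rgen n q j f) = Rgen n q j (Lgen n q i f)"
proof
  fix y
  show "Lgen n q i (Rgen n q j f) y = Rgen n q j (Lgen n q i f) y"
  proof (cases "y \<in> WB n")
    case y: True
    show ?thesis
    proof (cases "sgen i \<circ> y = y \<circ> sgen j")
      case True
      have "ldes y i \<longleftrightarrow> rdes y j" using rdes_iff_blen[OF j y] blen_ldes_iff[OF i y] True by simp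
      moreover have "ldes (y \<circ> sgen j) i \<longleftrightarrow> \<not> ldes y i" using ldes_sgen_comp[OF i y] True by simp
      moreover have "rdes (y \<circ> sgen j) j \<longleftrightarrow> \<not> rdes y j" using rdes_comp_sgen[OF j y] .
      moreover have "qpar q i = qpar q j" using sgen_conj_0_iff[OF y True] by (simp add: qpar_def)
      moreover have "sgen i \<circ> (y \<circ> sgen j) = y" using True by (metis comp_sgen_sgen(2))
      ultimately show ?thesis using y i j True by (simp add: Lgen_ldes Rgen_def algebra_simps)
    next
      case False
      have "ldes (y \<circ> sgen j) i \<longleftrightarrow> ldes y i" using sgen_cross[OF y j] False by blast
      moreover have "rdes (sgen i \<circ> y) j \<longleftrightarrow> rdes y j" using sgen_cross'[OF y i j] False by blast
      moreover have "sgen i \<circ> (y \<circ> sgen j) = sgen i \<circ> y \<circ> sgen j" by (simp add: comp_assoc)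
      ultimately show ?thesis using y i j by (simp add: Lgen_ldes Rgen_def algebra_simps del: comp_apply)
    qed
  qed (simp add: Lgen_def Rgen_def)
qed

lemma Lgen_Tb:
  assumes "i < n" "w \<in> WB n" "\<not> ldes w i" shows "Lgen n q i (Tb w) = Tb (sgen i \<circ> w)"
proof
  fix y
  have e: "sgen i \<circ> y = w \<longleftrightarrow> y = sgen i \<circ> w" by (metis comp_sgen_sgen(2))
  show "Lgen n q i (Tb w) y = Tb (sgen i \<circ> w) y"
    using assms ldes_sgen_comp[of i n w] by (auto simp: Lgen_ldes Tb_def e)
qed

lemma Rgen_Tb:
  assumes "i < n" "w \<in> WB n" "\<not> rdes w i" shows "Rgen n q i (Tb w) = Tb (w \<circ> sgen i)"
proof
  fix y
  have e: "y \<circ> sgen i = w \<longleftrightarrow> y = w \<circ> sgen i" by (metis comp_sgen_sgen(1))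
  show "Rgen n q i (Tb w) y = Tb (w \<circ> sgen i) y"
    using assms rdes_comp_sgen[of i n w] by (auto simp: Rgen_def Tb_def e)
qed

text \<open>The product \<open>hmul\<close> depends on n and q, and \<open>hone\<close> is a right
  unit only for functions supported on the group, so \<open>hmul\<close> gives no ring structure on
  the type of coefficient functions. Linear operators under composition do form an instance of
  \<open>ring_1\<close>.\<close>

typedef (overloaded) ('k::comm_ring_1) lop =
  "{X :: 'k hecke \<Rightarrow> 'k hecke. (\<forall>f g. X (hadd f g) = hadd (X f) (X g)) \<and> (\<forall>c f. X (hsmult c f) = hsmult c (X f))}"
  morphisms app Lop by (rule exI[of _ id]) simp

lemma app_hadd: "app X (hadd f g) = hadd (app X f) (app X g)" and app_hsmult: "app X (hsmult c f) = hsmult c (app X f)"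
  using app[of X] by auto

lemma lop_eqI: "(\<And>f y. app X f y = app Y f y) \<Longrightarrow> X = Y"
  by (metis app_inject ext)

lemmas happly = hadd_def hsmult_def

instantiation lop :: (comm_ring_1) ring_1
begin

definition "0 = Lop (\<lambda>f y. 0)"
definition "1 = Lop (\<lambda>f. f)"
definition "X + Y = Lop (\<lambda>f. hadd (app X f) (app Y f))"
definition "- X = Lop (\<lambda>f. hsmult (-1) (app X f))"
definition "X - Y = X + (- Y :: 'a lop)"
definition "X * Y = Lop (\<lambda>f. app X (app Y f))"

lemma app_simps_aux:
  "app 0 f y = 0" "app 1 f = f" "app (X + Y) f y = app X f y + app Y f y" "app (- X) f y = - app X f y"
  "app (X - Y) f y = app X f y - app Y f y" "app (X * Y) f = app X (app Y f)"
proof -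
  show 0: "app 0 f y = 0" unfolding zero_lop_def by (subst Lop_inverse) (auto simp: happly)
  show "app 1 f = f" unfolding one_lop_def by (subst Lop_inverse) auto
  show *: "app (X + Y) f y = app X f y + app Y f y" for X Y unfolding plus_lop_def
    by (subst Lop_inverse) (auto simp: app_hadd app_hsmult, auto simp: happly algebra_simps)
  show **: "app (- X) f y = - app X f y" for X unfolding uminus_lop_def
    by (subst Lop_inverse) (auto simp: app_hadd app_hsmult, auto simp: happly algebra_simps)
  show "app (X - Y) f y = app X f y - app Y f y" unfolding minus_lop_def by (simp add: * **)
  show "app (X * Y) f = app X (app Y f)" unfolding times_lop_def
    by (subst Lop_inverse) (auto simp: app_hadd app_hsmult)
qed

lemma app_add_fun: "app X (app (Y + Z) f) y = app X (app Y f) y + app X (app Z f) y"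
proof -
  have "app (Y + Z) f = hadd (app Y f) (app Z f)" by (rule ext) (simp add: app_simps_aux hadd_def)
  then show ?thesis by (simp add: app_hadd) (simp add: hadd_def)
qed

lemma one_neq_zero_aux: "(0::'a lop) \<noteq> 1"
proof
  assume "(0::'a lop) = 1"
  then have "app (0::'a lop) (\<lambda>_. 1) undefined = app (1::'a lop) (\<lambda>_. 1) undefined" by simp
  then show False unfolding app_simps_aux by simp
qed

instance
proof (standard, goal_cases)
  case 11 show ?case by (rule one_neq_zero_aux)
qed (rule lop_eqI, simp add: app_simps_aux app_add_fun)+

end

lemmas app_simps [simp] = app_simps_aux

definition lsc :: "'k::comm_ring_1 \<Rightarrow> 'k lop" where "lsc c = Lop (hsmult c)"

lemma app_lsc [simp]: "app (lsc c) f = hsmult c f"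
  unfolding lsc_def by (subst Lop_inverse) (auto simp: happly algebra_simps)

lemma lsc_hom: "lsc (a + b) = lsc a + lsc b" "lsc (a * b) = lsc a * lsc b" "lsc 1 = 1" "lsc c * X = X * lsc c"
proof -
  show "lsc c * X = X * lsc c" by (rule lop_eqI) (simp add: app_hsmult)
qed (rule lop_eqI, simp add: happly algebra_simps)+

text \<open>Outside the group the operator acts by the index character, so that the Hecke relations hold as
  identities of operators on all coefficient functions.\<close>
definition lgen :: "nat \<Rightarrow> 'k::comm_ring_1 \<Rightarrow> nat \<Rightarrow> 'k lop" where
  "lgen n q i = Lop (\<lambda>f y. if y \<in> WB n then Lgen n q i f y else qpar q i * f y)"

lemma app_lgen: "app (lgen n q i) f y = (if y \<in> WB n then Lgen n q i f y else qpar q i * f y)"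
  unfolding lgen_def by (subst Lop_inverse) (auto simp: happly Lgen_def algebra_simps)

section \<open>Jucys-Murphy elements in a Hecke algebra of type B\<close>

definition commutes :: "'r::ring_1 \<Rightarrow> 'r \<Rightarrow> bool" where "commutes x y \<longleftrightarrow> x * y = y * x"

lemma commutes_sym: "commutes x y \<Longrightarrow> commutes y x"
  by (simp add: commutes_def)

lemma commutes_1 [simp]: "commutes x 1"
  by (simp add: commutes_def)

lemma commutes_add: "commutes x y \<Longrightarrow> commutes x z \<Longrightarrow> commutes x (y + z)"
  by (simp add: commutes_def algebra_simps)

lemma commutes_minus: "commutes x y \<Longrightarrow> commutes x (- y)"
  by (simp add: commutes_def)

lemma commutes_diff: "commutes x y \<Longrightarrow> commutes x z \<Longrightarrow> commutes x (y - z)"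
  by (simp add: commutes_def algebra_simps)

lemma commutes_mult: "commutes x y \<Longrightarrow> commutes x z \<Longrightarrow> commutes x (y * z)"
  by (metis commutes_def mult.assoc)

lemma commutes_prod_list: "(\<And>y. y \<in> set ys \<Longrightarrow> commutes x y) \<Longrightarrow> commutes x (prod_list ys)"
  by (induction ys) (auto intro: commutes_mult)

lemma commutesD: "commutes x y \<Longrightarrow> x * y = y * x"
  by (simp add: commutes_def)

lemma commutesD2: "commutes x y \<Longrightarrow> x * (y * z) = y * (x * z)"
  by (metis commutes_def mult.assoc)

text \<open>The sign expansion is carried out in any ring with these relations, where K acts through
  a central ring homomorphism \<open>sc\<close>. The operators \<open>lgen\<close> are the instance
  used later.\<close>

locale heckeB =
  fixes sc :: "'k::comm_ring_1 \<Rightarrow> 'r::ring_1" and T :: "nat \<Rightarrow> 'r" and n :: nat and v vi :: 'k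
  assumes sc_add: "sc (a + b) = sc a + sc b" and sc_mult: "sc (a * b) = sc a * sc b" and sc_1: "sc 1 = 1"
    and sc_central: "sc c * x = x * sc c" and v_vi: "v * vi = 1"
    and quad: "1 \<le> i \<Longrightarrow> i < n \<Longrightarrow> T i * T i = sc (v\<^sup>2 - 1) * T i + sc (v\<^sup>2)"
    and far: "i + 2 \<le> j \<Longrightarrow> j < n \<Longrightarrow> T i * T j = T j * T i"
    and braid: "1 \<le> i \<Longrightarrow> Suc i < n \<Longrightarrow> T i * T (Suc i) * T i = T (Suc i) * T i * T (Suc i)"
    and braid0: "1 < n \<Longrightarrow> T 0 * T 1 * T 0 * T 1 = T 1 * T 0 * T 1 * T 0"
begin

lemma sc_0 [simp]: "sc 0 = 0"
  using sc_add[of 0 0] by simp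

lemma sc_minus: "sc (- a) = - sc a"
  using sc_add[of a "- a"] by (simp add: eq_neg_iff_add_eq_0 add.commute)

lemma commutes_sc [simp]: "commutes x (sc c)" "commutes (sc c) x"
  by (simp_all add: commutes_def sc_central)

lemma sc_left: "x * (sc c * y) = sc c * (x * y)"
  by (metis mult.assoc sc_central)

lemma sc_sc: "(sc a * x) * (sc b * y) = sc (a * b) * (x * y)"
  by (simp add: sc_mult mult.assoc sc_left[of x])

lemma sc_T: "T i * sc c = sc c * T i" "T i * (sc c * y) = sc c * (T i * y)"
  by (rule sc_central[symmetric], rule sc_left)

definition I :: "nat \<Rightarrow> 'r" where "I i = sc vi * T i"
definition Iv :: "nat \<Rightarrow> 'r" where "Iv i = I i - sc (v - vi)"

lemma I_sq: "1 \<le> i \<Longrightarrow> i < n \<Longrightarrow> I i * I i = sc (v - vi) * I i + 1"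
proof -
  assume i: "1 \<le> i" "i < n"
  have "I i * I i = sc (vi * vi) * (T i * T i)" by (simp add: I_def sc_mult mult.assoc sc_T)
  also have "\<dots> = sc (vi * vi * (v\<^sup>2 - 1)) * T i + sc (vi * vi * v\<^sup>2)"
    by (simp add: quad[OF i] distrib_left mult.assoc[symmetric] sc_mult[symmetric])
  also have "vi * vi * (v\<^sup>2 - 1) = (v - vi) * vi"
  proof -
    have "vi * vi * (v\<^sup>2 - 1) = (v * vi) * (v * vi) - vi * vi" by (simp add: power2_eq_square algebra_simps)
    then show ?thesis unfolding v_vi left_diff_distrib by simp
  qed
  also have "vi * vi * v\<^sup>2 = 1" using v_vi by (metis mult.commute power2_eq_square power_mult_distrib power_one)
  finally show ?thesis by (simp add: sc_1 sc_mult I_def mult.assoc)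
qed

lemma I_Iv: "1 \<le> i \<Longrightarrow> i < n \<Longrightarrow> I i * Iv i = 1" "1 \<le> i \<Longrightarrow> i < n \<Longrightarrow> Iv i * I i = 1"
  by (simp_all add: Iv_def algebra_simps I_sq sc_central)

lemma commutes_I: "commutes x (T i) \<Longrightarrow> commutes x (I i)"
  by (simp add: I_def commutes_mult)

lemma commutes_Iv: "commutes x (T i) \<Longrightarrow> commutes x (Iv i)"
  by (simp add: Iv_def commutes_diff commutes_I)

lemma T_far: "i + 2 \<le> j \<or> j + 2 \<le> i \<Longrightarrow> i < n \<Longrightarrow> j < n \<Longrightarrow> commutes (T i) (T j)"
  using far[of i j] far[of j i] by (auto simp: commutes_def)

lemma I_braid: "1 \<le> i \<Longrightarrow> Suc i < n \<Longrightarrow> I i * (I (Suc i) * I i) = I (Suc i) * (I i * I (Suc i))"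
  using braid[of i] by (simp add: I_def mult.assoc sc_T)

text \<open>Indices start at \<open>0\<close>: this \<open>L i\<close> is the Jucys-Murphy element with index \<open>i + 1\<close>.\<close>
fun L :: "nat \<Rightarrow> 'r" where
  "L 0 = T 0"
| "L (Suc i) = I (Suc i) * L i * I (Suc i)"

lemma sc_L: "L i * sc c = sc c * L i" "L i * (sc c * y) = sc c * (L i * y)"
  by (rule sc_central[symmetric], rule sc_left)

lemma sc_I: "I i * sc c = sc c * I i" "I i * (sc c * y) = sc c * (I i * y)"
  by (rule sc_central[symmetric], rule sc_left)

text \<open>The critical case is j = i - 1. There L_i is I_i I_j L I_j I_i with an L that commutes
  with I_i. A factor I_j entering from the left becomes I_i by the braid relation, passes L, and
  leaves on the right as I_j by a second braid relation.\<close>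

lemma T_L: "1 \<le> j \<Longrightarrow> j < n \<Longrightarrow> i < n \<Longrightarrow> j \<noteq> i \<Longrightarrow> j \<noteq> Suc i \<Longrightarrow> commutes (T j) (L i)"
proof (induction i arbitrary: j rule: less_induct)
  case (less i)
  show ?case
  proof (cases i)
    case 0
    then show ?thesis using less.prems by (auto intro!: T_far)
  next
    case (Suc k)
    show ?thesis
    proof (cases "j = k")
      case False
      then have "commutes (T j) (L k)" using less Suc by auto
      moreover have "commutes (T j) (I (Suc k))" using less.prems Suc False by (auto intro!: T_far commutes_I)
      ultimately show ?thesis by (simp add: Suc commutes_mult)
    next
      case True
      then obtain l where l: "k = Suc l" using less.prems by (cases k) auto
      have BL: "commutes (I (Suc (Suc l))) (L l)"
        using less.IH[of l "Suc (Suc l)"] less.prems Suc l by (auto intro: commutes_I commutes_sym)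
      have br: "I (Suc l) * (I (Suc (Suc l)) * I (Suc l)) = I (Suc (Suc l)) * (I (Suc l) * I (Suc (Suc l)))"
        using I_braid[of "Suc l"] less.prems Suc l by auto
      have br': "I (Suc l) * (I (Suc (Suc l)) * (I (Suc l) * x)) = I (Suc (Suc l)) * (I (Suc l) * (I (Suc (Suc l)) * x))" for x
        using br by (metis mult.assoc)
      have "I (Suc l) * L (Suc (Suc l)) = I (Suc (Suc l)) * (I (Suc l) * (I (Suc (Suc l)) * (L l * (I (Suc l) * I (Suc (Suc l))))))"
        by (simp add: mult.assoc br')
      also have "\<dots> = I (Suc (Suc l)) * (I (Suc l) * (L l * (I (Suc (Suc l)) * (I (Suc l) * I (Suc (Suc l))))))"
        by (simp add: commutesD2[OF BL])
      also have "\<dots> = L (Suc (Suc l)) * I (Suc l)"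
        by (simp add: mult.assoc br[symmetric])
      finally have "sc v * (I (Suc l) * L (Suc (Suc l))) = sc v * (L (Suc (Suc l)) * I (Suc l))" by simp
      moreover have "sc v * (sc vi * x) = x" for x by (metis mult.assoc mult_1 sc_1 sc_mult v_vi)
      ultimately have "T (Suc l) * L (Suc (Suc l)) = L (Suc (Suc l)) * T (Suc l)"
        unfolding I_def[of "Suc l"] by (simp add: sc_L mult.assoc del: L.simps)
      then show ?thesis using True Suc l by (simp add: commutes_def)
    qed
  qed
qed

text \<open>For \<open>L 1\<close> this is the braid relation of length four; each later
  \<open>L\<close> only adds generators that commute with T_0.\<close>

lemma T0_L: "i < n \<Longrightarrow> commutes (T 0) (L i)"
proof (induction i)
  case 0 show ?case by (simp add: commutes_def)
next
  case (Suc i)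
  show ?case
  proof (cases i)
    case 0
    then show ?thesis using braid0 Suc.prems by (simp add: commutes_def I_def mult.assoc sc_T)
  next
    case (Suc k)
    then have "commutes (T 0) (I (Suc i))" using Suc.prems by (auto intro!: T_far commutes_I)
    then show ?thesis using Suc.IH Suc.prems by (simp add: commutes_mult)
  qed
qed

text \<open>Of two different elements, the one with the larger index commutes with T_0 and with all
  the generators from which the other is built.\<close>

lemma L_L: "i < n \<Longrightarrow> j < n \<Longrightarrow> commutes (L i) (L j)"
proof -
  have *: "i \<le> j \<Longrightarrow> j < n \<Longrightarrow> commutes (L j) (L i)" for i j
  proof (induction i)
    case 0 then show ?case using T0_L by (auto intro: commutes_sym)
  next
    case (Suc i)
    show ?case
    proof (cases "Suc i = j")
      case False
      then have "commutes (L j) (I (Suc i))" using Suc.prems by (auto intro!: commutes_I commutes_sym[OF T_L])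
      then show ?thesis using Suc by (simp add: commutes_mult)
    qed (simp add: commutes_def)
  qed
  show "i < n \<Longrightarrow> j < n \<Longrightarrow> commutes (L i) (L j)"
    using *[of i j] *[of j i] commutes_sym by (cases "i \<le> j") auto
qed

section \<open>Chains of normalised generators and the elements u_k\<close>

definition up :: "nat \<Rightarrow> nat \<Rightarrow> 'r" where "up b a = prod_list (map I [b..<Suc a])"
definition dn :: "nat \<Rightarrow> nat \<Rightarrow> 'r" where "dn a b = prod_list (map I (rev [b..<Suc a]))"
text \<open>The inverse of \<open>up b a\<close>, hence the chain with sign minus from a down to
  b.\<close>

definition dnv :: "nat \<Rightarrow> nat \<Rightarrow> 'r" where "dnv a b = prod_list (map Iv (rev [b..<Suc a]))"

lemma chain_Suc:
  "b \<le> Suc a \<Longrightarrow> up b (Suc a) = up b a * I (Suc a)"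
  "b \<le> Suc a \<Longrightarrow> dn (Suc a) b = I (Suc a) * dn a b"
  "b \<le> Suc a \<Longrightarrow> dnv (Suc a) b = Iv (Suc a) * dnv a b"
  by (simp_all add: up_def dn_def dnv_def)

lemma chain_empty [simp]: "up (Suc a) a = 1" "dn a (Suc a) = 1" "dnv a (Suc a) = 1"
  by (simp_all add: up_def dn_def dnv_def)

lemma commutes_chain:
  assumes "\<And>i. b \<le> i \<Longrightarrow> i \<le> a \<Longrightarrow> commutes x (T i)"
  shows "commutes x (up b a)" "commutes x (dn a b)" "commutes x (dnv a b)"
  unfolding up_def dn_def dnv_def by (auto intro!: commutes_prod_list commutes_I commutes_Iv assms simp del: upt_Suc)

lemma dn_L_up: "b \<le> a \<Longrightarrow> L a = dn a (Suc b) * L b * up (Suc b) a"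
  by (induction a rule: dec_induct) (simp_all add: chain_Suc mult.assoc)

lemma dn_L: "b \<le> a \<Longrightarrow> a < n \<Longrightarrow> dn a (Suc b) * L b = L a * dnv a (Suc b)"
proof (induction a rule: dec_induct)
  case (step a)
  have "dn (Suc a) (Suc b) * L b = I (Suc a) * (L a * dnv a (Suc b))"
    using step by (simp add: chain_Suc mult.assoc)
  \<comment> \<open>Inserting I_(a+1) times its inverse to the right of L_a completes L_(a+1) and
    leaves the inverse generator to prolong \<open>dnv\<close>.\<close>
  also have "\<dots> = I (Suc a) * (L a * (I (Suc a) * Iv (Suc a)) * dnv a (Suc b))"
    using I_Iv[of "Suc a"] step.prems by simp
  also have "\<dots> = L (Suc a) * dnv (Suc a) (Suc b)"
    using step by (simp add: chain_Suc mult.assoc)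
  finally show ?case .
qed simp

definition u :: "nat \<Rightarrow> 'r" where "u k = prod_list (map (\<lambda>i. 1 + L i) [0..<k])"

lemma u_0 [simp]: "u 0 = 1" and u_Suc: "u (Suc k) = u k * (1 + L k)"
  by (simp_all add: u_def)

text \<open>The product is symmetric in two neighbouring Jucys-Murphy elements, and their sum and
  product commute with the generator exchanging them. In the expansion, the terms with v - vi that
  come from the quadratic relation are the same on both sides.\<close>

lemma I_LL: 
  assumes "Suc k < n" shows "commutes (I (Suc k)) ((1 + L k) * (1 + L (Suc k)))"
proof -
  let ?I = "I (Suc k)" and ?L = "L k"
  have sq: "?I * ?I = sc (v - vi) * ?I + 1" using I_sq assms by simp
  have c: "?L * (?I * (?L * ?I)) = ?I * (?L * (?I * ?L))"
    using commutesD[OF L_L[of k "Suc k"]] assms by (simp add: mult.assoc)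
  have 1: "?I * (?I * (?L * ?I)) = sc (v - vi) * (?I * (?L * ?I)) + ?L * ?I"
    unfolding mult.assoc[of ?I ?I, symmetric] sq by (simp add: distrib_right mult.assoc)
  have 2: "?I * (?L * (?I * ?I)) = sc (v - vi) * (?I * (?L * ?I)) + ?I * ?L"
    by (simp add: sq distrib_left sc_L sc_I)
  have 3: "?I * (?L * (?I * (?L * ?I))) = ?L * (?I * (?L * (?I * ?I)))" 
    using arg_cong[OF c, of "\<lambda>x. x * ?I"] by (simp only: mult.assoc)
  have "?I * ((1 + ?L) * (1 + L (Suc k))) = ?I + ?I * ?L + ?I * (?I * (?L * ?I)) + ?I * (?L * (?I * (?L * ?I)))"
    by (simp add: distrib_left distrib_right mult.assoc)
  moreover have "(1 + ?L) * (1 + L (Suc k)) * ?I = ?I + ?L * ?I + ?I * (?L * (?I * ?I)) + ?L * (?I * (?L * (?I * ?I)))"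
    by (simp add: distrib_left distrib_right mult.assoc)
  ultimately show ?thesis unfolding commutes_def 1 2 3 by (simp add: ac_simps)
qed

lemma T_I: "T i = sc v * I i"
  unfolding I_def by (metis mult.assoc mult_1 sc_1 sc_mult v_vi)

text \<open>When the last factor 1 + L_(k-1) is split off, it fails to commute with T_j only for j =
  k - 1. In that case the last two factors are split off together, by \<open>I_LL\<close>.\<close>

lemma T_u: "1 \<le> j \<Longrightarrow> j < n \<Longrightarrow> j \<noteq> k \<Longrightarrow> k \<le> n \<Longrightarrow> commutes (T j) (u k)"
proof (induction k rule: less_induct)
  case (less k)
  show ?case
  proof (cases k)
    case (Suc l)
    show ?thesis
    proof (cases "j = l")
      case False
      then have "commutes (T j) (u l)" "commutes (T j) (L l)" using less Suc by (auto intro!: T_L)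
      then show ?thesis by (simp add: Suc u_Suc commutes_mult commutes_add)
    next
      case True
      then obtain i where i: "l = Suc i" using less.prems by (cases l) auto
      have "commutes (T j) (u i)" using less i Suc True by auto
      moreover have "commutes (T j) ((1 + L i) * (1 + L l))"
        using I_LL[of i] less.prems Suc i True
        by (simp add: T_I[of "Suc i"] del: L.simps) (metis commutes_sc(1) commutes_mult commutes_sym)
      ultimately show ?thesis unfolding Suc i u_Suc mult.assoc
        using commutes_mult[of "T j" "u i"] i by blast
    qed
  qed simp
qed

section \<open>The type A subalgebra and congruences modulo the H u_b H\<close>

inductive_set subA :: "'r set" where
  subA_sc: "sc c \<in> subA"
| subA_T: "1 \<le> i \<Longrightarrow> i < n \<Longrightarrow> T i \<in> subA"
| subA_add: "x \<in> subA \<Longrightarrow> y \<in> subA \<Longrightarrow> x + y \<in> subA"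
| subA_mult: "x \<in> subA \<Longrightarrow> y \<in> subA \<Longrightarrow> x * y \<in> subA"

lemma subA_1: "1 \<in> subA" and subA_0: "0 \<in> subA"
  using subA_sc[of 1] subA_sc[of 0] by (auto simp: sc_1)

lemma subA_minus: "x \<in> subA \<Longrightarrow> - x \<in> subA"
  using subA_mult[OF subA_sc[of "-1"], of x] by (simp add: sc_minus sc_1)

lemma subA_diff: "x \<in> subA \<Longrightarrow> y \<in> subA \<Longrightarrow> x - y \<in> subA"
  using subA_add[of x "- y"] subA_minus by simp

lemma subA_prod_list: "(\<And>x. x \<in> set xs \<Longrightarrow> x \<in> subA) \<Longrightarrow> prod_list xs \<in> subA"
  by (induction xs) (auto intro: subA_1 subA_mult)

lemma subA_sum: "(\<And>x. x \<in> A \<Longrightarrow> f x \<in> subA) \<Longrightarrow> sum f A \<in> subA"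
  by (induction A rule: infinite_finite_induct) (auto intro: subA_0 subA_add)

lemma subA_I: "1 \<le> i \<Longrightarrow> i < n \<Longrightarrow> I i \<in> subA" "1 \<le> i \<Longrightarrow> i < n \<Longrightarrow> Iv i \<in> subA"
  by (auto simp: I_def Iv_def intro!: subA_diff subA_mult subA_sc subA_T)

lemma subA_chain:
  assumes "1 \<le> b" "a < n" shows "up b a \<in> subA" "dn a b \<in> subA" "dnv a b \<in> subA"
  unfolding up_def dn_def dnv_def using assms by (auto intro!: subA_prod_list subA_I simp del: upt_Suc)

text \<open>\<open>Jr (Suc m)\<close> is the paper's sum of the \<open>H u_b\<^sup>+ H\<close> with \<open>b > m\<close>.\<close>
inductive_set Jr :: "nat \<Rightarrow> 'r set" for a where
  Jr_0: "0 \<in> Jr a"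
| Jr_gen: "x \<in> subA \<Longrightarrow> z \<in> subA \<Longrightarrow> a \<le> b \<Longrightarrow> b \<le> n \<Longrightarrow> x * u b * z \<in> Jr a"
| Jr_add: "x \<in> Jr a \<Longrightarrow> y \<in> Jr a \<Longrightarrow> x + y \<in> Jr a"

lemma Jr_mono: "x \<in> Jr a \<Longrightarrow> b \<le> a \<Longrightarrow> x \<in> Jr b"
  by (induction rule: Jr.induct) (auto intro: Jr.intros)

lemma Jr_mult: "x \<in> Jr a \<Longrightarrow> y \<in> subA \<Longrightarrow> z \<in> subA \<Longrightarrow> y * x * z \<in> Jr a"
proof (induction rule: Jr.induct)
  case (Jr_gen x' z' b)
  then have "(y * x') * u b * (z' * z) \<in> Jr a" by (intro Jr.Jr_gen subA_mult)
  then show ?case by (simp add: mult.assoc)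
qed (auto simp: distrib_left distrib_right intro: Jr.intros)

lemma Jr_minus: "x \<in> Jr a \<Longrightarrow> - x \<in> Jr a"
  using Jr_mult[of x a "-1" 1] by (simp add: subA_1 subA_minus)

lemma Jr_diff: "x \<in> Jr a \<Longrightarrow> y \<in> Jr a \<Longrightarrow> x - y \<in> Jr a"
  using Jr_add[of x a "- y"] Jr_minus by simp

lemma Jr_u: "a \<le> b \<Longrightarrow> b \<le> n \<Longrightarrow> u b \<in> Jr a"
  using Jr_gen[of 1 1 a b] by (simp add: subA_1)

lemma Jr_sum: "(\<And>x. x \<in> A \<Longrightarrow> f x \<in> Jr a) \<Longrightarrow> sum f A \<in> Jr a"
  by (induction A rule: infinite_finite_induct) (auto intro: Jr.intros)

text \<open>L_j is L_a enclosed in two chains. The left chain commutes with u_a, the right one with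
  X, and u_a L_a = u_(a+1) - u_a. A factor L_j is thus traded for type A factors outside and an
  increase of the index of u.\<close>

lemma u_L_shift:
  assumes "a \<le> j" "j < n" "\<And>i. a < i \<Longrightarrow> i \<le> j \<Longrightarrow> commutes X (T i)"
  shows "u a * (- L j * X) = - (dn j (Suc a) * (u (Suc a) * X - u a * X) * up (Suc a) j)"
proof -
  have c: "commutes X (up (Suc a) j)" using assms by (intro commutes_chain) auto
  have c': "commutes (u a) (dn j (Suc a))"
    by (intro commutes_chain commutes_sym[OF T_u]) (use assms in auto)
  have "u a * (L j * X) = u a * (dn j (Suc a) * (L a * (up (Suc a) j * X)))"
    using dn_L_up[OF assms(1)] by (simp add: mult.assoc)
  also have "\<dots> = dn j (Suc a) * (u a * (L a * (X * up (Suc a) j)))"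
    by (simp add: commutesD2[OF c'] commutesD[OF c])
  also have "\<dots> = dn j (Suc a) * (u (Suc a) * X - u a * X) * up (Suc a) j"
    by (simp add: u_Suc algebra_simps)
  finally show ?thesis by simp
qed

lemma Ls_commute:
  assumes "\<forall>l \<in> set js. j < l \<and> l < n" "1 \<le> i" "i \<le> j"
  shows "commutes (prod_list (map (\<lambda>j. - L j) js)) (T i)"
  using assms by (intro commutes_sym[OF commutes_prod_list]) (auto intro!: commutes_minus T_L)

text \<open>Since \<open>Jr a\<close> is stable only under type A factors, this does not follow from
  u_a being in it. Increasing order lets the remaining L's pass the chain of the first one, and as
  they exceed a, the induction hypothesis applies both to a and to a + 1.\<close>

lemma u_Ls_Jr:
  assumes "sorted_wrt (<) js" "\<forall>j \<in> set js. a \<le> j \<and> j < n" "a \<le> n"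
  shows "u a * prod_list (map (\<lambda>j. - L j) js) \<in> Jr a"
  using assms
proof (induction js arbitrary: a)
  case Nil then show ?case by (simp add: Jr_u)
next
  case (Cons j js)
  let ?X = "prod_list (map (\<lambda>j. - L j) js)"
  have "u (Suc a) * ?X \<in> Jr (Suc a)" "u a * ?X \<in> Jr a" using Cons by (auto intro!: Cons.IH)
  then have "u (Suc a) * ?X - u a * ?X \<in> Jr a" using Jr_diff Jr_mono[of _ "Suc a" a] by simp
  then have "- (dn j (Suc a) * (u (Suc a) * ?X - u a * ?X) * up (Suc a) j) \<in> Jr a"
    using Cons.prems by (intro Jr_minus Jr_mult subA_chain) auto
  moreover have "u a * (- L j * ?X) = - (dn j (Suc a) * (u (Suc a) * ?X - u a * ?X) * up (Suc a) j)"
    using Cons.prems by (intro u_L_shift Ls_commute[where j = j]) auto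
  ultimately show ?case by simp
qed

text \<open>This is c_(a,j-a) of the theorem with j as absolute index. It is L_j with its inner L_a
  replaced by 1: as u_a L_a is congruent to -u_a, it is what -L_j becomes behind u_a. For j = a both
  chains are empty.\<close>

definition c :: "nat \<Rightarrow> nat \<Rightarrow> 'r" where "c a j = dn j (Suc a) * up (Suc a) j"

lemma subA_c: "j < n \<Longrightarrow> c a j \<in> subA"
  by (auto simp: c_def intro!: subA_mult subA_chain)

lemma u_Ls_cong:
  assumes "sorted_wrt (<) js" "\<forall>j \<in> set js. a \<le> j \<and> j < n" "a \<le> n"
  shows "u a * prod_list (map (\<lambda>j. - L j) js) - u a * prod_list (map (c a) js) \<in> Jr (Suc a)"
  using assms
proof (induction js)
  case Nil then show ?case by (simp add: Jr_0)
next
  case (Cons j js)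
  let ?X = "prod_list (map (\<lambda>j. - L j) js)" and ?C = "prod_list (map (c a) js)"
  have cd: "commutes (u a) (dn j (Suc a))"
    by (intro commutes_chain commutes_sym[OF T_u]) (use Cons.prems in auto)
  have cu: "commutes (u a) (up (Suc a) j)"
    by (intro commutes_chain commutes_sym[OF T_u]) (use Cons.prems in auto)
  have cX: "commutes ?X (up (Suc a) j)"
    using Cons.prems by (intro commutes_chain Ls_commute[where j = j]) auto
  have s: "u a * (- L j * ?X) = - (dn j (Suc a) * (u (Suc a) * ?X - u a * ?X) * up (Suc a) j)"
    using Cons.prems by (intro u_L_shift Ls_commute[where j = j]) auto
  have 1: "dn j (Suc a) * (u a * ?X) * up (Suc a) j = c a j * (u a * ?X)"
    by (simp add: mult.assoc c_def commutesD[OF cX] commutesD2[OF cu])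
  have 2: "u a * (c a j * ?C) = c a j * (u a * ?C)"
    by (simp add: mult.assoc c_def commutesD2[OF cd] commutesD2[OF cu])
  \<comment> \<open>The error splits into a term with u_(a+1), covered by \<open>u_Ls_Jr\<close>,
    and \<open>c a j\<close> times the error for the shorter list. The coefficient can be placed in
    front because u_a commutes with it.\<close>
  have e: "u a * (- L j * ?X) - u a * (c a j * ?C)
      = - (dn j (Suc a) * (u (Suc a) * ?X) * up (Suc a) j) + c a j * (u a * ?X - u a * ?C) * 1"
    unfolding s 2 right_diff_distrib left_diff_distrib 1 by simp
  have "u (Suc a) * ?X \<in> Jr (Suc a)" using Cons.prems by (intro u_Ls_Jr) auto
  then have "- (dn j (Suc a) * (u (Suc a) * ?X) * up (Suc a) j) \<in> Jr (Suc a)"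
    using Cons.prems by (intro Jr_minus Jr_mult subA_chain) auto
  moreover have "c a j * (u a * ?X - u a * ?C) * 1 \<in> Jr (Suc a)"
    using Cons by (intro Jr_mult subA_1 subA_c) auto
  ultimately show ?case unfolding list.map prod_list.Cons e by (rule Jr_add)
qed

text \<open>The factors 1 - L_j commute, so the last chain may absorb 1 - L_k first by
  \<open>dn_L\<close>. The remaining ones involve only L_j with j < k and commute with the result,
  whose generators have index above k. For k = m the chains multiply to the normalised T_w.\<close>

lemma chains_Ls:
  assumes "m + k \<le> n"
  shows "prod_list (map (\<lambda>j. dn (m + j) (Suc j)) [0..<k]) * prod_list (map (\<lambda>j. 1 - L j) [0..<k])
    = prod_list (map (\<lambda>j. dn (m + j) (Suc j) - L (m + j) * dnv (m + j) (Suc j)) [0..<k])"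
  using assms
proof (induction k)
  case (Suc k)
  let ?Q = "prod_list (map (\<lambda>j. dn (m + j) (Suc j)) [0..<k])" and ?N = "prod_list (map (\<lambda>j. 1 - L j) [0..<k])"
  have NT: "commutes ?N (T i)" if "k < i" "i \<le> m + k" for i
    by (intro commutes_sym[OF commutes_prod_list])
      (use that Suc.prems in \<open>auto intro!: commutes_diff T_L\<close>)
  have NL: "commutes ?N (L i)" if "i < n" for i
    by (intro commutes_sym[OF commutes_prod_list])
      (use that Suc.prems in \<open>auto intro!: commutes_diff L_L\<close>)
  have "commutes ?N (1 - L k)" using NL Suc.prems by (auto intro: commutes_diff)
  then have "?Q * dn (m + k) (Suc k) * (?N * (1 - L k)) = ?Q * (dn (m + k) (Suc k) * (1 - L k)) * ?N"
    by (simp add: commutesD mult.assoc)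
  also have "dn (m + k) (Suc k) * (1 - L k) = dn (m + k) (Suc k) - L (m + k) * dnv (m + k) (Suc k)"
    using dn_L[of k "m + k"] Suc.prems by (simp add: algebra_simps)
  also have "?Q * (dn (m + k) (Suc k) - L (m + k) * dnv (m + k) (Suc k)) * ?N =
      ?Q * ?N * (dn (m + k) (Suc k) - L (m + k) * dnv (m + k) (Suc k))"
  proof -
    have "commutes ?N (dn (m + k) (Suc k) - L (m + k) * dnv (m + k) (Suc k))"
      using Suc.prems by (intro commutes_diff commutes_mult NL commutes_chain NT) auto
    from commutesD[OF this] show ?thesis by (simp only: mult.assoc)
  qed
  finally show ?case using Suc by (simp add: mult.assoc)
qed simp

end

lemma sum_lists_snoc:
  fixes g :: "bool list \<Rightarrow> 'a::comm_monoid_add"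
  shows "(\<Sum>eps | length eps = Suc k. g eps) = (\<Sum>eps | length eps = k. g (eps @ [True]) + g (eps @ [False]))"
proof -
  have fin: "finite {eps :: bool list. length eps = k}"
    using finite_lists_length_eq[of "UNIV :: bool set" k] by simp
  have "{eps :: bool list. length eps = Suc k} = (\<lambda>eps. eps @ [True]) ` {eps. length eps = k} \<union> (\<lambda>eps. eps @ [False]) ` {eps. length eps = k}"
  proof (intro equalityI subsetI)
    fix eps :: "bool list" assume "eps \<in> {eps. length eps = Suc k}"
    then obtain e b where "eps = e @ [b]" "length e = k" by (cases eps rule: rev_cases) auto
    then show "eps \<in> (\<lambda>eps. eps @ [True]) ` {eps. length eps = k} \<union> (\<lambda>eps. eps @ [False]) ` {eps. length eps = k}"
      by (cases b) auto
  qed auto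
  then show ?thesis using fin
    by (simp, subst sum.union_disjoint) (auto simp: sum.reindex inj_on_def sum.distrib)
qed

section \<open>Expansion over sign tuples\<close>

context heckeB begin

text \<open>The image of \<open>Ieps\<close> under the anti-automorphism, with the signs read
  backwards: position j here belongs to the factor k = m - j there, since (m+1-k, 2m-k) = (j+1,
  m+j).\<close>

definition chains :: "nat \<Rightarrow> bool list \<Rightarrow> 'r" where
  "chains m eps = prod_list (map (\<lambda>j. if eps ! j then dn (m + j) (Suc j) else dnv (m + j) (Suc j)) [0..<length eps])"

definition minuses :: "bool list \<Rightarrow> nat list" where
  "minuses eps = filter (\<lambda>j. \<not> eps ! j) [0..<length eps]"

lemma chains_snoc: "chains m (eps @ [b]) =
    chains m eps * (if b then dn (m + length eps) (Suc (length eps)) else dnv (m + length eps) (Suc (length eps)))"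
proof -
  have "map (\<lambda>j. if (eps @ [b]) ! j then dn (m + j) (Suc j) else dnv (m + j) (Suc j)) [0..<length eps]
      = map (\<lambda>j. if eps ! j then dn (m + j) (Suc j) else dnv (m + j) (Suc j)) [0..<length eps]"
    by (rule map_cong) (auto simp: nth_append)
  then show ?thesis by (simp add: chains_def del: map_eq_conv split del: if_split)
qed

lemma minuses_snoc: "minuses (eps @ [b]) = minuses eps @ (if b then [] else [length eps])"
proof -
  have "filter (\<lambda>j. \<not> (eps @ [b]) ! j) [0..<length eps] = filter (\<lambda>j. \<not> eps ! j) [0..<length eps]"
    by (rule filter_cong) (auto simp: nth_append)
  then show ?thesis by (simp add: minuses_def)
qed

text \<open>Each selected -L_(m+k) passes the earlier chains, whose generators have index below m +
  k. All selected L's thereby collect on the left in increasing order, as \<open>u_Ls_cong\<close>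
  requires.\<close>

lemma chains_expand:
  assumes "m + k \<le> n"
  shows "prod_list (map (\<lambda>j. dn (m + j) (Suc j) - L (m + j) * dnv (m + j) (Suc j)) [0..<k]) =
    (\<Sum>eps | length eps = k. prod_list (map (\<lambda>j. - L (m + j)) (minuses eps)) * chains m eps)"
  using assms
proof (induction k)
  case 0
  have "{eps :: bool list. length eps = 0} = {[]}" by auto
  then show ?case by (simp add: minuses_def chains_def)
next
  case (Suc k)
  have "chains m eps * L (m + k) = L (m + k) * chains m eps" if "length eps = k" for eps
  proof -
    have "commutes (L (m + k)) (chains m eps)"
      unfolding chains_def
    proof (rule commutes_prod_list)
      fix y assume "y \<in> set (map (\<lambda>j. if eps ! j then dn (m + j) (Suc j) else dnv (m + j) (Suc j)) [0..<length eps])"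
      then obtain j where "j \<in> {0..<length eps}" "y = (if eps ! j then dn (m + j) (Suc j) else dnv (m + j) (Suc j))"
        unfolding set_map set_upt by (elim imageE)
      then have j: "j < k" "y = dn (m + j) (Suc j) \<or> y = dnv (m + j) (Suc j)" using that by auto
      have "commutes (L (m + k)) (dn (m + j) (Suc j))" "commutes (L (m + k)) (dnv (m + j) (Suc j))"
        using j Suc.prems by (auto intro!: commutes_chain commutes_sym[OF T_L])
      then show "commutes (L (m + k)) y" using j by auto
    qed
    then show ?thesis by (simp add: commutes_def)
  qed
  then have *: "chains m eps * (L (m + k) * x) = L (m + k) * (chains m eps * x)" if "length eps = k" for eps x
    using that by (simp add: mult.assoc[symmetric])
  let ?M = "\<lambda>eps. prod_list (map (\<lambda>j. - L (m + j)) (minuses eps))"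
  have "?M eps * chains m eps * (dn (m + k) (Suc k) - L (m + k) * dnv (m + k) (Suc k))
      = ?M (eps @ [True]) * chains m (eps @ [True]) + ?M (eps @ [False]) * chains m (eps @ [False])"
    if "length eps = k" for eps
    using *[OF that] that by (simp add: chains_snoc minuses_snoc right_diff_distrib mult.assoc)
  then show ?case using Suc by (simp add: sum_lists_snoc sum_distrib_right)
qed

lemma sorted_minuses: "sorted_wrt (<) (map ((+) m) (minuses eps))"
  unfolding minuses_def sorted_wrt_map
  by (rule sorted_wrt_mono_rel[of _ "(<)"]) (auto intro: sorted_wrt_filter)

text \<open>The congruence for the L's is multiplied on the right by the chains, which lie in the
  type A algebra and therefore preserve the ideal.\<close>

lemma u_chains_Ls_cong:
  assumes "m + m \<le> n"
  shows "u m * (prod_list (map (\<lambda>j. dn (m + j) (Suc j)) [0..<m]) * prod_list (map (\<lambda>j. 1 - L j) [0..<m]))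
    - u m * (\<Sum>eps | length eps = m. prod_list (map (\<lambda>j. c m (m + j)) (minuses eps)) * chains m eps) \<in> Jr (Suc m)"
proof -
  have "u m * prod_list (map (\<lambda>j. - L (m + j)) (minuses eps)) * chains m eps
      - u m * prod_list (map (\<lambda>j. c m (m + j)) (minuses eps)) * chains m eps \<in> Jr (Suc m)" if "length eps = m" for eps
  proof -
    have "chains m eps \<in> subA" unfolding chains_def
      using that assms by (auto intro!: subA_prod_list subA_chain)
    moreover have "u m * prod_list (map (\<lambda>j. - L j) (map ((+) m) (minuses eps)))
       - u m * prod_list (map (c m) (map ((+) m) (minuses eps))) \<in> Jr (Suc m)"
      using that assms by (intro u_Ls_cong sorted_minuses) (auto simp: minuses_def)
    ultimately have "1 * (u m * prod_list (map (\<lambda>j. - L j) (map ((+) m) (minuses eps)))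
       - u m * prod_list (map (c m) (map ((+) m) (minuses eps)))) * chains m eps \<in> Jr (Suc m)"
      by (intro Jr_mult subA_1)
    then show ?thesis by (simp add: comp_def left_diff_distrib)
  qed
  then have "(\<Sum>eps | length eps = m. u m * prod_list (map (\<lambda>j. - L (m + j)) (minuses eps)) * chains m eps
      - u m * prod_list (map (\<lambda>j. c m (m + j)) (minuses eps)) * chains m eps) \<in> Jr (Suc m)"
    by (intro Jr_sum) auto
  then show ?thesis unfolding chains_Ls[OF assms] chains_expand[OF assms]
    by (simp add: sum_subtractf sum_distrib_left mult.assoc)
qed

text \<open>The leading term of \<open>u_b\<^sup>+\<close> is \<open>Dr b * Wr b\<close>, where \<open>Dr b\<close> is \<open>T_d\<close> for a minimal coset
  representative \<open>d\<close> and \<open>Wr b\<close> is a unit of the type A subalgebra.\<close>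
fun Dr :: "nat \<Rightarrow> 'r" where
  "Dr 0 = 1" | "Dr (Suc b) = Dr b * prod_list (map T (rev [0..<Suc b]))"

fun Wr :: "nat \<Rightarrow> 'r" where
  "Wr 0 = 1" | "Wr (Suc b) = prod_list (map T [1..<Suc b]) * Wr b"

definition t :: "nat \<Rightarrow> 'r" where "t b = prod_list (map T (rev [1..<b+1] @ [0] @ [1..<b+1]))"

lemma L_t: "L b = sc (vi ^ (2 * b)) * t b"
proof (induction b)
  case 0 then show ?case by (simp add: t_def sc_1)
next
  case (Suc b)
  have "t (Suc b) = T (Suc b) * t b * T (Suc b)" by (simp add: t_def mult.assoc)
  moreover have "vi * vi ^ (2 * b) * vi = vi ^ (2 * Suc b)" by simp
  ultimately show ?case using Suc by (simp only: L.simps I_def sc_sc)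
qed

lemma t_L: "t b = sc ((v\<^sup>2) ^ b) * L b"
proof -
  have "(v\<^sup>2) ^ b * vi ^ (2 * b) = 1" using v_vi by (metis power_mult power_mult_distrib power_one)
  then show ?thesis unfolding L_t by (simp add: mult.assoc[symmetric] sc_mult[symmetric] sc_1)
qed

lemma Wr_commutes: "b \<le> k \<Longrightarrow> k < n \<Longrightarrow> commutes (t k) (Wr b)"
proof (induction b)
  case (Suc b)
  have "commutes (t k) (T i)" if "1 \<le> i" "i < Suc b" for i
    unfolding t_L using that Suc.prems by (intro commutes_sym[OF commutes_mult] T_L) auto
  then show ?case using Suc by (auto intro!: commutes_mult commutes_prod_list)
qed simp

text \<open>\<open>t b\<close> commutes with \<open>Wr b\<close> and can be moved in front of it.
  Cut after T_0, its left half prolongs \<open>Dr b\<close> and its right half prolongs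
  \<open>Wr b\<close>. This recursion makes \<open>Wr b\<close> the basis element of the longest
  permutation of Sigma_b.\<close>

lemma Dr_Wr_t: "b < n \<Longrightarrow> Dr b * Wr b * t b = Dr (Suc b) * Wr (Suc b)"
proof -
  assume b: "b < n"
  have "[0..<Suc b] = 0 # [1..<Suc b]" using upt_conv_Cons[of 0 "Suc b"] by simp
  then have t: "t b = prod_list (map T (rev [0..<Suc b])) * prod_list (map T [1..<Suc b])"
    by (simp add: t_def mult.assoc del: upt_Suc)
  have "Dr b * Wr b * t b = Dr b * (t b * Wr b)"
    using commutesD[OF Wr_commutes[of b b]] b by (simp add: mult.assoc)
  then show ?thesis unfolding t by (simp add: mult.assoc del: upt_Suc)
qed

lemma T_inv: "1 \<le> i \<Longrightarrow> i < n \<Longrightarrow> T i * (sc vi * Iv i) = 1" "1 \<le> i \<Longrightarrow> i < n \<Longrightarrow> (sc vi * Iv i) * T i = 1"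
proof -
  assume i: "1 \<le> i" "i < n"
  show "T i * (sc vi * Iv i) = 1" using I_Iv(1)[OF i] unfolding I_def by (simp add: sc_T mult.assoc)
  show "(sc vi * Iv i) * T i = 1" using I_Iv(2)[OF i] unfolding I_def sc_central[of vi "Iv i"] by (simp add: mult.assoc)
qed

lemma prod_T_inv:
  "set ws \<subseteq> {1..<n} \<Longrightarrow> \<exists>y \<in> subA. prod_list (map T ws) * y = 1 \<and> y * prod_list (map T ws) = 1"
proof (induction ws)
  case Nil then show ?case using subA_1 by auto
next
  case (Cons i ws)
  then obtain y where y: "y \<in> subA" "prod_list (map T ws) * y = 1" "y * prod_list (map T ws) = 1" by auto
  have i: "1 \<le> i" "i < n" using Cons.prems by auto
  have "T i * prod_list (map T ws) * (y * (sc vi * Iv i)) = T i * (prod_list (map T ws) * y) * (sc vi * Iv i)"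
    by (simp add: mult.assoc)
  moreover have "y * (sc vi * Iv i) * (T i * prod_list (map T ws)) = y * ((sc vi * Iv i) * T i) * prod_list (map T ws)"
    by (simp add: mult.assoc)
  ultimately show ?case using y T_inv[OF i] i
    by (intro bexI[of _ "y * (sc vi * Iv i)"]) (auto intro!: subA_mult subA_sc subA_I)
qed

lemma Wr_unit: "b \<le> n \<Longrightarrow> \<exists>y \<in> subA. Wr b * y = 1 \<and> y * Wr b = 1"
proof -
  assume b: "b \<le> n"
  have "\<exists>ws. set ws \<subseteq> {1..<n} \<and> Wr b = prod_list (map T ws)" using b
  proof (induction b)
    case 0 then show ?case by (intro exI[of _ "[]"]) auto
  next
    case (Suc b)
    then obtain ws where ws: "set ws \<subseteq> {1..<n}" "Wr b = prod_list (map T ws)" by auto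
    show ?case by (rule exI[of _ "[1..<Suc b] @ ws"]) (use ws Suc.prems in \<open>auto simp: mult.assoc\<close>)
  qed
  then show ?thesis using prod_T_inv by auto
qed

lemma Wr_subA: "b \<le> n \<Longrightarrow> Wr b \<in> subA"
  by (induction b) (auto intro!: subA_1 subA_mult subA_prod_list subA_T)

text \<open>\<open>t i\<close> is q^i times \<open>L i\<close>, so each factor releases q^i.\<close>

lemma u_scaled: "prod_list (map (\<lambda>i. sc ((v\<^sup>2) ^ i) + t i) [0..<k]) = sc (\<Prod>i<k. (v\<^sup>2) ^ i) * u k"
  "prod_list (map (\<lambda>i. sc ((v\<^sup>2) ^ i) - t i) [0..<k]) = sc (\<Prod>i<k. (v\<^sup>2) ^ i) * prod_list (map (\<lambda>i. 1 - L i) [0..<k])"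
proof (induction k)
  case (Suc k)
  have e: "sc ((v\<^sup>2) ^ k) + t k = sc ((v\<^sup>2) ^ k) * (1 + L k)" "sc ((v\<^sup>2) ^ k) - t k = sc ((v\<^sup>2) ^ k) * (1 - L k)"
    by (simp_all add: t_L algebra_simps)
  { case 1 then show ?case using Suc by (simp add: u_Suc e sc_sc) next
    case 2 then show ?case using Suc by (simp add: e sc_sc) }
qed (simp_all add: sc_1)

end

section \<open>The operator model of the Hecke algebra\<close>

lemma HB_hadd: "f \<in> HB n \<Longrightarrow> g \<in> HB n \<Longrightarrow> hadd f g \<in> HB n"
  by (auto simp: HB_def hadd_def) (metis add.right_neutral)

lemma HB_hsmult: "f \<in> HB n \<Longrightarrow> hsmult c f \<in> HB n"
  by (auto simp: HB_def hsmult_def) (metis mult_zero_right)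

lemma HB_Tb: "w \<in> WB n \<Longrightarrow> Tb w \<in> HB n"
  by (auto simp: HB_def Tb_def split: if_splits)

lemma HB_hone: "hone \<in> HB n"
  by (simp add: hone_def HB_Tb)

lemma HB_Rgen: "Rgen n q j f \<in> HB n"
  by (auto simp: HB_def Rgen_def)

lemma app_lgen_HB: "f \<in> HB n \<Longrightarrow> app (lgen n q i) f = Lgen n q i f"
proof (rule ext)
  fix y assume f: "f \<in> HB n"
  have "y \<notin> WB n \<Longrightarrow> f y = 0" using f by (auto simp: HB_def)
  then show "app (lgen n q i) f y = Lgen n q i f y" by (simp add: app_lgen Lgen_def)
qed

lemma Rgen_hadd: "Rgen n q j (hadd f g) = hadd (Rgen n q j f) (Rgen n q j g)"
  by (auto simp: Rgen_def hadd_def algebra_simps)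

lemma Rgen_hsmult: "Rgen n q j (hsmult c f) = hsmult c (Rgen n q j f)"
  by (auto simp: Rgen_def hsmult_def algebra_simps)

lemma app_hadd_op: "app (X + Y) f = hadd (app X f) (app Y f)"
  by (rule ext) (simp add: hadd_def)

lemma app_sum: "app (sum F A) f y = (\<Sum>x\<in>A. app (F x) f y)"
  by (induction A rule: infinite_finite_induct) auto

text \<open>On \<open>HB n\<close> these operators are the left multiplications: by
  \<open>Rcom_ext\<close> they are determined there by their value at \<open>hone\<close>.\<close>

definition Rcom :: "nat \<Rightarrow> 'k::comm_ring_1 \<Rightarrow> 'k lop set" where
  "Rcom n q = {X. \<forall>f \<in> HB n. app X f \<in> HB n \<and> (\<forall>j<n. app X (Rgen n q j f) = Rgen n q j (app X f))}"

lemma HB_expand: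
  assumes "f \<in> HB n" shows "app X f y = (\<Sum>w\<in>WB n. f w * app X (Tb w) y)"
proof -
  have "app X (\<lambda>y. \<Sum>w\<in>A. f w * Tb w y) y = (\<Sum>w\<in>A. f w * app X (Tb w) y)" if "finite A" for A
    using that
  proof (induction A)
    case empty
    have "(\<lambda>y :: int \<Rightarrow> int. 0 :: 'a) = hsmult 0 (\<lambda>y. 0)" by (simp add: hsmult_def)
    then have "app X (\<lambda>y. 0) = hsmult 0 (app X (\<lambda>y. 0))" by (metis app_hsmult)
    then show ?case by (simp add: hsmult_def fun_eq_iff)
  next
    case (insert w A)
    then have "(\<lambda>y. \<Sum>w\<in>insert w A. f w * Tb w y) = hadd (hsmult (f w) (Tb w)) (\<lambda>y. \<Sum>w\<in>A. f w * Tb w y)"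
      by (auto simp: hadd_def hsmult_def)
    then show ?case using insert by (simp only: app_hadd app_hsmult) (simp add: hadd_def hsmult_def)
  qed
  note exp = this[OF finite_WB, of n]
  have "f = (\<lambda>y. \<Sum>w\<in>WB n. f w * Tb w y)"
  proof
    fix y
    have "(\<Sum>w\<in>WB n. f w * Tb w y) = (\<Sum>w\<in>WB n. if w = y then f y else 0)"
      by (rule sum.cong) (auto simp: Tb_def)
    then show "f y = (\<Sum>w\<in>WB n. f w * Tb w y)" using assms finite_WB by (auto simp: HB_def)
  qed
  from arg_cong[OF this, of "\<lambda>g. app X g y"] show ?thesis using exp by simp
qed

text \<open>Every T_w arises from \<open>hone\<close> by right multiplications along a reduced word,
  and both operators commute with those.\<close>

lemma Rcom_ext:
  assumes "X \<in> Rcom n q" "Y \<in> Rcom n q" "app X hone = app Y hone" "f \<in> HB n"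
  shows "app X f = app Y f"
proof -
  have "w \<in> WB n \<Longrightarrow> app X (Tb w) = app Y (Tb w)" for w
  proof (induction "blen n w" arbitrary: w rule: less_induct)
    case less
    show ?case
    proof (cases "w = id")
      case True then show ?thesis using assms(3) by (simp add: hone_def)
    next
      case False
      then obtain j where j: "j < n" "rdes w j" using no_rdes_imp_id less.prems by blast
      let ?w = "w \<circ> sgen j"
      have w: "?w \<in> WB n" using j less.prems by simp
      have "\<not> rdes ?w j" using rdes_comp_sgen j less.prems by blast
      then have e: "Tb w = Rgen n q j (Tb ?w)" using Rgen_Tb[of j n ?w q] j w by simp
      have "app X (Tb ?w) = app Y (Tb ?w)"
        using less.hyps[of ?w] blen_comp_sgen_des[of j n w] j less.prems w by simp
      then show ?thesis using assms(1,2) j HB_Tb[OF w] unfolding e Rcom_def by auto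
    qed
  qed
  then show ?thesis using HB_expand[OF assms(4)] by (intro ext) simp
qed

inductive_set genB :: "nat \<Rightarrow> 'k::comm_ring_1 \<Rightarrow> 'k lop set" for n q where
  genB_sc: "lsc c \<in> genB n q"
| genB_T: "i < n \<Longrightarrow> lgen n q i \<in> genB n q"
| genB_add: "X \<in> genB n q \<Longrightarrow> Y \<in> genB n q \<Longrightarrow> X + Y \<in> genB n q"
| genB_mult: "X \<in> genB n q \<Longrightarrow> Y \<in> genB n q \<Longrightarrow> X * Y \<in> genB n q"

lemma genB_Rcom: "X \<in> genB n q \<Longrightarrow> X \<in> Rcom n q"
proof (induction rule: genB.induct)
  case (genB_T i)
  have "Lgen n q i f \<in> HB n" for f by (auto simp: HB_def Lgen_def)
  then show ?case using genB_T by (auto simp: Rcom_def app_lgen_HB HB_Rgen Lgen_Rgen_commute)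
next
  case (genB_add X Y)
  then show ?case unfolding Rcom_def by (auto simp: app_hadd_op HB_hadd Rgen_hadd)
next
  case (genB_mult X Y)
  then show ?case unfolding Rcom_def by auto
qed (auto simp: Rcom_def HB_hsmult Rgen_hsmult)

lemma genB_HB: "X \<in> genB n q \<Longrightarrow> f \<in> HB n \<Longrightarrow> app X f \<in> HB n"
  using genB_Rcom by (auto simp: Rcom_def)

lemma genB_1: "1 \<in> genB n q" and genB_0: "(0 :: 'a lop) \<in> genB n (q :: 'a::comm_ring_1)"
proof -
  have "lsc 0 = (0 :: 'a lop)" by (rule lop_eqI) (simp add: hsmult_def)
  then show "1 \<in> genB n q" "0 \<in> genB n q" using genB_sc[of 1 n q] genB_sc[of 0 n q] by (simp_all add: lsc_hom)
qed

lemma genB_minus: "X \<in> genB n q \<Longrightarrow> - X \<in> genB n q"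
proof -
  have "- X = lsc (-1) * X" by (rule lop_eqI) (simp add: hsmult_def)
  then show "X \<in> genB n q \<Longrightarrow> - X \<in> genB n q" by (simp add: genB_mult genB_sc)
qed

lemma genB_diff: "X \<in> genB n q \<Longrightarrow> Y \<in> genB n q \<Longrightarrow> X - Y \<in> genB n q"
  using genB_add[of X n q "- Y"] genB_minus[of Y n q] by simp

lemma genB_prod_list: "(\<And>X. X \<in> set Xs \<Longrightarrow> X \<in> genB n q) \<Longrightarrow> prod_list Xs \<in> genB n q"
  by (induction Xs) (auto intro: genB_1 genB_mult)

lemma genB_sum: "(\<And>x. x \<in> A \<Longrightarrow> F x \<in> genB n q) \<Longrightarrow> sum F A \<in> genB n q"
  by (induction A rule: infinite_finite_induct) (auto intro: genB_0 genB_add)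

section \<open>Evaluation at the unit, reduced words and the product\<close>

definition ev :: "'k::comm_ring_1 lop \<Rightarrow> 'k hecke" where "ev X = app X hone"

definition Tword :: "nat \<Rightarrow> 'k::comm_ring_1 \<Rightarrow> nat list \<Rightarrow> 'k lop" where
  "Tword n q ws = prod_list (map (lgen n q) ws)"

lemma Tword_genB: "set ws \<subseteq> {..<n} \<Longrightarrow> Tword n q ws \<in> genB n q"
  by (auto simp: Tword_def intro!: genB_prod_list genB_T)

fun reduced :: "nat list \<Rightarrow> bool" where
  "reduced [] \<longleftrightarrow> True"
| "reduced (i # ws) \<longleftrightarrow> \<not> ldes (word_prod ws) i \<and> reduced ws"

lemma ldes_word_prod: "ldes (word_prod ws) i \<longleftrightarrow> word_prod (rev ws) (hi i) < word_prod (rev ws) (lo i)"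
  by (simp add: ldes_def rdes_def inv_word_prod)

lemma ev_Tword: "set ws \<subseteq> {..<n} \<Longrightarrow> reduced ws \<Longrightarrow> ev (Tword n q ws) = Tb (word_prod ws)"
proof (induction ws)
  case Nil then show ?case by (simp add: ev_def Tword_def hone_def id_def)
next
  case (Cons i ws)
  have w: "word_prod ws \<in> WB n" using Cons.prems by (auto intro: WB_I)
  have "ev (Tword n q (i # ws)) = app (lgen n q i) (ev (Tword n q ws))" by (simp add: ev_def Tword_def)
  also have "\<dots> = Lgen n q i (Tb (word_prod ws))" using Cons w by (simp add: app_lgen_HB HB_Tb)
  also have "\<dots> = Tb (word_prod (i # ws))" using Cons.prems w by (simp add: Lgen_Tb)
  finally show ?case .
qed

lemma reduced_iff: "set ws \<subseteq> {..<n} \<Longrightarrow> length ws = blen n (word_prod ws) \<Longrightarrow> reduced ws"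
proof (induction ws)
  case (Cons i ws)
  have w: "word_prod ws \<in> WB n" "i < n" using Cons.prems by (auto intro: WB_I)
  have le: "blen n (word_prod ws) \<le> length ws" using blen_le Cons.prems by auto
  have nd: "\<not> ldes (word_prod ws) i"
    using blen_sgen_comp_des[OF w(2,1)] Cons.prems(2) le by (cases "ldes (word_prod ws) i") (auto simp: comp_def)
  then have "blen n (word_prod ws) = length ws" using blen_sgen_comp[OF w(2,1)] Cons.prems(2) by (simp add: comp_def)
  then show ?case using nd Cons by auto
qed simp

lemma reduced_redword: "w \<in> WB n \<Longrightarrow> reduced (redword n w)"
  using reduced_iff redword by metis

text \<open>The first letter of a reduced word is a left descent. Were it 0, the inverse of the
  element would send 1 below the image of -1, but elements of \<open>WA n\<close> preserve
  signs.\<close>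

lemma reduced_WA: "set ws \<subseteq> {..<n} \<Longrightarrow> reduced ws \<Longrightarrow> word_prod ws \<in> WA n \<Longrightarrow> set ws \<subseteq> {1..<n}"
proof (induction ws)
  case (Cons i ws)
  have w: "word_prod ws \<in> WB n" "i < n" using Cons.prems by (auto intro: WB_I)
  have ld: "ldes (sgen i \<circ> word_prod ws) i" using ldes_sgen_comp w Cons.prems by auto
  have "i \<noteq> 0"
  proof
    assume "i = 0"
    then have "inv (word_prod (i # ws)) 1 < inv (word_prod (i # ws)) (-1)"
      using ld by (simp add: ldes_def rdes_def hi_def lo_def)
    moreover have "inv (word_prod (i # ws)) \<in> WA n" using Cons.prems(3) by (rule WA_inv)
    ultimately show False using WA_pos[of "inv (word_prod (i # ws))" n 1] WA_pos[of "inv (word_prod (i # ws))" n "-1"] by linarith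
  qed
  moreover have "word_prod ws \<in> WA n"
    using Cons.prems(3) WA_sgen_comp[of i n "word_prod ws"] w(2) \<open>i \<noteq> 0\<close> unfolding word_prod_Cons by linarith
  ultimately show ?case using Cons.IH Cons.prems w(2) by auto
qed simp

lemma redword_WA: "w \<in> WA n \<Longrightarrow> set (redword n w) \<subseteq> {1..<n}"
  using reduced_WA[of "redword n w" n] redword[of w n] reduced_redword[of w n] WA_WB[of w n] by simp

definition Tw :: "nat \<Rightarrow> 'k::comm_ring_1 \<Rightarrow> (int \<Rightarrow> int) \<Rightarrow> 'k lop" where "Tw n q w = Tword n q (redword n w)"

lemma ev_Tw: "w \<in> WB n \<Longrightarrow> ev (Tw n q w) = Tb w"
  unfolding Tw_def using ev_Tword redword reduced_redword by metis

lemma Tw_genB: "w \<in> WB n \<Longrightarrow> Tw n q w \<in> genB n q"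
  unfolding Tw_def using Tword_genB redword by blast

lemma Lword_Tword: "f \<in> HB n \<Longrightarrow> set ws \<subseteq> {..<n} \<Longrightarrow> app (Tword n q ws) f = Lword n q ws f"
proof (induction ws)
  case (Cons i ws)
  then have "app (Tword n q ws) f \<in> HB n" using genB_HB[OF Tword_genB] by (metis insert_subset list.set(2))
  then show ?case using Cons by (simp add: Tword_def Lword_def app_lgen_HB)
qed (simp add: Tword_def Lword_def)

definition lift :: "nat \<Rightarrow> 'k::comm_ring_1 \<Rightarrow> 'k hecke \<Rightarrow> 'k lop" where
  "lift n q a = (\<Sum>w\<in>WB n. lsc (a w) * Tw n q w)"

lemma lift_genB: "lift n q a \<in> genB n q"
  unfolding lift_def by (intro genB_sum genB_mult genB_sc Tw_genB)

lemma ev_sum_Tw: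
  assumes "A \<subseteq> WB n"
  shows "ev (\<Sum>w\<in>A. lsc (a w) * Tw n q w) = (\<lambda>y. if y \<in> A then a y else 0)"
proof
  fix y
  have fin: "finite A" using finite_WB assms finite_subset by blast
  have "ev (\<Sum>w\<in>A. lsc (a w) * Tw n q w) y = (\<Sum>w\<in>A. if w = y then a y else 0)"
    unfolding ev_def app_sum
  proof (rule sum.cong)
    fix w assume "w \<in> A"
    then have "app (Tw n q w) hone = Tb w" using ev_Tw[of w n q] assms by (auto simp: ev_def)
    then show "app (lsc (a w) * Tw n q w) hone y = (if w = y then a y else 0)" by (simp add: hsmult_def Tb_def)
  qed simp
  then show "ev (\<Sum>w\<in>A. lsc (a w) * Tw n q w) y = (if y \<in> A then a y else 0)" using fin by simp
qed

lemma ev_lift: "a \<in> HB n \<Longrightarrow> ev (lift n q a) = a"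
  unfolding lift_def ev_sum_Tw[OF subset_refl] by (rule ext) (auto simp: HB_def)

lemma hmul_lift:
  assumes "b \<in> HB n" shows "hmul n q a b = app (lift n q a) b"
proof
  fix y
  show "hmul n q a b y = app (lift n q a) b y" unfolding hmul_def lift_def app_sum
    by (rule sum.cong) (use redword in \<open>auto simp: Tw_def Lword_Tword[OF assms] hsmult_def\<close>)
qed

lemma ev_HB: "X \<in> genB n q \<Longrightarrow> ev X \<in> HB n"
  unfolding ev_def by (rule genB_HB[OF _ HB_hone])

text \<open>The operator that \<open>hmul\<close> builds from reduced words and the given X both
  commute with right multiplications and agree at \<open>hone\<close>, so they agree on
  \<open>HB n\<close>. This turns composition of operators into \<open>hmul\<close>.\<close>

lemma hmul_ev:
  assumes "X \<in> genB n q" "b \<in> HB n" shows "hmul n q (ev X) b = app X b"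
  unfolding hmul_lift[OF assms(2)]
  by (rule Rcom_ext[OF _ _ _ assms(2)])
    (use assms in \<open>auto intro!: genB_Rcom lift_genB simp: ev_def[symmetric] ev_lift ev_HB\<close>)

lemma ev_mult: "X \<in> genB n q \<Longrightarrow> Y \<in> genB n q \<Longrightarrow> hmul n q (ev X) (ev Y) = ev (X * Y)"
  by (simp add: hmul_ev ev_HB) (simp add: ev_def)

lemma ev_1: "hone = ev 1"
  by (simp add: ev_def)

lemma ev_add: "hadd (ev X) (ev Y) = ev (X + Y)"
  by (rule ext) (simp add: ev_def hadd_def)

lemma ev_lsc_mult: "hsmult c (ev X) = ev (lsc c * X)"
  by (rule ext) (simp add: ev_def hsmult_def)

lemma ev_prod_list: "(\<And>X. X \<in> set Xs \<Longrightarrow> X \<in> genB n q) \<Longrightarrow> hprod n q (map ev Xs) = ev (prod_list Xs)"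
proof (induction Xs)
  case (Cons X Xs)
  then have "hprod n q (map ev (X # Xs)) = hmul n q (ev X) (ev (prod_list Xs))" by (simp add: hprod_def)
  also have "\<dots> = ev (prod_list (X # Xs))" using Cons.prems by (simp add: ev_mult genB_prod_list)
  finally show ?case .
qed (simp add: hprod_def ev_1)

lemma ev_lgen: "i < n \<Longrightarrow> Tb (sgen i) = ev (lgen n q i)"
proof -
  have "reduced [i]" unfolding reduced.simps ldes_word_prod by (simp add: not_less less_imp_le)
  then show "i < n \<Longrightarrow> Tb (sgen i) = ev (lgen n q i)" using ev_Tword[of "[i]" n q] by (simp add: Tword_def)
qed

lemma ev_mult_lgen:
  assumes "X \<in> genB n q" "j < n" shows "ev (X * lgen n q j) = Rgen n q j (ev X)"
proof -
  have "Rgen n q j hone = Tb (sgen j)"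
    using Rgen_Tb[of j n id q] assms(2) by (simp add: hone_def rdes_def not_less less_imp_le)
  then have "ev (X * lgen n q j) = app X (Rgen n q j hone)" using ev_lgen[OF assms(2), of q] by (simp add: ev_def)
  also have "\<dots> = Rgen n q j (ev X)" using genB_Rcom[OF assms(1)] HB_hone assms(2) by (auto simp: Rcom_def ev_def)
  finally show ?thesis .
qed

lemma app_Tword_restrict:
  "set ws \<subseteq> {..<n} \<Longrightarrow> app (Tword n q ws) f y =
    (if y \<in> WB n then app (Tword n q ws) (\<lambda>y. if y \<in> WB n then f y else 0) y else prod_list (map (qpar q) ws) * f y)"
proof (induction ws arbitrary: y)
  case (Cons i ws)
  let ?g = "\<lambda>y. if y \<in> WB n then f y else 0"
  have eq: "app (Tword n q ws) f z = app (Tword n q ws) ?g z" if "z \<in> WB n" for z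
    using Cons that by simp
  have out: "app (Tword n q ws) f z = prod_list (map (qpar q) ws) * f z" if "z \<notin> WB n" for z
    using Cons that by simp
  have T: "app (Tword n q (i # ws)) h = app (lgen n q i) (app (Tword n q ws) h)" for h by (simp add: Tword_def)
  have i: "i < n" using Cons.prems by simp
  show ?case unfolding T app_lgen Lgen_def using i by (simp add: eq out mult.assoc)
qed (simp add: Tword_def)

text \<open>On functions supported on the group, both words agree by \<open>Rcom_ext\<close>.
  Elsewhere they act as the product of their parameters, hence the last hypothesis.\<close>

lemma Tword_eqI:
  assumes "set ws \<subseteq> {..<n}" "set vs \<subseteq> {..<n}" "reduced ws" "reduced vs" "word_prod ws = word_prod vs"
    "prod_list (map (qpar q) ws) = prod_list (map (qpar (q::'a::comm_ring_1)) vs)"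
  shows "Tword n q ws = Tword n q vs"
proof (rule lop_eqI)
  fix f :: "'a hecke" and y
  let ?g = "\<lambda>y. if y \<in> WB n then f y else 0"
  have "app (Tword n q ws) ?g = app (Tword n q vs) ?g"
  proof (rule Rcom_ext[of _ n q])
    show "app (Tword n q ws) hone = app (Tword n q vs) hone"
      using assms by (simp flip: ev_def add: ev_Tword)
    show "?g \<in> HB n" by (auto simp: HB_def)
  qed (use assms in \<open>auto intro!: genB_Rcom Tword_genB\<close>)
  then show "app (Tword n q ws) f y = app (Tword n q vs) f y"
    using app_Tword_restrict[OF assms(1), of q f y] app_Tword_restrict[OF assms(2), of q f y] assms(6) by simp
qed

section \<open>The Hecke relations for the operators\<close>

lemma lgen_quad:
  assumes "i < n" shows "lgen n q i * lgen n q i = lsc (qpar q i - 1) * lgen n q i + lsc (qpar q i)"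
proof (rule lop_eqI)
  fix f y
  show "app (lgen n q i * lgen n q i) f y = app (lsc (qpar q i - 1) * lgen n q i + lsc (qpar q i)) f y"
    using assms ldes_sgen_comp[OF assms, of y] by (auto simp: app_lgen Lgen_ldes hsmult_def algebra_simps)
qed

lemma sgen_far: "i + 2 \<le> j \<Longrightarrow> sgen i \<circ> sgen j = sgen j \<circ> sgen i"
  by (rule sgen_conj[of _ "Suc j"], simp, auto simp: sgen_def lo_def hi_def)

lemma sgen_braid: "1 \<le> i \<Longrightarrow> sgen (Suc i) \<circ> (sgen i \<circ> sgen (Suc i)) = sgen i \<circ> (sgen (Suc i) \<circ> sgen i)"
proof -
  assume i: "1 \<le> i"
  have "sgen (Suc i) \<circ> (sgen i \<circ> sgen (Suc i)) = sgen i \<circ> sgen (Suc i) \<circ> sgen i"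
    by (rule sgen_conj[of _ "Suc (Suc i)"], simp, use i in \<open>simp add: sgen_def lo_def hi_def\<close>)
  then show ?thesis by (simp add: comp_assoc)
qed

lemma sgen_braid0: "sgen 0 \<circ> (sgen 1 \<circ> (sgen 0 \<circ> sgen 1)) = sgen 1 \<circ> (sgen 0 \<circ> (sgen 1 \<circ> sgen 0))"
proof -
  have "sgen 0 \<circ> (sgen 1 \<circ> (sgen 0 \<circ> sgen 1)) = sgen 1 \<circ> (sgen 0 \<circ> sgen 1) \<circ> sgen 0"
    by (rule sgen_conj[of _ 2], simp, simp add: sgen_def lo_def hi_def)
  then show ?thesis by (simp add: comp_assoc)
qed

lemma lgen_far: "i + 2 \<le> j \<Longrightarrow> j < n \<Longrightarrow> lgen n q i * lgen n q j = lgen n q j * lgen n q i"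
proof -
  assume ij: "i + 2 \<le> j" "j < n"
  have r: "reduced [i, j]" "reduced [j, i]"
    unfolding reduced.simps ldes_word_prod using ij by (simp_all add: sgen_def lo_def hi_def)
  have "Tword n q [i, j] = Tword n q [j, i]"
    by (rule Tword_eqI[OF _ _ r]) (use ij sgen_far[OF ij(1)] in \<open>simp_all add: qpar_def mult.commute\<close>)
  then show ?thesis by (simp add: Tword_def)
qed

lemma lgen_braid: "1 \<le> i \<Longrightarrow> Suc i < n \<Longrightarrow>
  lgen n q i * lgen n q (Suc i) * lgen n q i = lgen n q (Suc i) * lgen n q i * lgen n q (Suc i)"
proof -
  assume ij: "1 \<le> i" "Suc i < n"
  have r: "reduced [i, Suc i, i]" "reduced [Suc i, i, Suc i]"
    unfolding reduced.simps ldes_word_prod using ij by (simp_all add: sgen_def lo_def hi_def)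
  have "Tword n q [i, Suc i, i] = Tword n q [Suc i, i, Suc i]"
    by (rule Tword_eqI[OF _ _ r]) (use ij sgen_braid[OF ij(1)] in \<open>simp_all add: qpar_def mult.commute\<close>)
  then show ?thesis by (simp add: Tword_def mult.assoc)
qed

lemma lgen_braid0: "1 < n \<Longrightarrow>
  lgen n q 0 * lgen n q 1 * lgen n q 0 * lgen n q 1 = lgen n q 1 * lgen n q 0 * lgen n q 1 * lgen n q 0"
proof -
  assume n: "1 < n"
  have r: "reduced [0, 1, 0, 1]" "reduced [1, 0, 1, 0]"
    unfolding reduced.simps ldes_word_prod using n by (simp_all add: sgen_def lo_def hi_def)
  have "Tword n q [0, 1, 0, 1] = Tword n q [1, 0, 1, 0]"
    by (rule Tword_eqI[OF _ _ r]) (use n sgen_braid0 in \<open>simp_all add: qpar_def mult.commute\<close>)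
  then show ?thesis by (simp add: Tword_def mult.assoc)
qed

lemma uinv: "(v :: 'k::comm_ring_1) dvd 1 \<Longrightarrow> v * uinv v = 1"
proof -
  assume "v dvd 1"
  then obtain u where u: "1 = v * u" by (rule dvdE)
  have "\<exists>!u. v * u = 1"
  proof (rule ex1I[of _ u])
    fix x assume "v * x = 1"
    have "x = x * (v * u)" using u by simp
    also have "\<dots> = (v * x) * u" by (simp add: ac_simps)
    finally show "x = u" using \<open>v * x = 1\<close> by simp
  qed (use u in simp)
  then show ?thesis unfolding uinv_def by (rule theI')
qed

locale hecke_model =
  fixes n :: nat and v :: "'k::comm_ring_1"
  assumes v_unit: "v dvd 1"

sublocale hecke_model \<subseteq> heckeB lsc "lgen n (v\<^sup>2)" n v "uinv v"
proof
  fix i assume i: "1 \<le> i" "i < n"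
  show "lgen n (v\<^sup>2) i * lgen n (v\<^sup>2) i = lsc (v\<^sup>2 - 1) * lgen n (v\<^sup>2) i + lsc (v\<^sup>2)"
    using lgen_quad[OF i(2), of "v\<^sup>2"] i by (simp add: qpar_def)
qed (use v_unit lsc_hom uinv lgen_far lgen_braid lgen_braid0 in auto)

section \<open>The anti-automorphism and the filtration by the number of negative entries\<close>

context hecke_model begin

abbreviation "TT \<equiv> lgen n (v\<^sup>2)"
abbreviation "gB \<equiv> genB n (v\<^sup>2)"

lemma subA_genB: "X \<in> subA \<Longrightarrow> X \<in> gB"
  by (induction rule: subA.induct) (auto intro: genB.intros)

lemma genB_mult_subA: "X \<in> gB \<Longrightarrow> Z \<in> subA \<Longrightarrow> X * Z \<in> gB"
  using genB_mult subA_genB by blast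

lemma gB_HB: "X \<in> gB \<Longrightarrow> f \<in> HB n \<Longrightarrow> app X f \<in> HB n" "X \<in> gB \<Longrightarrow> ev X \<in> HB n"
  by (rule genB_HB, assumption+, rule ev_HB)

lemma HA_HB: "f \<in> HA n \<Longrightarrow> f \<in> HB n"
  using WA_WB by (auto simp: HA_def HB_def)

lemma HA_Lgen:
  assumes "1 \<le> i" "i < n" "f \<in> HA n" shows "Lgen n (v\<^sup>2) i f \<in> HA n"
proof -
  have "f y = 0 \<and> f (sgen i \<circ> y) = 0" if "y \<notin> WA n" for y
    using assms that WA_sgen_comp[of i n y] unfolding HA_def by blast
  then have "Lgen n (v\<^sup>2) i f y = 0" if "y \<notin> WA n" for y using that by (simp add: Lgen_def)
  then show ?thesis unfolding HA_def by blast
qed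

lemma HA_hadd: "f \<in> HA n \<Longrightarrow> g \<in> HA n \<Longrightarrow> hadd f g \<in> HA n"
  by (auto simp: HA_def hadd_def) (metis add.right_neutral)

lemma HA_hsmult: "f \<in> HA n \<Longrightarrow> hsmult a f \<in> HA n"
  by (auto simp: HA_def hsmult_def) (metis mult_zero_right)

lemma subA_HA: "X \<in> subA \<Longrightarrow> f \<in> HA n \<Longrightarrow> app X f \<in> HA n"
  by (induction arbitrary: f rule: subA.induct)
    (auto simp: app_lgen_HB HA_HB HA_Lgen app_hadd_op HA_hadd HA_hsmult)

lemma ev_HA: "X \<in> subA \<Longrightarrow> ev X \<in> HA n"
  unfolding ev_def by (rule subA_HA) (auto simp: HA_def hone_def Tb_def split: if_splits)

lemma Tw_subA: "w \<in> WA n \<Longrightarrow> Tw n (v\<^sup>2) w \<in> subA"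
  using redword_WA unfolding Tw_def Tword_def by (fastforce intro!: subA_prod_list subA_T)

lemma HA_ev_ex:
  assumes "a \<in> HA n" shows "\<exists>X \<in> subA. ev X = a"
proof
  show "ev (\<Sum>w\<in>WA n. lsc (a w) * Tw n (v\<^sup>2) w) = a"
    unfolding ev_sum_Tw[OF WA_subset_WB] using assms by (intro ext) (auto simp: HA_def)
  show "(\<Sum>w\<in>WA n. lsc (a w) * Tw n (v\<^sup>2) w) \<in> subA"
    by (intro subA_sum subA_mult subA_sc Tw_subA)
qed

definition star :: "'k hecke \<Rightarrow> 'k hecke" where "star f = (\<lambda>y. if y \<in> WB n then f (inv y) else 0)"

lemma star_Lgen: "i < n \<Longrightarrow> star (Lgen n (v\<^sup>2) i f) = Rgen n (v\<^sup>2) i (star f)"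
proof
  fix y assume i: "i < n"
  show "star (Lgen n (v\<^sup>2) i f) y = Rgen n (v\<^sup>2) i (star f) y"
  proof (cases "y \<in> WB n")
    case True
    have "ldes (inv y) i \<longleftrightarrow> rdes y i" using True by (simp add: ldes_def)
    then show ?thesis using True i by (simp add: star_def Lgen_ldes Rgen_def WB_inv_comp_sgen)
  qed (simp add: star_def Rgen_def)
qed

lemma star_HB: "star f \<in> HB n"
  by (auto simp: star_def HB_def)

lemma star_star: "f \<in> HB n \<Longrightarrow> star (star f) = f"
  by (rule ext) (auto simp: star_def HB_def)

lemma star_hadd: "star (hadd f g) = hadd (star f) (star g)"
  by (auto simp: star_def hadd_def)

lemma star_hsmult: "star (hsmult a f) = hsmult a (star f)"
  by (auto simp: star_def hsmult_def)

lemma star_Tb: "w \<in> WB n \<Longrightarrow> star (Tb w) = Tb (inv w)"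
proof
  fix y assume w: "w \<in> WB n"
  have "y \<in> WB n \<Longrightarrow> inv y = w \<longleftrightarrow> y = inv w" using w by (metis WB_inv_inv)
  then show "star (Tb w) y = Tb (inv w) y" using w by (auto simp: star_def Tb_def)
qed

lemma star_hone: "star hone = hone"
  by (simp add: hone_def star_Tb)

lemma star_ev_T: "i < n \<Longrightarrow> star (ev (TT i)) = ev (TT i)"
  by (simp add: ev_lgen[symmetric] star_Tb)

lemma star_HA: "f \<in> HA n \<Longrightarrow> star f \<in> HA n"
  unfolding HA_def star_def by (auto split: if_splits) (metis WA_inv WB_inv_inv)

text \<open>Inverting group elements exchanges left and right multiplication, which settles the
  generators. An arbitrary f is needed for the product case, where X is applied to the result of
  Y.\<close>

lemma star_app: "X \<in> gB \<Longrightarrow> f \<in> HB n \<Longrightarrow> star (app X f) = hmul n (v\<^sup>2) (star f) (star (ev X))"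
proof (induction arbitrary: f rule: genB.induct)
  case (genB_sc a)
  have "hmul n (v\<^sup>2) (star f) (hsmult a hone) = hsmult a (app (lift n (v\<^sup>2) (star f)) hone)"
    by (simp add: hmul_lift HB_hsmult HB_hone app_hsmult)
  also have "app (lift n (v\<^sup>2) (star f)) hone = star f" using ev_lift[OF star_HB] by (simp add: ev_def)
  finally show ?case by (simp add: ev_def star_hsmult star_hone)
next
  case (genB_T i)
  have "star (app (TT i) f) = Rgen n (v\<^sup>2) i (star f)" using genB_T by (simp add: app_lgen_HB star_Lgen)
  also have "\<dots> = ev (lift n (v\<^sup>2) (star f) * TT i)"
    using ev_mult_lgen[OF lift_genB genB_T(1), of "v\<^sup>2" "star f"] by (simp add: ev_lift star_HB)
  also have "\<dots> = hmul n (v\<^sup>2) (star f) (ev (TT i))"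
    using ev_mult[OF lift_genB genB.genB_T[OF genB_T(1)], of "v\<^sup>2" "star f"] by (simp add: ev_lift star_HB)
  finally show ?case by (simp add: star_ev_T genB_T)
next
  case (genB_add X Y)
  then show ?case
    by (simp add: app_hadd_op star_hadd ev_add[symmetric] hmul_lift star_HB HB_hadd app_hadd)
next
  case (genB_mult X Y)
  let ?l = "lift n (v\<^sup>2)"
  have "star (app (X * Y) f) = hmul n (v\<^sup>2) (hmul n (v\<^sup>2) (star f) (star (ev Y))) (star (ev X))"
    using genB_mult by (simp add: genB_HB)
  also have "\<dots> = app (?l (hmul n (v\<^sup>2) (star f) (star (ev Y)))) (star (ev X))" by (rule hmul_lift[OF star_HB])
  \<comment> \<open>Associativity of \<open>hmul\<close>: both operators commute with right
    multiplications and have the same value at \<open>hone\<close>.\<close>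
  also have "\<dots> = app (?l (star f) * ?l (star (ev Y))) (star (ev X))"
  proof (rule Rcom_ext[of _ n "v\<^sup>2"])
    have "ev (?l (star f) * ?l (star (ev Y))) = hmul n (v\<^sup>2) (star f) (star (ev Y))"
      using ev_mult[OF lift_genB lift_genB, of n "v\<^sup>2" "star f" "star (ev Y)"] by (simp add: ev_lift star_HB)
    moreover from this have "hmul n (v\<^sup>2) (star f) (star (ev Y)) \<in> HB n"
      using ev_HB[OF genB.genB_mult[OF lift_genB lift_genB]] by metis
    ultimately show "app (?l (hmul n (v\<^sup>2) (star f) (star (ev Y)))) hone = app (?l (star f) * ?l (star (ev Y))) hone"
      using ev_lift by (simp add: ev_def)
  qed (auto intro!: genB_Rcom lift_genB genB.genB_mult star_HB)
  also have "\<dots> = hmul n (v\<^sup>2) (star f) (hmul n (v\<^sup>2) (star (ev Y)) (star (ev X)))"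
    by (simp add: hmul_lift star_HB gB_HB(1)[OF lift_genB])
  also have "hmul n (v\<^sup>2) (star (ev Y)) (star (ev X)) = star (app X (ev Y))"
    using genB_mult by (simp add: gB_HB)
  finally show ?case by (simp add: ev_def)
qed

text \<open>\<open>star\<close> acts on elements, whereas products are computed with operators. This
  relation records an operator together with one representing its image, so that images of products
  can be assembled factor by factor.\<close>

definition St :: "'k lop \<Rightarrow> 'k lop \<Rightarrow> bool" where "St X Y \<longleftrightarrow> X \<in> gB \<and> Y \<in> gB \<and> star (ev X) = ev Y"

lemma St_mult: "St X X' \<Longrightarrow> St Y Y' \<Longrightarrow> St (X * Y) (Y' * X')"
proof -
  assume s: "St X X'" "St Y Y'"
  have "star (ev (X * Y)) = star (app X (ev Y))" by (simp add: ev_def)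
  also have "\<dots> = hmul n (v\<^sup>2) (ev Y') (ev X')" using s by (simp add: St_def star_app gB_HB)
  also have "\<dots> = ev (Y' * X')" using s by (simp add: St_def ev_mult)
  finally show ?thesis using s by (auto simp: St_def intro: genB_mult)
qed

lemma St_add: "St X X' \<Longrightarrow> St Y Y' \<Longrightarrow> St (X + Y) (X' + Y')"
  by (auto simp: St_def ev_add[symmetric] star_hadd intro: genB_add)

lemma St_sc: "St (lsc a) (lsc a)"
  by (simp add: St_def genB_sc ev_def star_hsmult star_hone)

lemma St_1: "St 1 1" and St_0: "St 0 0"
  using St_sc[of 1] St_sc[of 0] by (simp_all add: sc_1)

lemma St_T: "i < n \<Longrightarrow> St (TT i) (TT i)"
  by (simp add: St_def genB_T star_ev_T)

lemma St_I: "i < n \<Longrightarrow> St (I i) (I i)"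
  using St_mult[OF St_sc St_T, of i "uinv v"] by (simp add: I_def sc_central)

lemma St_Iv: "i < n \<Longrightarrow> St (Iv i) (Iv i)"
  using St_add[OF St_I St_sc[of "- (v - uinv v)"], of i] unfolding Iv_def sc_minus by simp

lemma St_prod_list: "list_all2 St Xs Ys \<Longrightarrow> St (prod_list Xs) (prod_list (rev Ys))"
  by (induction rule: list_all2_induct) (auto intro: St_1 St_mult)

lemma St_prod_list_map: "(\<And>x. x \<in> set xs \<Longrightarrow> St (F x) (G x)) \<Longrightarrow> St (prod_list (map F xs)) (prod_list (map G (rev xs)))"
  using St_prod_list[of "map F xs" "map G xs"] by (simp add: list_all2_conv_all_nth rev_map)

lemma St_sum: "(\<And>x. x \<in> A \<Longrightarrow> St (F x) (G x)) \<Longrightarrow> St (sum F A) (sum G A)"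
  by (induction A rule: infinite_finite_induct) (auto intro: St_0 St_add)

lemma anti_auto_star: "anti_auto n (v\<^sup>2) star"
proof -
  have "bij_betw star (HA n) (HA n)"
    by (rule bij_betw_byWitness[where f' = star]) (auto simp: star_star HA_HB star_HA)
  moreover have "star (hmul n (v\<^sup>2) a b) = hmul n (v\<^sup>2) (star b) (star a)" if "a \<in> HA n" "b \<in> HA n" for a b
    using star_app[OF lift_genB[of n "v\<^sup>2" a], of b] that by (simp add: hmul_lift HA_HB ev_lift)
  ultimately show ?thesis by (simp add: anti_auto_def star_hone star_hadd star_hsmult)
qed

text \<open>Any anti-automorphism fixing the generators agrees with \<open>star\<close> on what they
  generate, which identifies the definite description.\<close>

lemma hstar_ev: assumes X: "X \<in> subA" shows "hstar n (v\<^sup>2) (ev X) = star (ev X)"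
proof -
  have "\<phi> (ev X) = star (ev X)" if "anti_auto n (v\<^sup>2) \<phi>" "\<forall>i \<in> {1..<n}. \<phi> (Tb (sgen i)) = Tb (sgen i)" for \<phi>
    using X
  proof (induction rule: subA.induct)
    case (subA_sc a)
    have "ev (lsc a) = hsmult a hone" by (simp add: ev_def)
    moreover have "(hone :: 'k hecke) \<in> HA n" unfolding ev_1 by (rule ev_HA[OF subA_1])
    ultimately show ?case using that(1) by (simp add: anti_auto_def star_hsmult star_hone)
  next
    case (subA_T i)
    then show ?case using that(2) star_ev_T[of i] by (simp add: ev_lgen[of i n "v\<^sup>2", symmetric])
  next
    case (subA_add x y)
    then show ?case using that(1) by (simp add: anti_auto_def ev_add[symmetric] star_hadd ev_HA)
  next
    case (subA_mult x y)
    have "ev (x * y) = hmul n (v\<^sup>2) (ev x) (ev y)" using subA_mult by (simp add: ev_mult subA_genB)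
    then show ?case using that(1) anti_auto_star subA_mult by (simp add: anti_auto_def ev_HA)
  qed
  moreover have "\<forall>i \<in> {1..<n}. star (Tb (sgen i)) = Tb (sgen i)" by (auto simp: star_Tb)
  ultimately show ?thesis unfolding hstar_def using anti_auto_star by (intro the_equality) blast+
qed

section \<open>The filtration by negative entries and the leading term of u_b\<close>

definition Fil :: "nat \<Rightarrow> 'k hecke set" where "Fil k = {f. \<forall>y. f y \<noteq> 0 \<longrightarrow> y \<in> WB n \<and> negs n y < k}"

lemma Fil_hadd: "f \<in> Fil k \<Longrightarrow> g \<in> Fil k \<Longrightarrow> hadd f g \<in> Fil k"
  unfolding Fil_def hadd_def by clarsimp (metis add.right_neutral)

lemma Fil_hsmult: "f \<in> Fil k \<Longrightarrow> hsmult a f \<in> Fil k"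
  unfolding Fil_def hsmult_def by clarsimp (metis mult_zero_right)

lemma Fil_mono: "f \<in> Fil k \<Longrightarrow> k \<le> l \<Longrightarrow> f \<in> Fil l"
  by (fastforce simp: Fil_def)

lemma Fil_HB: "f \<in> Fil k \<Longrightarrow> f \<in> HB n"
  by (auto simp: Fil_def HB_def)

lemma Fil_Lgen:
  assumes "1 \<le> i" "i < n" "f \<in> Fil k" shows "Lgen n (v\<^sup>2) i f \<in> Fil k"
  unfolding Fil_def
proof (intro CollectI allI impI)
  fix y assume y: "Lgen n (v\<^sup>2) i f y \<noteq> 0"
  then have yW: "y \<in> WB n" by (auto simp: Lgen_def split: if_splits)
  have "f y \<noteq> 0 \<or> f (sgen i \<circ> y) \<noteq> 0" using y by (auto simp: Lgen_def split: if_splits)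
  then have "negs n y < k \<or> negs n (sgen i \<circ> y) < k" using assms(3) unfolding Fil_def by blast
  then show "y \<in> WB n \<and> negs n y < k" using yW assms negs_sgen_comp[of i n y] by auto
qed

lemma Fil_Rgen:
  assumes "1 \<le> i" "i < n" "f \<in> Fil k" shows "Rgen n (v\<^sup>2) i f \<in> Fil k"
  unfolding Fil_def
proof (intro CollectI allI impI)
  fix y assume y: "Rgen n (v\<^sup>2) i f y \<noteq> 0"
  then have yW: "y \<in> WB n" by (auto simp: Rgen_def split: if_splits)
  have "f y \<noteq> 0 \<or> f (y \<circ> sgen i) \<noteq> 0" using y by (auto simp: Rgen_def split: if_splits)
  then have "negs n y < k \<or> negs n (y \<circ> sgen i) < k" using assms(3) unfolding Fil_def by blast
  then show "y \<in> WB n \<and> negs n y < k" using yW assms negs_comp_sgen[of i n y] by auto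
qed

text \<open>Right multiplication by s_0 changes the sign of one entry only, so the number of
  negative entries grows by at most one.\<close>

lemma Fil_Rgen_0:
  assumes "0 < n" "f \<in> Fil k" shows "Rgen n (v\<^sup>2) 0 f \<in> Fil (Suc k)"
  unfolding Fil_def
proof (intro CollectI allI impI)
  fix y assume y: "Rgen n (v\<^sup>2) 0 f y \<noteq> 0"
  then have yW: "y \<in> WB n" by (auto simp: Rgen_def split: if_splits)
  have "f y \<noteq> 0 \<or> f (y \<circ> sgen 0) \<noteq> 0" using y by (auto simp: Rgen_def split: if_splits)
  then have "negs n y < k \<or> negs n (y \<circ> sgen 0) < k" using assms(2) unfolding Fil_def by blast
  moreover have "negs n y \<le> Suc (negs n (y \<circ> sgen 0))"
  proof (cases "rdes y 0")
    case True
    then have "\<not> rdes (y \<circ> sgen 0) 0" using rdes_comp_sgen[OF assms(1) yW] by simp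
    then show ?thesis using negs_comp_sgen_0[OF assms(1), of "y \<circ> sgen 0"] yW assms(1) by simp
  next
    case False then show ?thesis using negs_comp_sgen_0[OF assms(1) yW] by simp
  qed
  ultimately show "y \<in> WB n \<and> negs n y < Suc k" using yW by auto
qed

lemma Fil_left: "X \<in> subA \<Longrightarrow> f \<in> Fil k \<Longrightarrow> app X f \<in> Fil k"
  by (induction arbitrary: f rule: subA.induct)
    (auto simp: app_lgen_HB Fil_HB Fil_Lgen app_hadd_op Fil_hadd Fil_hsmult)

lemma Fil_right: "Z \<in> subA \<Longrightarrow> X \<in> gB \<Longrightarrow> ev X \<in> Fil k \<Longrightarrow> ev (X * Z) \<in> Fil k"
proof (induction arbitrary: X rule: subA.induct)
  case (subA_sc a)
  have "ev (X * lsc a) = hsmult a (ev X)" by (simp add: ev_lsc_mult sc_central)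
  then show ?case using subA_sc by (simp add: Fil_hsmult)
next
  case (subA_T i)
  then show ?case by (simp add: ev_mult_lgen Fil_Rgen)
next
  case (subA_add x y)
  then show ?case by (simp add: distrib_left ev_add[symmetric] Fil_hadd)
next
  case (subA_mult x y)
  then have "ev (X * x * y) \<in> Fil k" by (intro subA_mult.IH genB_mult_subA)
  then show ?case by (simp add: mult.assoc)
qed

lemma Fil_T0: "0 < n \<Longrightarrow> X \<in> gB \<Longrightarrow> ev X \<in> Fil k \<Longrightarrow> ev (X * TT 0) \<in> Fil (Suc k)"
  by (simp add: ev_mult_lgen Fil_Rgen_0)

definition U :: "nat \<Rightarrow> 'k lop" where "U k = prod_list (map (\<lambda>i. lsc ((v\<^sup>2) ^ i) + t i) [0..<k])"

lemma t_genB: "i < n \<Longrightarrow> t i \<in> gB"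
  unfolding t_def by (intro genB_prod_list) (auto intro!: genB_T simp del: upt_Suc)

lemma U_genB: "k \<le> n \<Longrightarrow> U k \<in> gB"
  unfolding U_def by (intro genB_prod_list) (auto intro!: genB_add genB_sc t_genB)

lemma Dr_genB: "b \<le> n \<Longrightarrow> Dr b \<in> gB"
  by (induction b) (auto intro!: genB_1 genB_mult genB_prod_list genB_T simp del: upt_Suc)

lemma T_prod_split: "prod_list (map TT (rev [0..<Suc b])) = prod_list (map TT (rev [1..<Suc b])) * TT 0"
proof -
  have "[0..<Suc b] = 0 # [1..<Suc b]" using upt_conv_Cons[of 0 "Suc b"] by simp
  then show ?thesis by (simp del: upt_Suc)
qed

lemma prod_T_subA: "b < n \<Longrightarrow> prod_list (map TT (rev [1..<Suc b])) \<in> subA" "b < n \<Longrightarrow> prod_list (map TT [1..<Suc b]) \<in> subA"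
  by (auto intro!: subA_prod_list subA_T simp del: upt_Suc)

lemma Dr_Fil: "b \<le> n \<Longrightarrow> ev (Dr b) \<in> Fil (Suc b)"
proof (induction b)
  case 0
  have "negs n id = 0"
  proof -
    have "{a. 1 \<le> a \<and> a \<le> int n \<and> id a < 0} = {}" by auto
    then show ?thesis unfolding negs_def by (metis card.empty)
  qed
  then show ?case by (auto simp: Fil_def ev_def hone_def Tb_def)
next
  case (Suc b)
  have "ev (Dr b * prod_list (map TT (rev [1..<Suc b])) * TT 0) \<in> Fil (Suc (Suc b))"
    using Suc by (intro Fil_T0 Fil_right genB_mult subA_genB prod_T_subA Dr_genB) auto
  then show ?case unfolding Dr.simps T_prod_split by (simp add: mult.assoc)
qed

text \<open>The next factor is q^b + \<open>t b\<close>, and \<open>t b\<close> contains T_0 exactly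
  once, so it raises the filtration by at most one. It turns the leading term into the next one by
  \<open>Dr_Wr_t\<close>; the q^b part raises nothing and joins the remainder.\<close>

lemma U_top: "b \<le> n \<Longrightarrow> \<exists>R \<in> gB. U b = Dr b * Wr b + R \<and> ev R \<in> Fil b"
proof (induction b)
  case 0 show ?case by (rule bexI[of _ 0]) (auto simp: U_def Fil_def ev_def genB_0)
next
  case (Suc b)
  then obtain R where R: "R \<in> gB" "U b = Dr b * Wr b + R" "ev R \<in> Fil b" by auto
  have t: "t b = prod_list (map TT (rev [1..<Suc b])) * TT 0 * prod_list (map TT [1..<Suc b])"
    by (simp add: t_def mult.assoc del: upt_Suc)
  have R1: "ev (R * t b) \<in> Fil (Suc b)"
  proof -
    have "ev (R * prod_list (map TT (rev [1..<Suc b]))) \<in> Fil b" using Suc.prems R by (intro Fil_right prod_T_subA) auto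
    then have "ev (R * prod_list (map TT (rev [1..<Suc b])) * TT 0) \<in> Fil (Suc b)"
      using Suc.prems R by (intro Fil_T0 genB_mult_subA prod_T_subA) auto
    then show ?thesis unfolding t mult.assoc[symmetric]
      by (rule Fil_right[rotated 2])
        (use Suc.prems R in \<open>auto intro!: genB_mult genB_T subA_genB[OF prod_T_subA(1)] prod_T_subA simp del: upt_Suc One_nat_def\<close>)
  qed
  have "ev (Dr b * Wr b) \<in> Fil (Suc b)" using Suc.prems by (intro Fil_right Dr_Fil Dr_genB Wr_subA) auto
  then have "ev (U b) \<in> Fil (Suc b)" unfolding R(2) ev_add[symmetric] using R(3) by (intro Fil_hadd) (auto intro: Fil_mono)
  then have R2: "ev (U b * lsc ((v\<^sup>2) ^ b)) \<in> Fil (Suc b)" using Suc.prems by (intro Fil_right subA_sc U_genB) auto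
  have "U (Suc b) = U b * lsc ((v\<^sup>2) ^ b) + U b * t b" by (simp add: U_def distrib_left)
  also have "U b * t b = Dr (Suc b) * Wr (Suc b) + R * t b"
    using Dr_Wr_t[of b] Suc.prems unfolding R(2) distrib_right by simp
  finally have "U (Suc b) = Dr (Suc b) * Wr (Suc b) + (R * t b + U b * lsc ((v\<^sup>2) ^ b))" by (simp add: algebra_simps)
  moreover have "ev (R * t b + U b * lsc ((v\<^sup>2) ^ b)) \<in> Fil (Suc b)" using R1 R2 by (simp add: ev_add[symmetric] Fil_hadd)
  moreover have "R * t b + U b * lsc ((v\<^sup>2) ^ b) \<in> gB"
    using R Suc.prems by (intro genB_add genB_mult t_genB U_genB genB_sc) auto
  ultimately show ?case by blast
qed

end

section \<open>Distinguished coset representatives\<close>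

lemma word_prod_rev_upt_Suc: "a \<le> b \<Longrightarrow> word_prod (rev [a..<Suc b]) = word_prod (rev [Suc a..<Suc b]) \<circ> sgen a"
  using upt_conv_Cons[of a "Suc b"] by (simp del: upt_Suc)

lemma cycle_apply:
  assumes "1 \<le> a" "a \<le> Suc b" "p > 0"
  shows "word_prod (rev [a..<Suc b]) p = (if p = int a then int b + 1 else if int a < p \<and> p \<le> int b + 1 then p - 1 else p)"
  using assms
proof (induction "Suc b - a" arbitrary: a p)
  case 0 then show ?case by simp
next
  case (Suc k)
  have ab: "a \<le> b" using Suc.hyps by simp
  have IH: "word_prod (rev [Suc a..<Suc b]) p' = (if p' = int a + 1 then int b + 1 else if int a + 1 < p' \<and> p' \<le> int b + 1 then p' - 1 else p')" if "p' > 0" for p'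
    using Suc.hyps(1)[of "Suc a" p'] Suc.hyps(2) ab that by (simp add: add.commute del: upt_Suc)
  have pos: "sgen a p > 0" using sgen_pos[of a p] Suc.prems by simp
  have sg: "sgen a p = (if p = int a then int a + 1 else if p = int a + 1 then int a else p)"
    using Suc.prems by (simp add: sgen_def)
  show ?case unfolding word_prod_rev_upt_Suc[OF ab] comp_apply IH[OF pos]
    unfolding sg using ab by simp
qed

text \<open>The permutation d with T_d = \<open>Dr b\<close>: it sends 1, ..., b to -b, ..., -1 in
  increasing order and fixes b + 1 and above.\<close>

fun dperm :: "nat \<Rightarrow> int \<Rightarrow> int" where
  "dperm 0 = id"
| "dperm (Suc b) = dperm b \<circ> word_prod (rev [0..<Suc b])"

lemma dperm_WB: "b \<le> n \<Longrightarrow> dperm b \<in> WB n"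
  by (induction b) (auto intro!: WB_comp WB_I simp del: upt_Suc)

lemma dperm_apply: "p > 0 \<Longrightarrow> dperm b p = (if p \<le> int b then p - int b - 1 else p)"
proof (induction b arbitrary: p)
  case (Suc b)
  have c: "word_prod (rev [0..<Suc b]) p = (if p = 1 then - int b - 1 else if p \<le> int b + 1 then p - 1 else p)"
  proof (cases "p = 1")
    case True
    have W: "word_prod (rev [1..<Suc b]) \<in> WB (Suc b)" by (auto intro!: WB_I)
    have "word_prod (rev [0..<Suc b]) p = word_prod (rev [1..<Suc b]) (sgen 0 p)"
      using word_prod_rev_upt_Suc[of 0 b] by simp
    also have "sgen 0 p = - 1" using True by (simp add: sgen_def)
    also have "word_prod (rev [1..<Suc b]) (- 1) = - word_prod (rev [1..<Suc b]) 1" by (rule WB_minus[OF W])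
    also have "\<dots> = - int b - 1" using cycle_apply[of 1 b 1] by simp
    finally show ?thesis using True by simp
  next
    case False
    have "word_prod (rev [0..<Suc b]) p = word_prod (rev [1..<Suc b]) (sgen 0 p)"
      using word_prod_rev_upt_Suc[of 0 b] by simp
    also have "sgen 0 p = p" using False Suc.prems by (simp add: sgen_def)
    finally show ?thesis using cycle_apply[of 1 b p] Suc.prems False by simp
  qed
  have m: "dperm b (- int b - 1) = - int b - 1"
    using WB_minus[OF dperm_WB[OF order_refl[of b]], of "int b + 1"] Suc.IH[of "int b + 1"] by simp
  show ?case unfolding dperm.simps comp_apply c using Suc.prems m Suc.IH[of "p - 1"] Suc.IH[of p] by auto
qed simp

lemma negs_comp_WA: "z \<in> WA n \<Longrightarrow> negs n (w \<circ> z) = negs n w"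
proof -
  have "negs n (w \<circ> word_prod ws) = negs n w" if "set ws \<subseteq> {1..<n}" for ws
    using that
  proof (induction ws arbitrary: w)
    case Nil then show ?case by (simp add: comp_def)
  next
    case (Cons i ws)
    have "w \<circ> word_prod (i # ws) = (w \<circ> sgen i) \<circ> word_prod ws" by (simp add: comp_assoc)
    then show ?case using Cons.IH[of "w \<circ> sgen i"] Cons.prems negs_comp_sgen[of i n w] by (auto simp: comp_def)
  qed
  then show "z \<in> WA n \<Longrightarrow> negs n (w \<circ> z) = negs n w" unfolding WA_def by blast
qed

lemma negs_dperm:
  assumes "x \<in> WA n" "b \<le> n" shows "negs n (x \<circ> dperm b) = b"
proof -
  have "x (dperm b a) < 0 \<longleftrightarrow> a \<le> int b" if "1 \<le> a" for a
    using that WA_pos[OF assms(1), of "dperm b a"] WB_eq_0_iff[OF WA_WB[OF assms(1)], of "dperm b a"] dperm_apply[of a b] by (auto split: if_splits)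
  then have "{a. 1 \<le> a \<and> a \<le> int n \<and> (x \<circ> dperm b) a < 0} = {1..int b}" using assms(2) by auto
  then show ?thesis by (simp add: negs_def)
qed

lemma adjacent_imp_strict_mono:
  fixes g :: "int \<Rightarrow> int"
  assumes "\<And>i. 1 \<le> i \<Longrightarrow> i < n \<Longrightarrow> \<not> rdes g i" "g \<in> WB n" "1 \<le> p" "p < q" "q \<le> int n"
  shows "g p < g q"
proof -
  have "g p < g (p + int (Suc k))" if "p + int (Suc k) \<le> int n" for k
    using that
  proof (induction k)
    case 0
    then have "1 \<le> nat p" "nat p < n" using assms(3) by auto
    from assms(1)[OF this] show ?case using assms(3) WB_eq_iff[OF assms(2), of "p + 1" p] by (simp add: rdes_def lo_def hi_def)
  next
    case (Suc k)
    then have "g p < g (p + int (Suc k))" by auto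
    also have "g (p + int (Suc k)) < g (p + int (Suc (Suc k)))"
    proof -
      have "1 \<le> nat (p + int (Suc k))" "nat (p + int (Suc k)) < n" using assms(3) Suc.prems by auto
      moreover have "p + int (Suc (Suc k)) = p + int (Suc k) + 1" by simp
      ultimately show ?thesis
        using assms(1)[of "nat (p + int (Suc k))"] assms(3) WB_eq_iff[OF assms(2), of "p + int (Suc k) + 1" "p + int (Suc k)"]
        by (simp only: rdes_def lo_def hi_def) (auto simp: not_less order.strict_iff_order)
    qed
    finally show ?case .
  qed
  from this[of "nat (q - p - 1)"] show ?thesis using assms by auto
qed

text \<open>Among signed permutations these are the representatives of minimal length in the cosets
  g Sigma_n.\<close>

definition mono_pos :: "nat \<Rightarrow> (int \<Rightarrow> int) \<Rightarrow> bool" where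
  "mono_pos n g \<longleftrightarrow> (\<forall>p q. 1 \<le> p \<longrightarrow> p < q \<longrightarrow> q \<le> int n \<longrightarrow> g p < g q)"

definition Dset :: "nat \<Rightarrow> nat \<Rightarrow> (int \<Rightarrow> int) set" where
  "Dset n b = {x \<in> WA n. \<forall>i. 1 \<le> i \<longrightarrow> i < n \<longrightarrow> i \<noteq> b \<longrightarrow> \<not> rdes x i}"

lemma id_Dset: "id \<in> Dset n b"
  by (auto simp: Dset_def rdes_def lo_def hi_def)

text \<open>x increases on 1..b and on b+1..n. Since d moves the first block to -b, ..., -1, the
  values of x d there are negative and again increasing, and they are followed by the positive
  increasing values of the second block.\<close>

lemma Dset_mono:
  assumes "x \<in> Dset n b" "b \<le> n" shows "mono_pos n (x \<circ> dperm b)"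
proof -
  have x: "x \<in> WA n" "x \<in> WB n" and nd: "\<And>i. 1 \<le> i \<Longrightarrow> i < n \<Longrightarrow> i \<noteq> b \<Longrightarrow> \<not> rdes x i"
    using assms by (auto simp: Dset_def WA_WB)
  have "\<not> rdes (x \<circ> dperm b) i" if i: "1 \<le> i" "i < n" for i
  proof -
    have li: "lo i = int i" "hi i = int i + 1" using i by (auto simp: lo_def hi_def)
    have d: "dperm b (int i) = (if i \<le> b then int i - int b - 1 else int i)"
      "dperm b (int i + 1) = (if i < b then int i - int b else int i + 1)" using i by (auto simp: dperm_apply)
    consider "i < b" | "i = b" | "i > b" by linarith
    then show ?thesis
    proof cases
      case 1
      have "x (int i - int b - 1) = - x (int (b - i) + 1)" "x (int i - int b) = - x (int (b - i))"
        using WB_minus[OF x(2), of "int (b - i) + 1"] WB_minus[OF x(2), of "int (b - i)"] 1 by (auto simp: of_nat_diff algebra_simps)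
      moreover have "\<not> rdes x (b - i)" using nd[of "b - i"] 1 i assms(2) by auto
      ultimately show ?thesis using 1 by (simp add: rdes_def li d) (simp add: lo_def hi_def)
    next
      case 2
      have "x (- 1) < 0" using WA_pos[OF x(1), of 1] WB_minus[OF x(2), of 1] by simp
      moreover have "x (int b + 1) > 0" using WA_pos[OF x(1), of "int b + 1"] by simp
      ultimately show ?thesis unfolding rdes_def li d comp_apply using 2 by simp
    next
      case 3
      then show ?thesis using nd[of i] i by (simp add: rdes_def li d)
    qed
  qed
  then show ?thesis unfolding mono_pos_def
    using adjacent_imp_strict_mono[of n "x \<circ> dperm b"] WB_comp[OF x(2) dperm_WB[OF assms(2)]] by blast
qed

lemma WA_range: "z \<in> WA n \<Longrightarrow> 1 \<le> p \<Longrightarrow> p \<le> int n \<Longrightarrow> 1 \<le> z p \<and> z p \<le> int n"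
  using WA_pos[of z n p] WB_abs_le[OF WA_WB[of z n], of p] by auto

lemma mono_pos_WA_rdes:
  assumes "mono_pos n g" "z \<in> WA n" "1 \<le> i" "i < n"
  shows "rdes (g \<circ> z) i \<longleftrightarrow> rdes z i"
proof -
  have r: "1 \<le> z (int i) \<and> z (int i) \<le> int n" "1 \<le> z (int i + 1) \<and> z (int i + 1) \<le> int n"
    using WA_range[OF assms(2), of "int i"] WA_range[OF assms(2), of "int i + 1"] assms(3,4) by auto
  have ne: "z (int i) \<noteq> z (int i + 1)" using WB_eq_iff[OF WA_WB[OF assms(2)]] by auto
  have li: "lo i = int i" "hi i = int i + 1" using assms by (auto simp: lo_def hi_def)
  have "z (int i) < z (int i + 1) \<Longrightarrow> g (z (int i)) < g (z (int i + 1))"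
    "z (int i + 1) < z (int i) \<Longrightarrow> g (z (int i + 1)) < g (z (int i))"
    using assms(1) r unfolding mono_pos_def by blast+
  then show ?thesis using ne unfolding rdes_def li comp_apply by linarith
qed

lemma WA_not_rdes_0: "z \<in> WA n \<Longrightarrow> \<not> rdes z 0"
  using WA_pos[of z n 1] WA_pos[of z n "-1"] by (simp add: rdes_def lo_def hi_def)

lemma WA_no_rdes_imp_id:
  assumes "z \<in> WA n" "\<And>i. 1 \<le> i \<Longrightarrow> i < n \<Longrightarrow> \<not> rdes z i" shows "z = id"
proof (rule no_rdes_imp_id[OF WA_WB[OF assms(1)]])
  fix i assume "i < n"
  then show "\<not> rdes z i" using assms WA_not_rdes_0 by (cases "i = 0") auto
qed

text \<open>With y = z z'^(-1) one has g y = g'. An increasing g does not affect the descents of y,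
  and g' has none in 1..n-1, so y is the identity.\<close>

lemma mono_pos_cancel:
  assumes g: "mono_pos n g" "mono_pos n g'" and z: "z \<in> WA n" "z' \<in> WA n" and e: "g \<circ> z = g' \<circ> z'"
  shows "z = z'" "g = g'"
proof -
  let ?y = "z \<circ> inv z'"
  have y: "?y \<in> WA n" using z by (simp add: WA_comp)
  have zz: "z' \<circ> inv z' = id" "inv z' \<circ> z' = id" using WB_inv_app[OF WA_WB[OF z(2)]] by (auto simp: fun_eq_iff)
  have ge: "g \<circ> ?y = g'" using e zz(1) by (metis comp_assoc comp_id)
  have "\<not> rdes ?y i" if i: "1 \<le> i" "i < n" for i
  proof -
    have "\<not> rdes (g' \<circ> id) i" unfolding mono_pos_WA_rdes[OF g(2) WA_id i] by (simp add: rdes_def not_less less_imp_le)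
    then show ?thesis using mono_pos_WA_rdes[OF g(1) y i] ge by simp
  qed
  then have yid: "?y = id" using WA_no_rdes_imp_id[OF y] by blast
  then show "g = g'" using ge by simp
  have "z = ?y \<circ> z'" using zz(2) by (simp add: comp_assoc)
  then show "z = z'" using yid by simp
qed

lemma Dset_decomp_inj:
  assumes "x \<in> Dset n b" "x' \<in> Dset n b" "z \<in> WA n" "z' \<in> WA n" "b \<le> n"
    and e: "x \<circ> dperm b \<circ> z = x' \<circ> dperm b \<circ> z'"
  shows "x = x' \<and> z = z'"
proof -
  have "z = z'" "x \<circ> dperm b = x' \<circ> dperm b"
    using mono_pos_cancel[OF Dset_mono[OF assms(1,5)] Dset_mono[OF assms(2,5)] assms(3,4) e] by auto
  moreover have "x = x'" if "x \<circ> dperm b = x' \<circ> dperm b"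
  proof
    fix p
    show "x p = x' p" using fun_cong[OF that, of "inv (dperm b) p"] WB_inv_app(2)[OF dperm_WB[OF assms(5)]] by simp
  qed
  ultimately show ?thesis by blast
qed

section \<open>Products of basis elements with additive lengths\<close>

context hecke_model begin

lemma ev_mult_T: "X \<in> gB \<Longrightarrow> ev X = Tb w \<Longrightarrow> w \<in> WB n \<Longrightarrow> i < n \<Longrightarrow> \<not> rdes w i \<Longrightarrow> ev (X * TT i) = Tb (w \<circ> sgen i)"
  by (simp add: ev_mult_lgen Rgen_Tb)

text \<open>Multiplying by s_b, ..., s_a on the right moves the entry at position b + 1 leftwards to
  position a. Every entry it passes is smaller, so each step increases the length.\<close>

lemma ev_chain:
  assumes X: "X \<in> gB" "ev X = Tb w" "w \<in> WB n" and ab: "1 \<le> a" "a \<le> Suc b" "b < n"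
    and lt: "\<And>i. a \<le> i \<Longrightarrow> i \<le> b \<Longrightarrow> w (int i) < w (int b + 1)"
  shows "ev (X * prod_list (map TT (rev [a..<Suc b]))) = Tb (w \<circ> word_prod (rev [a..<Suc b]))"
  using ab lt
proof (induction "Suc b - a" arbitrary: a)
  case 0 then show ?case using X by (simp add: comp_def)
next
  case (Suc k)
  have ab: "a \<le> b" using Suc.hyps by simp
  let ?w = "w \<circ> word_prod (rev [Suc a..<Suc b])" and ?X = "X * prod_list (map TT (rev [Suc a..<Suc b]))"
  have IH: "ev ?X = Tb ?w" using Suc.hyps Suc.prems ab by (intro Suc.hyps(1)) auto
  have XB: "?X \<in> gB" using X Suc.prems by (auto intro!: genB_mult genB_prod_list genB_T simp del: upt_Suc)
  have wB: "?w \<in> WB n" using X Suc.prems by (auto intro!: WB_comp WB_I simp del: upt_Suc)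
  have "?w (int a) = w (int a)" "?w (int a + 1) = w (int b + 1)"
    using cycle_apply[of "Suc a" b "int a"] cycle_apply[of "Suc a" b "int a + 1"] ab Suc.prems by (simp_all del: upt_Suc)
  then have "\<not> rdes ?w a" using Suc.prems(4)[of a] Suc.prems(1) ab unfolding rdes_def by (simp add: lo_def hi_def del: upt_Suc comp_apply)
  then have "ev (?X * TT a) = Tb (?w \<circ> sgen a)" using ab Suc.prems XB IH wB by (intro ev_mult_T) auto
  moreover have "?X * TT a = X * prod_list (map TT (rev [a..<Suc b]))"
    using ab upt_conv_Cons[of a "Suc b"] by (simp add: mult.assoc del: upt_Suc)
  moreover have "?w \<circ> sgen a = w \<circ> word_prod (rev [a..<Suc b])"
    unfolding word_prod_rev_upt_Suc[OF ab] by (rule comp_assoc)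
  ultimately show ?case by simp
qed

text \<open>At each stage the first b entries are negative. The next entry, which is positive, moves
  to the front past them and is then negated by s_0, all with increasing length.\<close>

lemma ev_Dr:
  assumes X: "X \<in> gB" "ev X = Tb x" "x \<in> WA n" shows "b \<le> n \<Longrightarrow> ev (X * Dr b) = Tb (x \<circ> dperm b)"
proof (induction b)
  case 0 then show ?case using X by (simp add: comp_def)
next
  case (Suc b)
  let ?w = "x \<circ> dperm b" and ?c = "word_prod (rev [1..<Suc b])"
  have w: "?w \<in> WB n" using Suc.prems by (intro WB_comp WA_WB[OF X(3)] dperm_WB) auto
  have pos: "?w (int b + 1) > 0" using WA_pos[OF X(3)] by (simp add: dperm_apply)
  have neg: "?w (int i) < 0" if "1 \<le> i" "i \<le> b" for i
    using that WA_pos[OF X(3), of "dperm b (int i)"] WB_eq_0_iff[OF WA_WB[OF X(3)], of "dperm b (int i)"] by (auto simp: dperm_apply)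
  have 1: "ev (X * Dr b * prod_list (map TT (rev [1..<Suc b]))) = Tb (?w \<circ> ?c)"
  proof (rule ev_chain[OF _ _ w])
    show "ev (X * Dr b) = Tb ?w" using Suc by (simp add: comp_def)
    fix i assume "1 \<le> i" "i \<le> b"
    then show "?w (int i) < ?w (int b + 1)" using neg pos by fastforce
  qed (use Suc X w in \<open>auto intro!: genB_mult Dr_genB\<close>)
  have "(?w \<circ> ?c) 1 = ?w (int b + 1)" using cycle_apply[of 1 b 1] by (simp del: upt_Suc)
  moreover have wc: "?w \<circ> ?c \<in> WB n" using w Suc.prems by (intro WB_comp[OF w] WB_I) auto
  ultimately have "\<not> rdes (?w \<circ> ?c) 0" using pos WB_minus[OF wc, of 1] by (simp add: rdes_def lo_def hi_def del: upt_Suc comp_apply)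
  then have "ev (X * Dr b * prod_list (map TT (rev [1..<Suc b])) * TT 0) = Tb (?w \<circ> ?c \<circ> sgen 0)"
    using Suc.prems X 1 wc by (intro ev_mult_T genB_mult_subA genB_mult Dr_genB prod_T_subA) (auto simp del: upt_Suc)
  moreover have "X * Dr b * prod_list (map TT (rev [1..<Suc b])) * TT 0 = X * Dr (Suc b)"
    unfolding Dr.simps T_prod_split by (simp add: mult.assoc del: upt_Suc)
  moreover have "?w \<circ> ?c \<circ> sgen 0 = x \<circ> dperm (Suc b)"
    using word_prod_rev_upt_Suc[of 0 b] by (simp add: comp_assoc del: upt_Suc)
  ultimately have "ev (X * Dr (Suc b)) = Tb (x \<circ> dperm (Suc b))" by (simp only:)
  then show ?case .
qed

text \<open>For increasing g, the descents of g z and z in 1..n-1 coincide, so z can be built up by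
  right multiplications that increase both lengths.\<close>

lemma app_mono_pos:
  assumes Y: "Y \<in> gB" "ev Y = Tb g" "g \<in> WB n" "mono_pos n g"
  shows "z \<in> WA n \<Longrightarrow> app Y (Tb z) = Tb (g \<circ> z)"
proof (induction "blen n z" arbitrary: z rule: less_induct)
  case less
  show ?case
  proof (cases "z = id")
    case True then show ?thesis using Y by (simp add: ev_def hone_def)
  next
    case False
    then obtain i where i: "1 \<le> i" "i < n" "rdes z i" using WA_no_rdes_imp_id[OF less.prems] by blast
    let ?z = "z \<circ> sgen i"
    have z: "z \<in> WB n" "?z \<in> WA n" "?z \<in> WB n" using less.prems i by (auto simp: WA_WB)
    have nd: "\<not> rdes ?z i" using rdes_comp_sgen[OF i(2) z(1)] i(3) by simp
    have IH: "app Y (Tb ?z) = Tb (g \<circ> ?z)"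
      using less.hyps[OF _ z(2)] blen_comp_sgen_des[OF i(2) z(1) i(3)] by simp
    have "app Y (Tb z) = app Y (Rgen n (v\<^sup>2) i (Tb ?z))"
      using Rgen_Tb[OF i(2) z(3) nd, of "v\<^sup>2"] by simp
    also have "\<dots> = Rgen n (v\<^sup>2) i (app Y (Tb ?z))"
      using genB_Rcom[OF Y(1)] i(2) HB_Tb[OF z(3)] unfolding Rcom_def by blast
    also have "\<dots> = Tb (g \<circ> ?z \<circ> sgen i)" unfolding IH
      by (rule Rgen_Tb[OF i(2) WB_comp[OF Y(3) z(3)]]) (use mono_pos_WA_rdes[OF Y(4) z(2) i(1,2)] nd in simp)
    also have "g \<circ> ?z \<circ> sgen i = g \<circ> z" by (simp add: comp_assoc)
    finally show ?thesis .
  qed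
qed

end

section \<open>Linear independence\<close>

context hecke_model begin

text \<open>u_b divided on the right by the unit \<open>Wr b\<close>, so that the leading term is
  T_d itself.\<close>

definition Er :: "nat \<Rightarrow> 'k lop" where
  "Er b = U b * (SOME y. y \<in> subA \<and> Wr b * y = 1 \<and> y * Wr b = 1)"

lemma Er:
  assumes "b \<le> n"
  shows "U b = Er b * Wr b" "\<exists>R \<in> gB. Er b = Dr b + R \<and> ev R \<in> Fil b" "Er b \<in> gB"
proof -
  define y where "y = (SOME y. y \<in> subA \<and> Wr b * y = 1 \<and> y * Wr b = 1)"
  have "\<exists>y. y \<in> subA \<and> Wr b * y = 1 \<and> y * Wr b = 1" using Wr_unit[OF assms] by blast
  from someI_ex[OF this] have y: "y \<in> subA" "Wr b * y = 1" "y * Wr b = 1" unfolding y_def by auto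
  have E: "Er b = U b * y" by (simp add: Er_def y_def)
  show "U b = Er b * Wr b" unfolding E by (simp add: mult.assoc y)
  show "Er b \<in> gB" unfolding E using U_genB[OF assms] y(1) by (rule genB_mult_subA)
  obtain R where R: "R \<in> gB" "U b = Dr b * Wr b + R" "ev R \<in> Fil b" using U_top[OF assms] by blast
  have "Er b = Dr b + R * y" unfolding E R(2) distrib_right by (simp add: mult.assoc y)
  then show "\<exists>R \<in> gB. Er b = Dr b + R \<and> ev R \<in> Fil b"
    using R y by (intro bexI[of _ "R * y"]) (auto intro: genB_mult_subA Fil_right)
qed

definition Bel :: "nat \<Rightarrow> (int \<Rightarrow> int) \<Rightarrow> (int \<Rightarrow> int) \<Rightarrow> 'k hecke" where
  "Bel b x z = app (Tw n (v\<^sup>2) x * Er b) (Tb z)"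

text \<open>Lengths add in x d z because x d is increasing. The remainder of \<open>Er b\<close>
  stays in the filtration step, which type A multiplications preserve on either side.\<close>

lemma Bel_top:
  assumes "x \<in> Dset n b" "z \<in> WA n" "b \<le> n"
  shows "\<exists>g \<in> Fil b. Bel b x z = hadd (Tb (x \<circ> dperm b \<circ> z)) g"
proof -
  obtain R where R: "R \<in> gB" "Er b = Dr b + R" "ev R \<in> Fil b" using Er(2)[OF assms(3)] by blast
  have x: "x \<in> WA n" "x \<in> WB n" using assms(1) WA_WB by (auto simp: Dset_def)
  have z: "Tb z = ev (Tw n (v\<^sup>2) z)" using ev_Tw[OF WA_WB[OF assms(2)], of "v\<^sup>2"] by simp
  have D: "Tw n (v\<^sup>2) x * Dr b \<in> gB" using Tw_genB[OF x(2)] Dr_genB[OF assms(3)] by (rule genB_mult)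
  have "Bel b x z = hadd (app (Tw n (v\<^sup>2) x * Dr b) (Tb z)) (app (Tw n (v\<^sup>2) x) (ev (R * Tw n (v\<^sup>2) z)))"
    unfolding Bel_def R(2) distrib_left app_hadd_op z by (simp add: ev_def)
  moreover have "app (Tw n (v\<^sup>2) x * Dr b) (Tb z) = Tb (x \<circ> dperm b \<circ> z)"
    by (rule app_mono_pos[OF D ev_Dr[OF Tw_genB[OF x(2)] ev_Tw[OF x(2)] x(1) assms(3)] _ Dset_mono[OF assms(1,3)] assms(2)])
      (intro WB_comp x(2) dperm_WB assms(3))
  moreover have "app (Tw n (v\<^sup>2) x) (ev (R * Tw n (v\<^sup>2) z)) \<in> Fil b"
    by (intro Fil_left Fil_right Tw_subA x(1) assms(2) R)
  ultimately show ?thesis by auto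
qed

text \<open>Contains all of H u_b H, by \<open>U_Span\<close>.\<close>

definition Span :: "nat \<Rightarrow> 'k hecke set" where
  "Span b = {f. \<exists>a. f = (\<lambda>y. \<Sum>(x, z) \<in> Dset n b \<times> WA n. a x z * Bel b x z y)}"

lemma finite_Dset: "finite (Dset n b \<times> WA n)"
  using finite_WA finite_subset[of "Dset n b" "WA n"] by (auto simp: Dset_def)

lemma Bel_Fil:
  assumes "x \<in> Dset n b" "z \<in> WA n" "b \<le> n"
  shows "Bel b x z \<in> Fil (Suc b)"
proof -
  obtain g where g: "g \<in> Fil b" "Bel b x z = hadd (Tb (x \<circ> dperm b \<circ> z)) g" using Bel_top[OF assms] by blast
  have x: "x \<in> WA n" using assms(1) by (auto simp: Dset_def)
  have "x \<circ> dperm b \<circ> z \<in> WB n" by (intro WB_comp dperm_WB WA_WB x assms)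
  moreover have "negs n (x \<circ> dperm b \<circ> z) = b" using negs_comp_WA[OF assms(2)] negs_dperm[OF x assms(3)] by metis
  ultimately have "Tb (x \<circ> dperm b \<circ> z) \<in> Fil (Suc b)" by (auto simp: Fil_def Tb_def split: if_splits)
  then show ?thesis unfolding g(2) using g(1) by (intro Fil_hadd) (auto intro: Fil_mono)
qed

lemma Fil_zero: "(\<lambda>y. 0) \<in> Fil k"
  by (simp add: Fil_def)

lemma Fil_sum: "(\<And>x. x \<in> A \<Longrightarrow> F x \<in> Fil k) \<Longrightarrow> (\<lambda>y. \<Sum>x\<in>A. a x * F x y) \<in> Fil k"
proof (induction A rule: infinite_finite_induct)
  case (insert x A)
  have "(\<lambda>y. \<Sum>x\<in>insert x A. a x * F x y) = hadd (hsmult (a x) (F x)) (\<lambda>y. \<Sum>x\<in>A. a x * F x y)"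
    using insert by (auto simp: hadd_def hsmult_def)
  then show ?case using insert by (simp add: Fil_hadd Fil_hsmult)
qed (simp_all add: Fil_zero)

lemma Span_Fil: "f \<in> Span b \<Longrightarrow> b \<le> n \<Longrightarrow> f \<in> Fil (Suc b)"
  unfolding Span_def split_beta using Fil_sum[of "Dset n b \<times> WA n" "\<lambda>p. Bel b (fst p) (snd p)" "Suc b"] Bel_Fil[of _ b] by auto

text \<open>The coefficient at x0 d z0 of the combination is exactly \<open>a x0 z0\<close>: leading
  terms are distinct basis elements by \<open>Dset_decomp_inj\<close>, and the remainders have fewer
  than b negative entries. This is independence modulo lower filtration, valid over any K.\<close>

lemma Bel_indep:
  assumes b: "b \<le> n" and F: "(\<lambda>y. \<Sum>(x, z) \<in> Dset n b \<times> WA n. a x z * Bel b x z y) \<in> Fil b"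
    and x0: "x0 \<in> Dset n b" and z0: "z0 \<in> WA n"
  shows "a x0 z0 = 0"
proof -
  let ?y = "x0 \<circ> dperm b \<circ> z0"
  have neg: "negs n ?y = b" using negs_comp_WA[OF z0] negs_dperm[of x0 n b] x0 b by (metis (no_types, lifting) Dset_def mem_Collect_eq)
  have Bel: "Bel b x z ?y = (if x = x0 \<and> z = z0 then 1 else 0)" if xz: "x \<in> Dset n b" "z \<in> WA n" for x z
  proof -
    obtain g where g: "g \<in> Fil b" "Bel b x z = hadd (Tb (x \<circ> dperm b \<circ> z)) g" using Bel_top[OF xz b] by blast
    have "g ?y = 0" using g(1) neg by (auto simp: Fil_def)
    moreover have "x \<circ> dperm b \<circ> z = ?y \<longleftrightarrow> x = x0 \<and> z = z0" using Dset_decomp_inj[OF xz(1) x0 xz(2) z0 b] by auto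
    ultimately show ?thesis unfolding g(2) hadd_def Tb_def by auto
  qed
  have "(\<Sum>(x, z) \<in> Dset n b \<times> WA n. a x z * Bel b x z ?y) = (\<Sum>p \<in> Dset n b \<times> WA n. if p = (x0, z0) then a x0 z0 else 0)"
  proof (rule sum.cong[OF refl])
    fix p assume "p \<in> Dset n b \<times> WA n"
    then show "(case p of (x, z) \<Rightarrow> a x z * Bel b x z ?y) = (if p = (x0, z0) then a x0 z0 else 0)"
      by (cases p, cases "p = (x0, z0)") (auto simp: Bel)
  qed
  also have "\<dots> = a x0 z0" using finite_Dset x0 z0 by (subst sum.delta) auto
  moreover have "(\<Sum>(x, z) \<in> Dset n b \<times> WA n. a x z * Bel b x z ?y) = 0"
  proof (rule ccontr)
    assume "(\<Sum>(x, z) \<in> Dset n b \<times> WA n. a x z * Bel b x z ?y) \<noteq> 0"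
    then have "negs n ?y < b" using F unfolding Fil_def by blast
    then show False using neg by simp
  qed
  ultimately show ?thesis by simp
qed

lemma Span_zero: "(\<lambda>y. 0) \<in> Span b"
  unfolding Span_def by (intro CollectI exI[of _ "\<lambda>x z. 0"]) auto

lemma Span_add_smult: "f \<in> Span b \<Longrightarrow> g \<in> Span b \<Longrightarrow> (\<lambda>y. s * f y + g y) \<in> Span b"
proof -
  assume "f \<in> Span b" "g \<in> Span b"
  then obtain a a' where "f = (\<lambda>y. \<Sum>(x, z) \<in> Dset n b \<times> WA n. a x z * Bel b x z y)"
    "g = (\<lambda>y. \<Sum>(x, z) \<in> Dset n b \<times> WA n. a' x z * Bel b x z y)" unfolding Span_def by blast
  then show ?thesis unfolding Span_def
    by (intro CollectI exI[of _ "\<lambda>x z. s * a x z + a' x z"])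
      (auto simp: sum_distrib_left sum.distrib[symmetric] algebra_simps intro!: ext sum.cong)
qed

lemma Span_sum: "(\<And>x. x \<in> A \<Longrightarrow> F x \<in> Span b) \<Longrightarrow> (\<lambda>y. \<Sum>x\<in>A. s x * F x y) \<in> Span b"
proof (induction A rule: infinite_finite_induct)
  case (insert x A)
  then show ?case using Span_add_smult[of "F x" b "\<lambda>y. \<Sum>x\<in>A. s x * F x y" "s x"] by simp
qed (simp_all add: Span_zero)

lemma Bel_Span: "x \<in> Dset n b \<Longrightarrow> z \<in> WA n \<Longrightarrow> Bel b x z \<in> Span b"
proof -
  assume a: "x \<in> Dset n b" "z \<in> WA n"
  have "Bel b x z y = (\<Sum>(x', z') \<in> Dset n b \<times> WA n. (if x' = x \<and> z' = z then 1 else 0) * Bel b x' z' y)" for y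
  proof -
    have "(\<Sum>(x', z') \<in> Dset n b \<times> WA n. (if x' = x \<and> z' = z then 1 else 0) * Bel b x' z' y)
      = (\<Sum>p \<in> Dset n b \<times> WA n. if p = (x, z) then Bel b x z y else 0)"
    proof (rule sum.cong[OF refl])
      fix p show "(case p of (x', z') \<Rightarrow> (if x' = x \<and> z' = z then 1 else 0) * Bel b x' z' y) = (if p = (x, z) then Bel b x z y else 0)"
        by (cases p, cases "p = (x, z)") auto
    qed
    also have "\<dots> = Bel b x z y" using finite_Dset a by (subst sum.delta) auto
    finally show ?thesis by simp
  qed
  then show ?thesis unfolding Span_def by (intro CollectI exI[of _ "\<lambda>x' z'. if x' = x \<and> z' = z then 1 else 0"]) auto
qed

lemma app_HA:
  assumes "f \<in> HA n" shows "app X f = (\<lambda>y. \<Sum>z\<in>WA n. f z * app X (Tb z) y)"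
proof
  fix y
  have "app X f y = (\<Sum>z\<in>WB n. f z * app X (Tb z) y)" by (rule HB_expand[OF HA_HB[OF assms]])
  also have "\<dots> = (\<Sum>z\<in>WA n. f z * app X (Tb z) y)"
  proof (rule sum.mono_neutral_right[OF finite_WB WA_subset_WB])
    have "f z = 0" if "z \<notin> WA n" for z using that assms by (auto simp: HA_def)
    then show "\<forall>z \<in> WB n - WA n. f z * app X (Tb z) y = 0" by simp
  qed
  finally show "app X f y = (\<Sum>z\<in>WA n. f z * app X (Tb z) y)" .
qed

lemma TU: "1 \<le> i \<Longrightarrow> i < n \<Longrightarrow> i \<noteq> b \<Longrightarrow> b \<le> n \<Longrightarrow> TT i * U b = U b * TT i"
  unfolding U_def u_scaled using commutes_mult[OF commutes_sc(1) T_u] by (simp add: commutes_def)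

text \<open>If x has a descent i other than b, then T_x = T_(x s_i) T_i, and T_i commutes with u_b,
  so it can be handed over to Z. This shortens x until it lies in \<open>Dset n b\<close>.\<close>

lemma Tw_U_Span:
  assumes b: "b \<le> n" shows "x \<in> WA n \<Longrightarrow> Z \<in> subA \<Longrightarrow> ev (Tw n (v\<^sup>2) x * U b * Z) \<in> Span b"
proof (induction "blen n x" arbitrary: x Z rule: less_induct)
  case less
  have xB: "x \<in> WB n" using less.prems WA_WB by blast
  show ?case
  proof (cases "x \<in> Dset n b")
    case True
    have "ev (Tw n (v\<^sup>2) x * U b * Z) = app (Tw n (v\<^sup>2) x * Er b) (ev (Wr b * Z))"
      unfolding Er(1)[OF b] by (simp add: ev_def)
    also have "\<dots> = (\<lambda>y. \<Sum>z\<in>WA n. ev (Wr b * Z) z * Bel b x z y)"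
      unfolding Bel_def by (intro app_HA ev_HA subA_mult Wr_subA b less.prems)
    also have "\<dots> \<in> Span b" using Bel_Span[OF True] by (intro Span_sum)
    finally show ?thesis .
  next
    case False
    then obtain i where i: "1 \<le> i" "i < n" "i \<noteq> b" "rdes x i" using less.prems by (auto simp: Dset_def)
    let ?x = "x \<circ> sgen i"
    have x': "?x \<in> WA n" "?x \<in> WB n" using less.prems i xB by auto
    have nd: "\<not> rdes ?x i" using rdes_comp_sgen[OF i(2) xB] i by simp
    have "ev (Tw n (v\<^sup>2) ?x * TT i) = Tb x"
      using ev_mult_T[OF Tw_genB[OF x'(2)] ev_Tw[OF x'(2)] x'(2) i(2) nd] by simp
    then have e: "ev (Tw n (v\<^sup>2) x) = ev (Tw n (v\<^sup>2) ?x * TT i)" using ev_Tw[OF xB] by simp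
    have UZ: "U b * Z \<in> gB" using U_genB[OF b] less.prems(2) by (rule genB_mult_subA)
    have "ev (Tw n (v\<^sup>2) x * U b * Z) = hmul n (v\<^sup>2) (ev (Tw n (v\<^sup>2) x)) (ev (U b * Z))"
      using ev_mult[OF Tw_genB[OF xB] UZ] by (simp add: mult.assoc)
    also have "\<dots> = ev (Tw n (v\<^sup>2) ?x * TT i * (U b * Z))"
      unfolding e by (rule ev_mult[OF genB_mult[OF Tw_genB[OF x'(2)] genB_T[OF i(2)]] UZ])
    also have "Tw n (v\<^sup>2) ?x * TT i * (U b * Z) = Tw n (v\<^sup>2) ?x * (TT i * U b) * Z" by (simp add: mult.assoc)
    also have "\<dots> = Tw n (v\<^sup>2) ?x * U b * (TT i * Z)" unfolding TU[OF i(1-3) b] by (simp add: mult.assoc)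
    also have "ev \<dots> \<in> Span b"
      by (rule less.hyps) (use x' i less.prems blen_comp_sgen_des[OF i(2) xB i(4)] in \<open>auto intro!: subA_mult[OF subA_T]\<close>)
    finally show ?thesis .
  qed
qed

lemma U_Span:
  assumes "b \<le> n" "X \<in> subA" "Z \<in> subA" shows "ev (X * U b * Z) \<in> Span b"
proof -
  have UZ: "U b * Z \<in> gB" using U_genB[OF assms(1)] assms(3) by (rule genB_mult_subA)
  let ?S = "\<Sum>w\<in>WA n. lsc (ev X w) * Tw n (v\<^sup>2) w"
  have S: "?S \<in> gB" by (intro genB_sum genB_mult genB_sc Tw_genB WA_WB)
  have "ev ?S = ev X" unfolding ev_sum_Tw[OF WA_subset_WB] using ev_HA[OF assms(2)] by (intro ext) (auto simp: HA_def)
  then have "ev (X * U b * Z) = ev (?S * (U b * Z))"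
    using ev_mult[OF subA_genB[OF assms(2)] UZ] ev_mult[OF S UZ] by (simp add: mult.assoc)
  also have "\<dots> = (\<lambda>y. \<Sum>w\<in>WA n. ev X w * ev (Tw n (v\<^sup>2) w * U b * Z) y)"
    by (rule ext) (simp add: ev_def app_sum hsmult_def)
  also have "\<dots> \<in> Span b" by (intro Span_sum Tw_U_Span assms)
  finally show ?thesis .
qed

lemma q_unit: "v\<^sup>2 ^ i * uinv v ^ (2 * i) = 1"
  using v_vi by (metis power_mult power_mult_distrib power_one)

lemma u_U: "u b = lsc (\<Prod>i<b. uinv v ^ (2 * i)) * U b"
proof -
  have "(\<Prod>i<b. uinv v ^ (2 * i)) * (\<Prod>i<b. v\<^sup>2 ^ i) = 1"
    unfolding prod.distrib[symmetric] using q_unit by (simp add: mult.commute)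
  then show ?thesis unfolding U_def u_scaled by (metis lsc_hom(2,3) mult.assoc mult_1)
qed

lemma u_Span:
  assumes "b \<le> n" "X \<in> subA" "Z \<in> subA" shows "ev (X * u b * Z) \<in> Span b"
proof -
  have "X * u b * Z = (X * lsc (\<Prod>i<b. uinv v ^ (2 * i))) * U b * Z" unfolding u_U by (simp add: mult.assoc)
  then show ?thesis using U_Span[OF assms(1) subA_mult[OF assms(2) subA_sc] assms(3)] by simp
qed

text \<open>Separates the summands with b = a, which have independent leading terms, from those with
  larger b.\<close>

lemma Jr_split: "Y \<in> Jr a \<Longrightarrow> \<exists>Y1 Y2. Y = Y1 + Y2 \<and> ev Y1 \<in> Span a \<and> Y2 \<in> Jr (Suc a)"
proof (induction rule: Jr.induct)
  case Jr_0
  show ?case by (intro exI[of _ 0]) (auto simp: ev_def intro: Span_zero Jr.Jr_0)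
next
  case (Jr_gen x z b)
  show ?case
  proof (cases "a = b")
    case True
    then show ?thesis using Jr_gen u_Span by (intro exI[of _ "x * u b * z"] exI[of _ 0]) (auto intro: Jr.Jr_0)
  next
    case False
    then show ?thesis using Jr_gen
      by (intro exI[of _ 0] exI[of _ "x * u b * z"]) (auto simp: ev_def intro: Span_zero Jr.Jr_gen)
  qed
next
  case (Jr_add x y)
  then obtain x1 x2 y1 y2 where *: "x = x1 + x2" "ev x1 \<in> Span a" "x2 \<in> Jr (Suc a)" "y = y1 + y2" "ev y1 \<in> Span a" "y2 \<in> Jr (Suc a)"
    by blast
  have "ev (x1 + y1) = (\<lambda>u. 1 * ev x1 u + ev y1 u)" by (auto simp: ev_def)
  then have "ev (x1 + y1) \<in> Span a" using Span_add_smult[OF *(2,5), of 1] by simp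
  then show ?case using * by (intro exI[of _ "x1 + y1"] exI[of _ "x2 + y2"]) (auto intro: Jr.Jr_add)
qed

lemma Jr_empty: "Y \<in> Jr (Suc n) \<Longrightarrow> Y = 0"
  by (induction rule: Jr.induct) auto

lemma Span_Fil_zero:
  assumes "f \<in> Span b" "f \<in> Fil b" "b \<le> n" shows "f = (\<lambda>y. 0)"
proof -
  obtain a where a: "f = (\<lambda>y. \<Sum>(x, z) \<in> Dset n b \<times> WA n. a x z * Bel b x z y)" using assms(1) unfolding Span_def by blast
  have "a x z = 0" if "x \<in> Dset n b" "z \<in> WA n" for x z
    using Bel_indep[OF assms(3) _ that] assms(2) unfolding a by blast
  then show ?thesis unfolding a by (intro ext sum.neutral) auto
qed

text \<open>Descending induction from a = n + 1, where the ideal is zero. In a splitting Y = Y1 +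
  Y2, the part Y2 = Y - Y1 lies one filtration step higher and vanishes by induction; then Y1 lies
  both in \<open>Span a\<close> and in \<open>Fil a\<close>, which forces zero.\<close>

lemma Jr_Fil_zero: "a \<le> Suc n \<Longrightarrow> Y \<in> Jr a \<Longrightarrow> ev Y \<in> Fil a \<Longrightarrow> ev Y = (\<lambda>y. 0)"
proof (induction "Suc n - a" arbitrary: a Y)
  case 0
  then have "a = Suc n" by simp
  then have "Y = 0" using Jr_empty 0 by blast
  then show ?case by (simp add: ev_def fun_eq_iff)
next
  case (Suc k)
  have an: "a \<le> n" using Suc.hyps by simp
  obtain Y1 Y2 where Y: "Y = Y1 + Y2" "ev Y1 \<in> Span a" "Y2 \<in> Jr (Suc a)" using Jr_split Suc.prems by blast
  have "ev Y2 = hadd (ev Y) (hsmult (-1) (ev Y1))" unfolding Y(1) by (rule ext) (simp add: ev_def hadd_def hsmult_def)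
  also have "\<dots> \<in> Fil (Suc a)"
    using Suc.prems Span_Fil[OF Y(2) an] by (intro Fil_hadd Fil_hsmult) (auto intro: Fil_mono)
  finally have "ev Y2 = (\<lambda>y. 0)" using Suc.hyps Y(3) an by (intro Suc.hyps(1)[of "Suc a"]) auto
  then have "ev Y = ev Y1" unfolding Y(1) by (auto simp: ev_def fun_eq_iff)
  then show ?case using Span_Fil_zero[OF Y(2) _ an] Suc.prems by simp
qed

text \<open>The injectivity behind the uniqueness of h_m. The element u_m H has at most m negative
  entries in its support, so lying in the ideal of the larger b it vanishes. Independence then gives
  \<open>Wr m * H\<close> = 0 at the unit, and \<open>Wr m\<close> is invertible.\<close>

lemma u_inj:
  assumes m: "m \<le> n" and H: "H \<in> subA" and e: "ev (u m * H) = ev Y" and Y: "Y \<in> Jr (Suc m)"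
  shows "ev H = (\<lambda>y. 0)"
proof -
  have "ev (u m * H) \<in> Fil (Suc m)" using Span_Fil[OF u_Span[OF m subA_1 H] m] by simp
  then have z: "ev (u m * H) = (\<lambda>y. 0)" using Jr_Fil_zero[OF _ Y] e m by simp
  have "ev (U m * H) = (\<lambda>y. 0)"
  proof -
    have "U m * H = lsc (\<Prod>i<m. v\<^sup>2 ^ i) * (u m * H)" unfolding U_def u_scaled by (simp add: mult.assoc)
    then have "ev (U m * H) = hsmult (\<Prod>i<m. v\<^sup>2 ^ i) (ev (u m * H))" by (simp add: ev_def)
    then show ?thesis by (simp add: z hsmult_def)
  qed
  \<comment> \<open>Only x = 1 occurs, with the coefficients of \<open>Wr m * H\<close> in z,
    because u_m = \<open>Er m * Wr m\<close> up to a scalar.\<close>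
  moreover have "ev (U m * H) = (\<lambda>y. \<Sum>(x, z) \<in> Dset n m \<times> WA n. (if x = id then ev (Wr m * H) z else 0) * Bel m x z y)"
  proof
    fix y
    have "ev (U m * H) = app (Tw n (v\<^sup>2) id * Er m) (ev (Wr m * H))"
    proof -
      have "Tw n (v\<^sup>2) id = 1" using redword(2)[OF WB_id[of n]] by (simp add: Tw_def Tword_def)
      then show ?thesis unfolding Er(1)[OF m] by (simp add: ev_def)
    qed
    also have "\<dots> = (\<lambda>y. \<Sum>z\<in>WA n. ev (Wr m * H) z * Bel m id z y)"
      unfolding Bel_def by (intro app_HA ev_HA subA_mult Wr_subA m H)
    finally have "ev (U m * H) y = (\<Sum>z\<in>WA n. ev (Wr m * H) z * Bel m id z y)" by simp
    also have "\<dots> = (\<Sum>x\<in>Dset n m. if x = id then (\<Sum>z\<in>WA n. ev (Wr m * H) z * Bel m id z y) else 0)"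
      using finite_WA id_Dset[of n m] finite_subset[of "Dset n m" "WA n"] by (subst sum.delta) (auto simp: Dset_def)
    also have "\<dots> = (\<Sum>x\<in>Dset n m. \<Sum>z\<in>WA n. (if x = id then ev (Wr m * H) z else 0) * Bel m x z y)"
      by (rule sum.cong) (auto intro!: sum.cong)
    finally show "ev (U m * H) y = (\<Sum>(x, z) \<in> Dset n m \<times> WA n. (if x = id then ev (Wr m * H) z else 0) * Bel m x z y)"
      by (simp add: sum.cartesian_product)
  qed
  ultimately have "(\<lambda>y. \<Sum>(x, z) \<in> Dset n m \<times> WA n. (if x = id then ev (Wr m * H) z else 0) * Bel m x z y) \<in> Fil m"
    using Fil_zero by metis
  from Bel_indep[OF m this id_Dset] have "ev (Wr m * H) z = 0" if "z \<in> WA n" for z using that by auto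
  moreover have "ev (Wr m * H) z = 0" if "z \<notin> WA n" for z
    using that ev_HA[OF subA_mult[OF Wr_subA[OF m] H]] by (auto simp: HA_def)
  ultimately have W: "ev (Wr m * H) = (\<lambda>y. 0)" by blast
  obtain y where y: "y * Wr m = 1" using Wr_unit[OF m] by blast
  have "ev H = app y (ev (Wr m * H))" using y by (simp add: ev_def) (metis app_simps(2,6) mult.assoc mult_1)
  also have "\<dots> = (\<lambda>y. 0)" unfolding W using app_hsmult[of y 0 "\<lambda>_. 0"] by (simp add: hsmult_def)
  finally show ?thesis .
qed

end

section \<open>Translation of the concrete definitions\<close>

text \<open>The exchange of the first k entries with the m that follow, built chain by chain in the
  order in which T_w is factored; k = m gives \<open>wmm\<close>.\<close>

fun wst :: "nat \<Rightarrow> nat \<Rightarrow> int \<Rightarrow> int" where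
  "wst m 0 = id"
| "wst m (Suc k) = wst m k \<circ> word_prod (rev [Suc k..<Suc (m + k)])"

lemma wst_WB: "m + k \<le> n \<Longrightarrow> wst m k \<in> WB n"
  by (induction k) (auto intro!: WB_comp WB_I simp del: upt_Suc)

lemma wst_apply: "p > 0 \<Longrightarrow> wst m k p = (if p \<le> int k then p + int m else if p \<le> int m + int k then p - int k else p)"
proof (induction k arbitrary: p)
  case (Suc k)
  have c: "word_prod (rev [Suc k..<Suc (m + k)]) p =
      (if p = int k + 1 then int m + int k + 1 else if int k + 1 < p \<and> p \<le> int m + int k + 1 then p - 1 else p)"
    using cycle_apply[of "Suc k" "m + k" p] Suc.prems by (simp add: add.commute del: upt_Suc)
  show ?case unfolding wst.simps comp_apply c
    using Suc.IH[of "int m + int k + 1"] Suc.IH[of "p - 1"] Suc.IH[of p] Suc.prems by auto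
qed simp

lemma wst_wmm: "wst m m = wmm m"
proof
  fix p :: int
  have W: "wst m m \<in> WB (2 * m)" by (rule wst_WB) simp
  consider "p = 0" | "p > 0" | "p < 0" by linarith
  then show "wst m m p = wmm m p"
  proof cases
    case 1 then show ?thesis using WB_eq_0_iff[OF W, of 0] by (simp add: wmm_def)
  next
    case 2 then show ?thesis by (simp add: wst_apply wmm_def)
  next
    case 3
    have "wst m m p = - wst m m (- p)" using WB_minus[OF W, of "- p"] by simp
    then show ?thesis using 3 by (simp add: wst_apply wmm_def)
  qed
qed

context hecke_model begin

lemma hprod_ev:
  assumes "\<And>x. x \<in> set xs \<Longrightarrow> F x = ev (G x) \<and> G x \<in> gB"
  shows "hprod n (v\<^sup>2) (map F xs) = ev (prod_list (map G xs))"
proof -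
  have "map F xs = map ev (map G xs)" using assms by simp
  then show ?thesis using ev_prod_list[of "map G xs" n "v\<^sup>2"] assms by (simp only:) auto
qed

lemma Tarc0_ev: "i < n \<Longrightarrow> Tarc0 n (v\<^sup>2) i = ev (t i)"
  unfolding Tarc0_def t_def by (rule hprod_ev) (auto intro!: ev_lgen genB_T)

lemma uplus_ev: "k \<le> n \<Longrightarrow> uplus n (v\<^sup>2) k = ev (U k)"
  unfolding uplus_def U_def
proof (rule hprod_ev)
  fix i assume "k \<le> n" "i \<in> set [0..<k]"
  then have "i < n" by auto
  then show "hadd (hsmult (v\<^sup>2 ^ i) hone) (Tarc0 n (v\<^sup>2) i) = ev (lsc (v\<^sup>2 ^ i) + t i) \<and> lsc (v\<^sup>2 ^ i) + t i \<in> gB"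
    by (auto simp: Tarc0_ev ev_1 ev_lsc_mult ev_add intro!: genB_add genB_sc t_genB)
qed

lemma uminus_ev: "k \<le> n \<Longrightarrow> uminus n (v\<^sup>2) k = ev (prod_list (map (\<lambda>i. lsc (v\<^sup>2 ^ i) - t i) [0..<k]))"
  unfolding uminus_def
proof (rule hprod_ev)
  fix i assume "k \<le> n" "i \<in> set [0..<k]"
  then have "i < n" by auto
  then show "hadd (hsmult (v\<^sup>2 ^ i) hone) (hsmult (-1) (Tarc0 n (v\<^sup>2) i)) = ev (lsc (v\<^sup>2 ^ i) - t i) \<and> lsc (v\<^sup>2 ^ i) - t i \<in> gB"
    by (auto simp: Tarc0_ev ev_1 ev_lsc_mult ev_add sc_minus sc_1 intro!: genB_diff genB_sc t_genB)
qed

lemma Igen_ev: "i < n \<Longrightarrow> Igen n v i = ev (I i)"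
  unfolding Igen_def I_def by (simp add: ev_lgen[of i n "v\<^sup>2"] ev_lsc_mult)

lemma I_genB: "i < n \<Longrightarrow> I i \<in> gB" "i < n \<Longrightarrow> Iv i \<in> gB"
  unfolding Iv_def I_def by (auto intro!: genB_diff genB_mult genB_sc genB_T)

lemma Iplus_dn: "b \<le> a \<Longrightarrow> a < n \<Longrightarrow> Iplus n v a b = ev (dn a b)"
  unfolding Iplus_def Ichain_def dn_def
  by (simp del: upt_Suc) (rule hprod_ev, auto simp: Igen_ev I_genB)

lemma Iplus_up: "a \<le> b \<Longrightarrow> b < n \<Longrightarrow> Iplus n v a b = ev (up a b)"
proof (cases "a = b")
  case True
  then show "b < n \<Longrightarrow> Iplus n v a b = ev (up a b)" using Iplus_dn[of b a] by (simp add: dn_def up_def)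
next
  case False
  then show "a \<le> b \<Longrightarrow> b < n \<Longrightarrow> Iplus n v a b = ev (up a b)"
    unfolding Iplus_def Ichain_def up_def
    by (simp del: upt_Suc) (rule hprod_ev, auto simp: Igen_ev I_genB)
qed

definition upv :: "nat \<Rightarrow> nat \<Rightarrow> 'k lop" where "upv a b = prod_list (map Iv [a..<Suc b])"

lemma chain_genB: "a < n \<Longrightarrow> dn a b \<in> gB" "a < n \<Longrightarrow> up b a \<in> gB" "a < n \<Longrightarrow> upv b a \<in> gB" "a < n \<Longrightarrow> dnv a b \<in> gB"
  unfolding dn_def up_def upv_def dnv_def by (auto intro!: genB_prod_list I_genB simp del: upt_Suc)

lemma dn_upv: "1 \<le> a \<Longrightarrow> a \<le> Suc b \<Longrightarrow> b < n \<Longrightarrow> dn b a * upv a b = 1 \<and> upv a b * dn b a = 1"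
proof (induction "Suc b - a" arbitrary: b)
  case 0
  then have "a = Suc b" by simp
  then show ?case by (simp add: upv_def)
next
  case (Suc k)
  show ?case
  proof (cases b)
    case 0 with Suc show ?thesis by (simp add: upv_def dn_def I_Iv)
  next
    case b: (Suc b')
    have ab: "a \<le> Suc b'" using Suc.hyps b by simp
    have IH: "dn b' a * upv a b' = 1" "upv a b' * dn b' a = 1" using Suc.hyps(1)[of b'] Suc.hyps(2) Suc.prems b ab by auto
    have d: "dn b a = I b * dn b' a" "upv a b = upv a b' * Iv b" using ab unfolding b by (simp_all add: dn_def upv_def)
    have II: "I b * Iv b = 1" "Iv b * I b = 1" using I_Iv Suc.prems b by auto
    have "dn b a * upv a b = I b * (dn b' a * upv a b') * Iv b" "upv a b * dn b a = upv a b' * (Iv b * I b) * dn b' a"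
      unfolding d by (simp_all only: mult.assoc)
    then show ?thesis by (simp add: IH II)
  qed
qed

lemma hinv_ev:
  assumes "X \<in> gB" "Y \<in> gB" "X * Y = 1" "Y * X = 1" shows "hinv n (v\<^sup>2) (ev X) = ev Y"
  unfolding hinv_def
proof (rule the_equality)
  show "ev Y \<in> HB n \<and> hmul n (v\<^sup>2) (ev X) (ev Y) = hone \<and> hmul n (v\<^sup>2) (ev Y) (ev X) = hone"
    using assms by (simp add: gB_HB ev_mult ev_1)
next
  fix b assume b: "b \<in> HB n \<and> hmul n (v\<^sup>2) (ev X) b = hone \<and> hmul n (v\<^sup>2) b (ev X) = hone"
  then have "app X b = hone" using hmul_ev[OF assms(1), of b] by simp
  then have "app (Y * X) b = ev Y" by (simp add: ev_def)
  then show "b = ev Y" using assms(4) by simp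
qed

lemma Iminus_ev: "1 \<le> a \<Longrightarrow> a \<le> b \<Longrightarrow> b < n \<Longrightarrow> Iminus n v a b = ev (upv a b)"
  unfolding Iminus_def using dn_upv[of a b] by (simp add: Iplus_dn hinv_ev chain_genB)

lemma c_genB: "j < n \<Longrightarrow> c a j \<in> gB"
  unfolding c_def by (intro genB_mult chain_genB)

lemma cm_ev: "a + i < n \<Longrightarrow> cm n v a i = ev (c a (a + i))"
proof (cases "i = 0")
  case True then show ?thesis by (simp add: cm_def c_def ev_1)
next
  case False
  then show "a + i < n \<Longrightarrow> cm n v a i = ev (c a (a + i))"
    by (simp add: cm_def c_def Iplus_dn Iplus_up ev_mult chain_genB)
qed

lemma St_chain:
  assumes "a < n" shows "St (up b a) (dn a b)" "St (dn a b) (up b a)" "St (upv b a) (dnv a b)"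
proof -
  have i: "i < n" if "i \<in> set [b..<Suc a]" for i using that assms by auto
  show "St (up b a) (dn a b)" unfolding up_def dn_def by (intro St_prod_list_map St_I i)
  show "St (upv b a) (dnv a b)" unfolding upv_def dnv_def by (intro St_prod_list_map St_Iv i)
  have "St (prod_list (map I (rev [b..<Suc a]))) (prod_list (map I (rev (rev [b..<Suc a]))))"
    by (intro St_prod_list_map St_I i) (simp del: upt_Suc)
  then show "St (dn a b) (up b a)" unfolding up_def dn_def by (simp del: upt_Suc)
qed

lemma St_c: "j < n \<Longrightarrow> St (c a j) (c a j)"
  unfolding c_def by (intro St_mult St_chain)

lemma chains_subA: "m + length eps \<le> n \<Longrightarrow> chains m eps \<in> subA"
  unfolding chains_def by (intro subA_prod_list) (auto intro!: subA_chain)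

text \<open>The chain added at stage k moves position m + k + 1 to the left. Its value m + k + 1
  exceeds the values at most m that it passes, so \<open>ev_chain\<close> applies.\<close>

lemma wst_ev:
  assumes "m + m \<le> n" shows "k \<le> m \<Longrightarrow> ev (prod_list (map (\<lambda>j. prod_list (map TT (rev [Suc j..<Suc (m + j)]))) [0..<k])) = Tb (wst m k)"
proof (induction k)
  case 0 then show ?case by (simp add: ev_1[symmetric] hone_def id_def)
next
  case (Suc k)
  let ?Q = "prod_list (map (\<lambda>j. prod_list (map TT (rev [Suc j..<Suc (m + j)]))) [0..<k])"
  have "ev (?Q * prod_list (map TT (rev [Suc k..<Suc (m + k)]))) = Tb (wst m k \<circ> word_prod (rev [Suc k..<Suc (m + k)]))"
  proof (rule ev_chain)
    show "?Q \<in> gB" using Suc.prems assms by (auto intro!: genB_prod_list genB_T simp del: upt_Suc)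
    show "ev ?Q = Tb (wst m k)" using Suc by simp
    show "wst m k \<in> WB n" using Suc.prems assms by (intro wst_WB) simp
    fix i assume "Suc k \<le> i" "i \<le> m + k"
    then show "wst m k (int i) < wst m k (int (m + k) + 1)" by (simp add: wst_apply)
  qed (use Suc.prems assms in auto)
  then show ?case by (simp del: upt_Suc add: upt_Suc_append comp_def)
qed

lemma dn_T: "b \<le> Suc a \<Longrightarrow> prod_list (map TT (rev [b..<Suc a])) = lsc (v ^ (Suc a - b)) * dn a b"
proof -
  have "prod_list (map TT ws) = lsc (v ^ length ws) * prod_list (map I ws)" for ws
  proof (induction ws)
    case (Cons i ws)
    then show ?case using sc_sc[of v "I i" "v ^ length ws"] by (simp add: T_I[of i] sc_mult)
  qed (simp add: sc_1)
  from this[of "rev [b..<Suc a]"] show ?thesis by (simp add: dn_def del: upt_Suc)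
qed

lemma dns_T: "prod_list (map (\<lambda>j. prod_list (map TT (rev [Suc j..<Suc (m + j)]))) [0..<k])
    = lsc (v ^ (m * k)) * prod_list (map (\<lambda>j. dn (m + j) (Suc j)) [0..<k])"
proof (induction k)
  case (Suc k)
  have "prod_list (map TT (rev [Suc k..<Suc (m + k)])) = lsc (v ^ m) * dn (m + k) (Suc k)"
    using dn_T[of "Suc k" "m + k"] by simp
  moreover have "v ^ (m * k) * v ^ m = v ^ (m * Suc k)" by (simp add: power_add mult.commute)
  ultimately show ?case using Suc sc_sc[of "v ^ (m * k)" _ "v ^ m"] by (simp del: upt_Suc add: upt_Suc_append)
qed (simp add: sc_1)

definition pq :: "nat \<Rightarrow> 'k" where "pq k = (\<Prod>i<k. v\<^sup>2 ^ i)"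

lemma pq_power: "v ^ (m * m) * pq m = v ^ (m * (2 * m - 1))"
proof -
  \<comment> \<open>\<open>pq k\<close> is v^(k(k-1)). The extra v^k avoids truncated subtraction
    and is cancelled afterwards as a unit.\<close>
  have "v ^ k * pq k = v ^ (k * k)" for k
  proof (induction k)
    case (Suc k)
    have "v ^ Suc k * pq (Suc k) = v * (v ^ k * pq k) * v\<^sup>2 ^ k" by (simp add: pq_def mult.assoc)
    also have "\<dots> = v ^ (Suc k * Suc k)" 
    proof -
      have e: "Suc k * Suc k = Suc (k * k + 2 * k)" by simp
      show ?thesis unfolding Suc e by (simp add: power_add power_mult mult.assoc)
    qed
    finally show ?case .
  qed (simp add: pq_def)
  then have "v ^ m * pq m = v ^ (m * m)" .
  have "v ^ m * (v ^ (m * m) * pq m) = v ^ (m * m) * (v ^ m * pq m)" by (simp add: ac_simps)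
  also have "\<dots> = v ^ (m * m + m * m)" by (simp add: \<open>v ^ m * pq m = v ^ (m * m)\<close> power_add)
  also have "m * m + m * m = m + m * (2 * m - 1)" by (cases m) (auto simp: algebra_simps)
  finally have "v ^ m * (v ^ (m * m) * pq m) = v ^ m * v ^ (m * (2 * m - 1))" by (simp add: power_add)
  then have "uinv v ^ m * (v ^ m * (v ^ (m * m) * pq m)) = uinv v ^ m * (v ^ m * v ^ (m * (2 * m - 1)))" by simp
  moreover have "uinv v ^ m * (v ^ m * x) = x" for x
    using v_vi by (simp add: mult.assoc[symmetric] power_mult_distrib[symmetric] mult.commute[of "uinv v"])
  ultimately show ?thesis by simp
qed

lemma pq_unit: "(\<Prod>i<b. uinv v ^ (2 * i)) * pq b = 1"
  unfolding pq_def prod.distrib[symmetric] using q_unit by (simp add: mult.commute)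

lemma U_u: "U b = lsc (pq b) * u b"
  unfolding U_def u_scaled pq_def ..

lemma ev_Jr_Jset:
  assumes "Y \<in> Jr (Suc m)" shows "ev Y \<in> Jset n (v\<^sup>2) m"
  using assms
proof (induction rule: Jr.induct)
  case Jr_0 show ?case unfolding Jset_def by (intro CollectI exI[of _ "[]"]) (auto simp: ev_def)
next
  case (Jr_gen x z b)
  \<comment> \<open>\<open>Jset\<close> is built from the unnormalised u_b^+, so the inverse scalar
    is moved into the left factor.\<close>
  let ?x = "x * lsc (\<Prod>i<b. uinv v ^ (2 * i))"
  have x: "?x \<in> subA" using Jr_gen by (intro subA_mult subA_sc)
  have "x * u b * z = ?x * U b * z" unfolding u_U by (simp add: mult.assoc)
  then have "ev (x * u b * z) = hmul n (v\<^sup>2) (hmul n (v\<^sup>2) (ev ?x) (uplus n (v\<^sup>2) b)) (ev z)"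
    using Jr_gen subA_genB[OF x] by (simp add: uplus_ev ev_mult subA_genB U_genB genB_mult)
  then show ?case unfolding Jset_def
    by (intro CollectI exI[of _ "[(ev ?x, b, ev z)]"]) (use Jr_gen ev_HA[OF x] in \<open>auto simp: ev_HA\<close>)
next
  case (Jr_add x y)
  then obtain xs ys where xs: "\<forall>(x, b, z) \<in> set xs. x \<in> HA n \<and> z \<in> HA n \<and> m < b \<and> b \<le> n"
      "ev x = (\<lambda>y. \<Sum>(x, b, z) \<leftarrow> xs. hmul n (v\<^sup>2) (hmul n (v\<^sup>2) x (uplus n (v\<^sup>2) b)) z y)"
    and ys: "\<forall>(x, b, z) \<in> set ys. x \<in> HA n \<and> z \<in> HA n \<and> m < b \<and> b \<le> n"
      "ev y = (\<lambda>y. \<Sum>(x, b, z) \<leftarrow> ys. hmul n (v\<^sup>2) (hmul n (v\<^sup>2) x (uplus n (v\<^sup>2) b)) z y)"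
    unfolding Jset_def by blast
  show ?case unfolding Jset_def
  proof (intro CollectI exI[of _ "xs @ ys"] conjI)
    show "ev (x + y) = (\<lambda>y. \<Sum>(x, b, z) \<leftarrow> xs @ ys. hmul n (v\<^sup>2) (hmul n (v\<^sup>2) x (uplus n (v\<^sup>2) b)) z y)"
      unfolding ev_add[symmetric] xs(2) ys(2) hadd_def by simp
  qed (use xs(1) ys(1) in auto)
qed

lemma Jset_ex:
  assumes "a \<in> Jset n (v\<^sup>2) m" shows "\<exists>Y \<in> Jr (Suc m). ev Y = a"
proof -
  have "\<exists>Y \<in> Jr (Suc m). ev Y = (\<lambda>y. \<Sum>(x, b, z) \<leftarrow> xs. hmul n (v\<^sup>2) (hmul n (v\<^sup>2) x (uplus n (v\<^sup>2) b)) z y)"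
    if "\<forall>(x, b, z) \<in> set xs. x \<in> HA n \<and> z \<in> HA n \<and> m < b \<and> b \<le> n" for xs
    using that
  proof (induction xs)
    case Nil show ?case by (rule bexI[OF _ Jr_0]) (simp add: ev_def fun_eq_iff)
  next
    case (Cons p xs)
    obtain x b z where p: "p = (x, b, z)" by (cases p)
    obtain Y where Y: "Y \<in> Jr (Suc m)" "ev Y = (\<lambda>y. \<Sum>(x, b, z) \<leftarrow> xs. hmul n (v\<^sup>2) (hmul n (v\<^sup>2) x (uplus n (v\<^sup>2) b)) z y)"
      using Cons by auto
    have b: "m < b" "b \<le> n" and xz: "x \<in> HA n" "z \<in> HA n" using Cons.prems p by auto
    obtain X where X: "X \<in> subA" "ev X = x" using HA_ev_ex[OF xz(1)] by blast
    obtain Z where Z: "Z \<in> subA" "ev Z = z" using HA_ev_ex[OF xz(2)] by blast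
    have "X * U b * Z = (X * lsc (pq b)) * u b * Z" unfolding U_u by (simp add: mult.assoc)
    then have J: "X * U b * Z \<in> Jr (Suc m)" using Jr_gen[OF subA_mult[OF X(1) subA_sc] Z(1), of "Suc m" b] b by simp
    have "hmul n (v\<^sup>2) (hmul n (v\<^sup>2) x (uplus n (v\<^sup>2) b)) z = ev (X * U b * Z)"
      using b X Z by (simp add: uplus_ev ev_mult subA_genB U_genB genB_mult flip: X(2) Z(2))
    then show ?case using J Y p by (intro bexI[of _ "X * U b * Z + Y"]) (auto simp: ev_add[symmetric] hadd_def intro: Jr_add)
  qed
  then show ?thesis using assms unfolding Jset_def by blast
qed

end

section \<open>The closed form of h_m\<close>

context hecke_model begin

definition Hr :: "nat \<Rightarrow> 'k lop" where
  "Hr m = lsc (v ^ (m * (2 * m - 1))) *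
    (\<Sum>eps | length eps = m. prod_list (map (\<lambda>j. c m (m + j)) (minuses eps)) * chains m eps)"

lemma Hr_subA:
  assumes "n = 2 * m" shows "Hr m \<in> subA"
proof -
  have "prod_list (map (\<lambda>j. c m (m + j)) (minuses eps)) \<in> subA" "chains m eps \<in> subA" if "length eps = m" for eps
  proof -
    have "m + j < n" if "j \<in> set (minuses eps)" for j using that \<open>length eps = m\<close> assms by (auto simp: minuses_def)
    then show "prod_list (map (\<lambda>j. c m (m + j)) (minuses eps)) \<in> subA" by (intro subA_prod_list) (auto intro!: subA_c)
    show "chains m eps \<in> subA" by (rule chains_subA) (use that assms in simp)
  qed
  then show ?thesis unfolding Hr_def by (intro subA_mult subA_sc subA_sum) auto
qed

lemma top_identity:
  assumes n: "n = 2 * m"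
  shows "\<exists>Y \<in> Jr (Suc m). hmul n (v\<^sup>2) (hmul n (v\<^sup>2) (uplus n (v\<^sup>2) m) (Tb (wmm m))) (uminus n (v\<^sup>2) m)
    = ev (U m * Hr m + Y)"
proof -
  let ?Q = "prod_list (map (\<lambda>j. dn (m + j) (Suc j)) [0..<m])" and ?N = "prod_list (map (\<lambda>j. 1 - L j) [0..<m])"
  let ?QT = "prod_list (map (\<lambda>j. prod_list (map TT (rev [Suc j..<Suc (m + j)]))) [0..<m])"
  let ?UT = "prod_list (map (\<lambda>i. lsc (v\<^sup>2 ^ i) - t i) [0..<m])"
  let ?S = "\<Sum>eps | length eps = m. prod_list (map (\<lambda>j. c m (m + j)) (minuses eps)) * chains m eps"
  let ?k = "lsc (pq m) * lsc (v ^ (m * (2 * m - 1)))"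
  have mn: "m \<le> n" "m + m \<le> n" using n by auto
  have QT: "?QT \<in> gB" using mn(2) by (auto intro!: genB_prod_list genB_T simp del: upt_Suc)
  have UT: "?UT \<in> gB" using mn(1) by (intro genB_prod_list) (auto intro!: genB_diff genB_sc t_genB)
  have "hmul n (v\<^sup>2) (hmul n (v\<^sup>2) (uplus n (v\<^sup>2) m) (Tb (wmm m))) (uminus n (v\<^sup>2) m) = ev (U m * ?QT * ?UT)"
    unfolding uplus_ev[OF mn(1)] uminus_ev[OF mn(1)] wst_wmm[symmetric] wst_ev[OF mn(2) order_refl, symmetric]
    using U_genB[OF mn(1)] QT UT by (simp add: ev_mult genB_mult)
  also have "U m * ?QT * ?UT = (lsc (pq m) * u m) * (lsc (v ^ (m * m)) * ?Q) * (lsc (pq m) * ?N)"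
    unfolding U_u dns_T u_scaled(2) pq_def ..
  also have "\<dots> = lsc (pq m * (v ^ (m * m) * pq m)) * (u m * (?Q * ?N))"
    unfolding sc_sc by (simp add: mult.assoc)
  \<comment> \<open>One \<open>pq m\<close> stays with u_m to restore \<open>U m\<close>; the other
    joins v^(m*m) to give the power of v in the theorem.\<close>
  also have "\<dots> = ?k * (u m * (?Q * ?N))" unfolding pq_power sc_mult ..
  also have "\<dots> = ?k * (u m * ?S) + ?k * (u m * (?Q * ?N) - u m * ?S)" by (simp add: right_diff_distrib)
  also have "?k * (u m * ?S) = U m * Hr m"
    unfolding U_u Hr_def sc_sc by (simp add: sc_mult)
  finally have e: "hmul n (v\<^sup>2) (hmul n (v\<^sup>2) (uplus n (v\<^sup>2) m) (Tb (wmm m))) (uminus n (v\<^sup>2) m)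
     = ev (U m * Hr m + ?k * (u m * (?Q * ?N) - u m * ?S))" .
  have "?k * (u m * (?Q * ?N) - u m * ?S) * 1 \<in> Jr (Suc m)"
    by (intro Jr_mult u_chains_Ls_cong mn subA_mult subA_sc subA_1)
  then have "?k * (u m * (?Q * ?N) - u m * ?S) \<in> Jr (Suc m)" by simp
  then show ?thesis using e by blast
qed

text \<open>Existence is \<open>top_identity\<close>. For uniqueness, the difference of two
  candidates multiplied by u_m lies in the ideal, and \<open>u_inj\<close> applies.\<close>

lemma hm_ev:
  assumes n: "n = 2 * m" shows "hm m v = ev (Hr m)"
proof -
  let ?lhs = "hmul n (v\<^sup>2) (hmul n (v\<^sup>2) (uplus n (v\<^sup>2) m) (Tb (wmm m))) (uminus n (v\<^sup>2) m)"
  have mn: "m \<le> n" using n by simp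
  obtain Y where Y: "Y \<in> Jr (Suc m)" "?lhs = ev (U m * Hr m + Y)" using top_identity[OF n] by blast
  have mul: "hmul n (v\<^sup>2) (uplus n (v\<^sup>2) m) (ev H) = ev (U m * H)" if "H \<in> subA" for H
    using that mn by (simp add: uplus_ev ev_mult U_genB subA_genB)
  have "(THE h. h \<in> HA n \<and> (\<exists>j \<in> Jset n (v\<^sup>2) m. ?lhs = hadd (hmul n (v\<^sup>2) (uplus n (v\<^sup>2) m) h) j)) = ev (Hr m)"
  proof (rule the_equality, intro conjI)
    show "ev (Hr m) \<in> HA n" by (rule ev_HA[OF Hr_subA[OF n]])
    show "\<exists>j \<in> Jset n (v\<^sup>2) m. ?lhs = hadd (hmul n (v\<^sup>2) (uplus n (v\<^sup>2) m) (ev (Hr m))) j"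
      using ev_Jr_Jset[OF Y(1)] Y(2) mul[OF Hr_subA[OF n]] by (intro bexI[of _ "ev Y"]) (auto simp: ev_add)
  next
    fix h assume h: "h \<in> HA n \<and> (\<exists>j \<in> Jset n (v\<^sup>2) m. ?lhs = hadd (hmul n (v\<^sup>2) (uplus n (v\<^sup>2) m) h) j)"
    then obtain j where j: "j \<in> Jset n (v\<^sup>2) m" "?lhs = hadd (hmul n (v\<^sup>2) (uplus n (v\<^sup>2) m) h) j" by blast
    obtain H where H: "H \<in> subA" "ev H = h" using HA_ev_ex h by blast
    obtain Y' where Y': "Y' \<in> Jr (Suc m)" "ev Y' = j" using Jset_ex[OF j(1)] by blast
    have eq: "ev (U m * H + Y') = ev (U m * Hr m + Y)"
      using j(2) Y(2) mul[OF H(1)] unfolding H(2)[symmetric] Y'(2)[symmetric] by (simp add: ev_add)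
    \<comment> \<open>\<open>u_inj\<close> is about the normalised u_m, so \<open>pq m\<close> is
      attached to the difference and cancelled at the end by \<open>pq_unit\<close>.\<close>
    have "u m * (lsc (pq m) * (H - Hr m)) = U m * H - U m * Hr m"
      unfolding U_u sc_left[of "u m"] by (simp only: mult.assoc right_diff_distrib)
    moreover have "ev (U m * H - U m * Hr m) = ev (Y - Y')"
    proof
      fix y
      have "ev (U m * H) y + ev Y' y = ev (U m * Hr m) y + ev Y y"
        using fun_cong[OF eq, of y] by (simp add: ev_def)
      then have "ev (U m * H) y - ev (U m * Hr m) y = ev Y y - ev Y' y"
        by (simp add: diff_eq_eq eq_diff_eq add.commute diff_add_eq add_diff_eq)
      then show "ev (U m * H - U m * Hr m) y = ev (Y - Y') y" by (simp add: ev_def)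
    qed
    ultimately have "ev (u m * (lsc (pq m) * (H - Hr m))) = ev (Y - Y')" by simp
    then have z: "ev (lsc (pq m) * (H - Hr m)) = (\<lambda>y. 0)"
      by (rule u_inj[OF mn subA_mult[OF subA_sc subA_diff[OF H(1) Hr_subA[OF n]]] _ Jr_diff[OF Y(1) Y'(1)]])
    show "h = ev (Hr m)"
    proof
      fix y
      have "pq m * (h y - ev (Hr m) y) = 0" using fun_cong[OF z, of y] H(2) by (auto simp: ev_def hsmult_def)
      then have "(\<Prod>i<m. uinv v ^ (2 * i)) * (pq m * (h y - ev (Hr m) y)) = 0" by simp
      then show "h y = ev (Hr m) y" unfolding mult.assoc[symmetric] pq_unit by simp
    qed
  qed
  then show ?thesis unfolding hm_def Let_def n by simp
qed

section \<open>Applying the anti-automorphism to the right-hand side\<close>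

lemma rev_upt_reindex: "rev [1..<m+1] = map (\<lambda>j. m - j) [0..<m]"
  by (rule nth_equalityI) (auto simp: rev_nth simp del: upt_Suc)

lemma rev_minuses:
  assumes "length eps = m"
  shows "rev (filter (\<lambda>i. \<not> eps ! (i - 1)) [1..<m+1]) = map (\<lambda>j. m - j) (minuses (rev eps))"
proof -
  have "rev (filter (\<lambda>i. \<not> eps ! (i - 1)) [1..<m+1]) = map (\<lambda>j. m - j) (filter (\<lambda>j. \<not> eps ! (m - j - 1)) [0..<m])"
    unfolding rev_filter rev_upt_reindex filter_map comp_def ..
  also have "filter (\<lambda>j. \<not> eps ! (m - j - 1)) [0..<m] = minuses (rev eps)"
    unfolding minuses_def using assms by (auto intro!: filter_cong simp: rev_nth)
  finally show ?thesis .
qed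

text \<open>The anti-automorphism reverses the factors, which the substitution k = m - j puts back
  into increasing order of j. This is why \<open>rev eps\<close> appears.\<close>

lemma Ieps_St:
  assumes n: "n = 2 * m" and eps: "length eps = m"
  shows "\<exists>X. Ieps m v eps = ev X \<and> St X (chains m (rev eps))"
proof -
  let ?F = "\<lambda>k. if eps ! (k - 1) then up (m + 1 - k) (n - k) else upv (m + 1 - k) (n - k)"
  let ?G = "\<lambda>k. if eps ! (k - 1) then dn (n - k) (m + 1 - k) else dnv (n - k) (m + 1 - k)"
  have "Ieps m v eps = ev (prod_list (map ?F [1..<m+1]))"
    unfolding Ieps_def n[symmetric]
  proof (rule hprod_ev)
    fix k assume "k \<in> set [1..<m+1]"
    then have k: "1 \<le> m + 1 - k" "m + 1 - k \<le> n - k" "n - k < n" using n by auto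
    show "(if eps ! (k - 1) then Iplus n v (m + 1 - k) (n - k) else Iminus n v (m + 1 - k) (n - k)) = ev (?F k) \<and> ?F k \<in> gB"
      using k by (simp add: Iplus_up Iminus_ev chain_genB)
  qed
  moreover have "St (prod_list (map ?F [1..<m+1])) (prod_list (map ?G (rev [1..<m+1])))"
  proof (rule St_prod_list_map)
    fix k assume "k \<in> set [1..<m+1]"
    then have "n - k < n" using n by auto
    then show "St (?F k) (?G k)" by (auto simp: St_chain)
  qed
  moreover have "map ?G (rev [1..<m+1]) = map (\<lambda>j. if rev eps ! j then dn (m + j) (Suc j) else dnv (m + j) (Suc j)) [0..<length (rev eps)]"
    unfolding rev_upt_reindex length_rev eps map_map
  proof (rule map_cong[OF refl])
    fix j assume "j \<in> set [0..<m]"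
    then have j: "n - (m - j) = m + j" "m + 1 - (m - j) = Suc j" "rev eps ! j = eps ! (m - j - 1)"
      using eps n by (auto simp: rev_nth)
    show "(?G \<circ> (\<lambda>j. m - j)) j = (if rev eps ! j then dn (m + j) (Suc j) else dnv (m + j) (Suc j))"
      unfolding comp_apply j ..
  qed
  ultimately show ?thesis unfolding chains_def by (intro exI[of _ "prod_list (map ?F [1..<m+1])"]) (simp only: simp_thms)
qed

text \<open>Each coefficient is a palindrome and hence fixed. The product is reversed, and
  decreasing i means increasing j = m - i, which is the order in
  \<open>minuses (rev eps)\<close>.\<close>

lemma Ceps_St:
  assumes n: "n = 2 * m" and eps: "length eps = m"
  shows "\<exists>X. Ceps m v eps = ev X \<and> St X (prod_list (map (\<lambda>j. c m (m + j)) (minuses (rev eps))))"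
proof -
  let ?l = "filter (\<lambda>i. \<not> eps ! (i - 1)) [1..<m+1]" and ?F = "\<lambda>i. c m (m + (m - i))"
  have i: "m + (m - i) < n" if "i \<in> set ?l" for i using that n by auto
  have "Ceps m v eps = ev (prod_list (map ?F ?l))"
    unfolding Ceps_def n[symmetric] by (rule hprod_ev) (use cm_ev[OF i] c_genB[OF i] in blast)
  moreover have "St (prod_list (map ?F ?l)) (prod_list (map ?F (rev ?l)))"
    by (intro St_prod_list_map St_c i)
  moreover have "map ?F (rev ?l) = map (\<lambda>j. c m (m + j)) (minuses (rev eps))"
    unfolding rev_minuses[OF eps] using eps by (auto simp: minuses_def)
  ultimately show ?thesis by (intro exI[of _ "prod_list (map ?F ?l)"]) (simp only: simp_thms)
qed

lemma St_rhs:
  assumes n: "n = 2 * m"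
  shows "\<exists>X. hsmult (v ^ (m * (2 * m - 1))) (hsum {eps. length eps = m} (\<lambda>eps. hmul n (v\<^sup>2) (Ieps m v eps) (Ceps m v eps)))
     = ev X \<and> St X (Hr m)"
proof -
  have "\<forall>eps. \<exists>X. length eps = m \<longrightarrow> hmul n (v\<^sup>2) (Ieps m v eps) (Ceps m v eps) = ev X \<and>
      St X (prod_list (map (\<lambda>j. c m (m + j)) (minuses (rev eps))) * chains m (rev eps))"
  proof
    fix eps
    show "\<exists>X. length eps = m \<longrightarrow> hmul n (v\<^sup>2) (Ieps m v eps) (Ceps m v eps) = ev X \<and>
      St X (prod_list (map (\<lambda>j. c m (m + j)) (minuses (rev eps))) * chains m (rev eps))"
    proof (cases "length eps = m")
      case True
      obtain X Y where XY: "Ieps m v eps = ev X" "St X (chains m (rev eps))"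
        "Ceps m v eps = ev Y" "St Y (prod_list (map (\<lambda>j. c m (m + j)) (minuses (rev eps))))"
        using Ieps_St[OF n True] Ceps_St[OF n True] by blast
      then have "hmul n (v\<^sup>2) (ev X) (ev Y) = ev (X * Y)" by (intro ev_mult) (simp_all add: St_def)
      then show ?thesis using XY St_mult[OF XY(2,4)] by (intro exI[of _ "X * Y"]) simp
    qed simp
  qed
  then obtain X where X: "\<And>eps. length eps = m \<Longrightarrow> hmul n (v\<^sup>2) (Ieps m v eps) (Ceps m v eps) = ev (X eps)"
    "\<And>eps. length eps = m \<Longrightarrow> St (X eps) (prod_list (map (\<lambda>j. c m (m + j)) (minuses (rev eps))) * chains m (rev eps))"
    by metis
  let ?E = "{eps :: bool list. length eps = m}"
  have "hsum ?E (\<lambda>eps. hmul n (v\<^sup>2) (Ieps m v eps) (Ceps m v eps)) = ev (\<Sum>eps\<in>?E. X eps)"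
    unfolding hsum_def by (rule ext) (auto simp: X(1) ev_def app_sum intro!: sum.cong)
  moreover have "St (lsc (v ^ (m * (2 * m - 1))) * (\<Sum>eps\<in>?E. X eps)) (Hr m)"
  proof -
    have "St (\<Sum>eps\<in>?E. X eps) (\<Sum>eps\<in>?E. prod_list (map (\<lambda>j. c m (m + j)) (minuses (rev eps))) * chains m (rev eps))"
      by (rule St_sum) (simp add: X(2))
    \<comment> \<open>Reversal permutes the sign tuples of length m, so it disappears in the
      sum.\<close>
    moreover have "(\<Sum>eps\<in>?E. prod_list (map (\<lambda>j. c m (m + j)) (minuses (rev eps))) * chains m (rev eps))
        = (\<Sum>eps\<in>?E. prod_list (map (\<lambda>j. c m (m + j)) (minuses eps)) * chains m eps)"
      by (rule sum.reindex_bij_witness[where i = rev and j = rev]) auto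
    ultimately show ?thesis unfolding Hr_def sc_central[of "v ^ (m * (2 * m - 1))" "\<Sum>eps\<in>?E. prod_list (map (\<lambda>j. c m (m + j)) (minuses eps)) * chains m eps"]
      by (intro St_mult St_sc) simp
  qed
  ultimately show ?thesis by (auto simp: ev_lsc_mult)
qed

end

theorem theorem6p8:
  fixes m :: nat and v :: "'k::comm_ring_1"
  assumes "1 \<le> m" and "v dvd 1"
  shows "hstar (2 * m) (v ^ 2) (hm m v) =
    hsmult (v ^ (m * (2 * m - 1)))
      (hsum {eps. length eps = m} (\<lambda>eps. hmul (2 * m) (v ^ 2) (Ieps m v eps) (Ceps m v eps)))"
proof -
  interpret hecke_model "2 * m" v by (rule hecke_model.intro[OF assms(2)])
  obtain X where X: "hsmult (v ^ (m * (2 * m - 1))) (hsum {eps. length eps = m} (\<lambda>eps. hmul (2 * m) (v\<^sup>2) (Ieps m v eps) (Ceps m v eps)))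
     = ev X" "St X (Hr m)" using St_rhs[OF refl] by blast
  have "hstar (2 * m) (v\<^sup>2) (hm m v) = star (ev (Hr m))"
    using hm_ev[OF refl] hstar_ev[OF Hr_subA[OF refl]] by simp
  \<comment> \<open>The right-hand side has image h_m under the involution \<open>star\<close>, so
    it is in turn the image of h_m.\<close>
  also have "\<dots> = star (star (ev X))" using X(2) by (simp add: St_def)
  also have "\<dots> = ev X" by (rule star_star[OF gB_HB(2)]) (use X(2) in \<open>simp add: St_def\<close>)
  finally show ?thesis using X(1) by simp
qed

end
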